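(* Let $(\mathcal{S},\Delta)$ be a compact quantum group whose Haar state is faithful on $\mathcal{S}$, let $X$ be a compact (Hausdorff) space, and suppose that $\mathcal{S}$ acts faithfully on the $C^*$-algebra $C(X)$. Then $\mathcal{S}$ must be a Kac algebra.
   Context: A compact quantum group (CQG) is a unital $C^*$-algebra $\mathcal{S}$ with a coassociative coproduct, i.e. a unital $*$-homomorphism $\Delta:\mathcal{S}\to\mathcal{S}\otimes\mathcal{S}$ (injective, i.e. minimal, tensor product), such that the linear spans of $\Delta(\mathcal{S})(\mathcal{S}\otimes 1)$ and $\Delta(\mathcal{S})(1\otimes\mathcal{S})$ are norm-dense in $\mathcal{S}\otimes\mathcal{S}$. $\mathcal{S}_0$ denotes the canonical norm-dense Hopf $*$-algebra generated by the matrix coefficients of the finite-dimensional irreducible unitary representations of $\mathcal{S}$, with antipode $\kappa$ and counit $\epsilon$. The Haar state is the unique state $h$ on $\mathcal{S}$ with $(\mathrm{id}\otimes h)\Delta(a)=(h\otimes\mathrm{id})\Delta(a)=h(a)1$ for all $a\in\mathcal{S}$; it need not be faithful on $\mathcal{S}$ in general. $\mathcal{S}$ is called a Kac algebra if $h$ is tracial, i.e. $h(ab)=h(ba)$ for all $a,b\in\mathcal{S}$; this is known to be equivalent to $\kappa^2=\mathrm{id}$ on $\mathcal{S}_0$. An action of a CQG $\mathcal{S}$ on a unital $C^*$-algebra $\mathcal{C}$ is a unital $*$-homomorphism $\beta:\mathcal{C}\to\mathcal{C}\otimes\mathcal{S}$ such that $(\beta\otimes\mathrm{id})\circ\beta=(\mathrm{id}\otimes\Delta)\circ\beta$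 and the linear span of $\beta(\mathcal{C})(1\otimes\mathcal{S})$ is norm-dense in $\mathcal{C}\otimes\mathcal{S}$. The action $\beta$ is faithful if the $*$-subalgebra of $\mathcal{S}$ generated by the elements $(\omega\otimes\mathrm{id})(\beta(a))$, with $a\in\mathcal{C}$ and $\omega$ a bounded linear functional on $\mathcal{C}$, is norm-dense in $\mathcal{S}$. *)

theory Defs
  imports "HOL-Analysis.Analysis"
begin

section \<open>Unital $C^*$-algebras\<close>

text \<open>
  The algebras are nonzero, since \<open>real_normed_algebra_1\<close> contains \<open>0 \<noteq> 1\<close> and \<open>norm 1 = 1\<close>.
\<close>

class unital_cstar_algebra = real_normed_algebra_1 + banach +
  fixes scaleC :: "complex \<Rightarrow> 'a \<Rightarrow> 'a"  (infixr \<open>*\<^sub>C\<close> 75)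
    and star :: "'a \<Rightarrow> 'a"
  assumes scaleC_add_right: "c *\<^sub>C (x + y) = c *\<^sub>C x + c *\<^sub>C y"
    and scaleC_add_left: "(c + d) *\<^sub>C x = c *\<^sub>C x + d *\<^sub>C x"
    and scaleC_scaleC: "c *\<^sub>C d *\<^sub>C x = (c * d) *\<^sub>C x"
    and scaleR_scaleC: "r *\<^sub>R x = complex_of_real r *\<^sub>C x"
    and mult_scaleC_left: "(c *\<^sub>C x) * y = c *\<^sub>C (x * y)"
    and mult_scaleC_right: "x * (c *\<^sub>C y) = c *\<^sub>C (x * y)"
    and norm_scaleC: "norm (c *\<^sub>C x) = cmod c * norm x"
    and star_star: "star (star x) = x"
    and star_add: "star (x + y) = star x + star y"
    and star_scaleC: "star (c *\<^sub>C x) = cnj c *\<^sub>C star x"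
    and star_mult: "star (x * y) = star y * star x"
    and cstar_identity: "norm (star x * x) = (norm x)\<^sup>2"

global_interpretation complex_vector:
  vector_space "scaleC :: complex \<Rightarrow> 'a \<Rightarrow> 'a :: unital_cstar_algebra"
proof
  show "1 *\<^sub>C x = x" for x :: 'a
    using scaleR_scaleC[of 1 x] by simp
qed (simp_all add: scaleC_add_right scaleC_add_left scaleC_scaleC)

abbreviation clinear ::
  "('a :: unital_cstar_algebra \<Rightarrow> 'b :: unital_cstar_algebra) \<Rightarrow> bool"
  where "clinear \<equiv> Vector_Spaces.linear scaleC scaleC"

definition bounded_clinear ::
  "('a :: unital_cstar_algebra \<Rightarrow> 'b :: unital_cstar_algebra) \<Rightarrow> bool"
  where "bounded_clinear f \<longleftrightarrow> clinear f \<and> bounded_linear f"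

lemma norm_star [simp]: "norm (star x) = norm (x :: 'a :: unital_cstar_algebra)"
proof -
  have le: "norm y \<le> norm (star y)" for y :: 'a
  proof (cases "y = 0")
    case False
    have "norm y * norm y \<le> norm (star y) * norm y"
      using norm_mult_ineq[of "star y" y] by (simp add: cstar_identity power2_eq_square)
    with False show ?thesis by simp
  qed simp
  show ?thesis
    using le[of x] le[of "star x"] by (simp add: star_star)
qed

lemma bounded_linear_star: "bounded_linear (star :: 'a \<Rightarrow> 'a :: unital_cstar_algebra)"
  by (rule bounded_linear_intro[where K = 1])
     (simp_all add: star_add scaleR_scaleC star_scaleC)

lemma bounded_linear_scaleC: "bounded_linear (scaleC c :: 'a \<Rightarrow> 'a :: unital_cstar_algebra)"
  by (rule bounded_linear_intro[where K = "cmod c"])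
     (simp_all add: scaleC_add_right scaleR_scaleC scaleC_scaleC norm_scaleC mult.commute)

instantiation complex :: unital_cstar_algebra
begin

definition scaleC_complex :: "complex \<Rightarrow> complex \<Rightarrow> complex"
  where "scaleC_complex = (*)"

definition star_complex :: "complex \<Rightarrow> complex"
  where "star_complex = cnj"

instance
  by standard
     (simp_all add: scaleC_complex_def star_complex_def algebra_simps scaleR_conv_of_real
        norm_mult power2_eq_square)

end


section \<open>The $C^*$-algebra of bounded continuous functions\<close>

text \<open>
  For compact \<open>'x\<close> the type \<open>'x \<Rightarrow>\<^sub>C complex\<close> is the algebra of all continuous functions on \<open>'x\<close>.
  The library has its completeness only for metric domains; this instance replaces that one.
\<close>

unbundle bcontfun.lifting

instance bcontfun :: (topological_space, complete_space) complete_space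
proof
  fix f :: "nat \<Rightarrow> ('a, 'b) bcontfun"
  assume "Cauchy f"
  then obtain g where "uniform_limit UNIV f g sequentially"
    using uniformly_convergent_eq_cauchy[of "\<lambda>_. True" f]
    unfolding Cauchy_def uniform_limit_sequentially_iff
    by (metis dist_fun_lt_imp_dist_val_lt)
  from uniform_limit_bcontfunE[OF this sequentially_bot]
  obtain l where "f \<longlonglongrightarrow> l" by metis
  then show "convergent f" by (rule convergentI)
qed

instance bcontfun :: (topological_space, banach) banach ..

instantiation bcontfun :: (topological_space, unital_cstar_algebra) unital_cstar_algebra
begin

lift_definition one_bcontfun :: "'a \<Rightarrow>\<^sub>C 'b" is "\<lambda>_. 1"
  by (rule const_bcontfun)

lift_definition times_bcontfun :: "('a \<Rightarrow>\<^sub>C 'b) \<Rightarrow> ('a \<Rightarrow>\<^sub>C 'b) \<Rightarrow> 'a \<Rightarrow>\<^sub>C 'b"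
  is "\<lambda>f g x. f x * g x"
proof -
  fix f g :: "'a \<Rightarrow> 'b"
  assume "f \<in> bcontfun" "g \<in> bcontfun"
  then obtain B C where f: "continuous_on UNIV f" "\<And>x. norm (f x) \<le> B"
    and g: "continuous_on UNIV g" "\<And>x. norm (g x) \<le> C"
    by (auto simp: bcontfun_def bounded_iff)
  have "norm (f x * g x) \<le> B * C" for x
    by (rule order_trans[OF norm_mult_ineq mult_mono])
       (use f(2) g(2) order_trans[OF norm_ge_zero f(2)] in auto)
  then show "(\<lambda>x. f x * g x) \<in> bcontfun"
    by (intro bcontfun_normI continuous_on_mult f(1) g(1))
qed

lift_definition scaleC_bcontfun :: "complex \<Rightarrow> ('a \<Rightarrow>\<^sub>C 'b) \<Rightarrow> 'a \<Rightarrow>\<^sub>C 'b"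
  is "\<lambda>c f x. c *\<^sub>C f x"
  by (auto simp: bcontfun_def image_image[symmetric]
        intro!: bounded_linear.continuous_on[OF bounded_linear_scaleC]
          bounded_linear_image[OF _ bounded_linear_scaleC])

lift_definition star_bcontfun :: "('a \<Rightarrow>\<^sub>C 'b) \<Rightarrow> 'a \<Rightarrow>\<^sub>C 'b"
  is "\<lambda>f x. star (f x)"
  by (auto simp: bcontfun_def image_image[symmetric]
        intro!: bounded_linear.continuous_on[OF bounded_linear_star]
          bounded_linear_image[OF _ bounded_linear_star])

instance
proof
  fix f g h :: "'a \<Rightarrow>\<^sub>C 'b" and c d :: complex and r :: real
  note rep = times_bcontfun.rep_eq one_bcontfun.rep_eq scaleC_bcontfun.rep_eq
    star_bcontfun.rep_eq
  show "f * g * h = f * (g * h)"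
    by (rule bcontfun_eqI) (simp add: rep mult.assoc)
  show "1 * f = f" "f * 1 = f"
    by (rule bcontfun_eqI, simp add: rep)+
  show "(f + g) * h = f * h + g * h" "f * (g + h) = f * g + f * h"
    by (rule bcontfun_eqI, simp add: rep algebra_simps)+
  show "(0 :: 'a \<Rightarrow>\<^sub>C 'b) \<noteq> 1"
  proof
    assume "(0 :: 'a \<Rightarrow>\<^sub>C 'b) = 1"
    then have "apply_bcontfun (0 :: 'a \<Rightarrow>\<^sub>C 'b) undefined = apply_bcontfun 1 undefined" by simp
    then show False by (simp add: rep)
  qed
  show "r *\<^sub>R f * g = r *\<^sub>R (f * g)" "f * r *\<^sub>R g = r *\<^sub>R (f * g)"
    by (rule bcontfun_eqI, simp add: rep)+
  show "norm (f * g) \<le> norm f * norm g"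
    by (rule norm_bound)
       (auto simp: rep intro!: order_trans[OF norm_mult_ineq] mult_mono norm_bounded)
  show "norm (1 :: 'a \<Rightarrow>\<^sub>C 'b) = 1"
  proof (rule antisym)
    show "norm (1 :: 'a \<Rightarrow>\<^sub>C 'b) \<le> 1"
      by (rule norm_bound) (simp add: rep)
    show "1 \<le> norm (1 :: 'a \<Rightarrow>\<^sub>C 'b)"
      using norm_bounded[of "1 :: 'a \<Rightarrow>\<^sub>C 'b" undefined] by (simp add: rep)
  qed
  show "c *\<^sub>C (f + g) = c *\<^sub>C f + c *\<^sub>C g"
    by (rule bcontfun_eqI) (simp add: rep scaleC_add_right)
  show "(c + d) *\<^sub>C f = c *\<^sub>C f + d *\<^sub>C f"
    by (rule bcontfun_eqI) (simp add: rep scaleC_add_left)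
  show "c *\<^sub>C d *\<^sub>C f = (c * d) *\<^sub>C f"
    by (rule bcontfun_eqI) (simp add: rep scaleC_scaleC)
  show "r *\<^sub>R f = complex_of_real r *\<^sub>C f"
    by (rule bcontfun_eqI) (simp add: rep scaleR_scaleC)
  show "c *\<^sub>C f * g = c *\<^sub>C (f * g)" "f * c *\<^sub>C g = c *\<^sub>C (f * g)"
    by (rule bcontfun_eqI, simp add: rep mult_scaleC_left mult_scaleC_right)+
  show "star (star f) = f" "star (f + g) = star f + star g"
    "star (c *\<^sub>C f) = cnj c *\<^sub>C star f" "star (f * g) = star g * star f"
    by (rule bcontfun_eqI, simp add: rep star_star star_add star_scaleC star_mult)+
  have le: "norm (c *\<^sub>C f) \<le> cmod c * norm f" for c and f :: "'a \<Rightarrow>\<^sub>C 'b"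
    by (rule norm_bound) (simp add: rep norm_scaleC mult_left_mono norm_bounded)
  show "norm (c *\<^sub>C f) = cmod c * norm f"
  proof (cases "c = 0")
    case True
    then show ?thesis using le[of c f] by simp
  next
    case False
    have "inverse c *\<^sub>C c *\<^sub>C f = f"
      using False by (intro bcontfun_eqI) (simp add: rep)
    then have "norm f \<le> inverse (cmod c) * norm (c *\<^sub>C f)"
      using le[of "inverse c" "c *\<^sub>C f"] by (simp add: norm_inverse)
    with False have "cmod c * norm f \<le> norm (c *\<^sub>C f)"
      by (simp add: field_simps)
    with le[of c f] show ?thesis by simp
  qed
  show "norm (star f * f) = (norm f)\<^sup>2"
  proof (rule antisym)
    show "norm (star f * f) \<le> (norm f)\<^sup>2"
      by (rule norm_bound) (simp add: rep cstar_identity power_mono norm_bounded)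
    have "norm (apply_bcontfun f x) \<le> sqrt (norm (star f * f))" for x
      using norm_bounded[of "star f * f" x]
      by (intro real_le_rsqrt) (simp add: rep cstar_identity)
    then have "norm f \<le> sqrt (norm (star f * f))"
      by (rule norm_bound)
    then show "(norm f)\<^sup>2 \<le> norm (star f * f)"
      using power_mono[of "norm f" _ 2] by fastforce
  qed
qed

end


section \<open>States and homomorphisms\<close>

definition unital_star_hom ::
  "('a :: unital_cstar_algebra \<Rightarrow> 'b :: unital_cstar_algebra) \<Rightarrow> bool"
  where "unital_star_hom f \<longleftrightarrow> clinear f \<and> f 1 = 1 \<and>
    (\<forall>x y. f (x * y) = f x * f y) \<and> (\<forall>x. f (star x) = star (f x))"

definition is_state :: "('a :: unital_cstar_algebra \<Rightarrow> complex) \<Rightarrow> bool"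
  where "is_state \<phi> \<longleftrightarrow> clinear \<phi> \<and> (\<forall>x. \<phi> (star x * x) \<in> \<real>\<^sub>\<ge>\<^sub>0) \<and> \<phi> 1 = 1"

definition faithful_functional :: "('a :: unital_cstar_algebra \<Rightarrow> complex) \<Rightarrow> bool"
  where "faithful_functional \<phi> \<longleftrightarrow> (\<forall>x. \<phi> (star x * x) = 0 \<longrightarrow> x = 0)"

definition tracial :: "('a :: unital_cstar_algebra \<Rightarrow> complex) \<Rightarrow> bool"
  where "tracial \<phi> \<longleftrightarrow> (\<forall>x y. \<phi> (x * y) = \<phi> (y * x))"

definition star_subalgebra :: "'a :: unital_cstar_algebra set \<Rightarrow> bool"
  where "star_subalgebra A \<longleftrightarrow> complex_vector.subspace A \<and>
    (\<forall>x\<in>A. \<forall>y\<in>A. x * y \<in> A) \<and> (\<forall>x\<in>A. star x \<in> A)"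


section \<open>The minimal tensor product\<close>

text \<open>
  A list \<open>[(a\<^sub>1, b\<^sub>1), \<dots>, (a\<^sub>n, b\<^sub>n)]\<close> represents the element
  \<open>a\<^sub>1 \<otimes> b\<^sub>1 + \<dots> + a\<^sub>n \<otimes> b\<^sub>n\<close> of an algebraic tensor product.

  The spatial norm of such an element is its operator norm on \<open>H \<otimes> K\<close>, where \<open>H\<close> and \<open>K\<close> carry the
  universal representations, i.e. the direct sums of the GNS representations of all states. It is
  thus the supremum, over states \<open>\<phi>\<close> and \<open>\<psi>\<close>, of its norm on \<open>H\<^sub>\<phi> \<otimes> H\<^sub>\<psi>\<close>. The classes of elements of
  the algebras are dense in \<open>H\<^sub>\<phi>\<close> and \<open>H\<^sub>\<psi>\<close>, with inner product \<open>\<langle>a, c\<rangle> = \<phi> (star c * a)\<close> and with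
  the algebra acting by left multiplication, so this norm can be computed on lists of pairs.
\<close>

definition gns_inner ::
  "('a :: unital_cstar_algebra \<Rightarrow> complex) \<Rightarrow> ('b :: unital_cstar_algebra \<Rightarrow> complex) \<Rightarrow>
    ('a \<times> 'b) list \<Rightarrow> ('a \<times> 'b) list \<Rightarrow> complex"
  where "gns_inner \<phi> \<psi> vs ws =
    (\<Sum>(a, b)\<leftarrow>vs. \<Sum>(c, d)\<leftarrow>ws. \<phi> (star c * a) * \<psi> (star d * b))"

definition tensor_mult :: "('a :: times \<times> 'b :: times) list \<Rightarrow> ('a \<times> 'b) list \<Rightarrow> ('a \<times> 'b) list"
  where "tensor_mult us vs = [(a * c, b * d). (a, b) \<leftarrow> us, (c, d) \<leftarrow> vs]"

definition spatial_norm ::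
  "('a :: unital_cstar_algebra \<times> 'b :: unital_cstar_algebra) list \<Rightarrow> real"
  where "spatial_norm us =
    Sup {sqrt (Re (gns_inner \<phi> \<psi> (tensor_mult us vs) (tensor_mult us vs))) |\<phi> \<psi> vs.
      is_state \<phi> \<and> is_state \<psi> \<and> Re (gns_inner \<phi> \<psi> vs vs) \<le> 1}"

text \<open>
  \<open>min_tensor t\<close> says that \<open>'c\<close>, with \<open>t a b\<close> in the role of \<open>a \<otimes> b\<close>, is the completion of the
  algebraic tensor product of \<open>'a\<close> and \<open>'b\<close> in the spatial norm. This determines \<open>'c\<close> up to a unique
  isomorphism respecting elementary tensors. Injectivity on the algebraic tensor product follows
  from the norm condition, as the spatial norm is a norm there.
\<close>

definition min_tensor ::
  "('a :: unital_cstar_algebra \<Rightarrow> 'b :: unital_cstar_algebra \<Rightarrow> 'c :: unital_cstar_algebra) \<Rightarrow> bool"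
  where "min_tensor t \<longleftrightarrow>
    (\<forall>a. clinear (t a)) \<and> (\<forall>b. clinear (\<lambda>a. t a b)) \<and>
    t 1 1 = 1 \<and>
    (\<forall>a b c d. t a b * t c d = t (a * c) (b * d)) \<and>
    (\<forall>a b. star (t a b) = t (star a) (star b)) \<and>
    (\<forall>us. norm (\<Sum>(a, b)\<leftarrow>us. t a b) = spatial_norm us) \<and>
    closure (complex_vector.span {t a b |a b. True}) = UNIV"

text \<open>
  The maps \<open>f \<otimes> g\<close>, \<open>\<omega> \<otimes> id\<close> and \<open>id \<otimes> \<omega>\<close> exist for minimal tensor products and are determined by
  their values on elementary tensors; they are described by the relations below.
\<close>

definition tensor_hom ::
  "('a :: unital_cstar_algebra \<Rightarrow> 'b :: unital_cstar_algebra \<Rightarrow> 'c :: unital_cstar_algebra) \<Rightarrow>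
   ('a' :: unital_cstar_algebra \<Rightarrow> 'b' :: unital_cstar_algebra \<Rightarrow> 'c' :: unital_cstar_algebra) \<Rightarrow>
   ('a \<Rightarrow> 'a') \<Rightarrow> ('b \<Rightarrow> 'b') \<Rightarrow> ('c \<Rightarrow> 'c') \<Rightarrow> bool"
  where "tensor_hom t t' f g F \<longleftrightarrow> unital_star_hom F \<and> (\<forall>a b. F (t a b) = t' (f a) (g b))"

definition left_slice ::
  "('a :: unital_cstar_algebra \<Rightarrow> 'b :: unital_cstar_algebra \<Rightarrow> 'c :: unital_cstar_algebra) \<Rightarrow>
   ('a \<Rightarrow> complex) \<Rightarrow> ('c \<Rightarrow> 'b) \<Rightarrow> bool"
  where "left_slice t \<omega> E \<longleftrightarrow> bounded_clinear E \<and> (\<forall>a b. E (t a b) = \<omega> a *\<^sub>C b)"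

definition right_slice ::
  "('a :: unital_cstar_algebra \<Rightarrow> 'b :: unital_cstar_algebra \<Rightarrow> 'c :: unital_cstar_algebra) \<Rightarrow>
   ('b \<Rightarrow> complex) \<Rightarrow> ('c \<Rightarrow> 'a) \<Rightarrow> bool"
  where "right_slice t \<omega> E \<longleftrightarrow> bounded_clinear E \<and> (\<forall>a b. E (t a b) = \<omega> b *\<^sub>C a)"

text \<open>
  \<open>'abc\<close> is a threefold tensor product, presented both as \<open>(A \<otimes> B) \<otimes> C\<close> and as \<open>A \<otimes> (B \<otimes> C)\<close>.
\<close>

definition min_tensor3 ::
  "('a :: unital_cstar_algebra \<Rightarrow> 'b :: unital_cstar_algebra \<Rightarrow> 'ab :: unital_cstar_algebra) \<Rightarrow>
   ('b \<Rightarrow> 'c :: unital_cstar_algebra \<Rightarrow> 'bc :: unital_cstar_algebra) \<Rightarrow>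
   ('ab \<Rightarrow> 'c \<Rightarrow> 'abc :: unital_cstar_algebra) \<Rightarrow> ('a \<Rightarrow> 'bc \<Rightarrow> 'abc) \<Rightarrow> bool"
  where "min_tensor3 ab bc ab_c a_bc \<longleftrightarrow>
    min_tensor ab \<and> min_tensor bc \<and> min_tensor ab_c \<and> min_tensor a_bc \<and>
    (\<forall>a b c. ab_c (ab a b) c = a_bc a (bc b c))"


section \<open>Compact quantum groups and their actions\<close>

locale compact_quantum_group =
  fixes ss :: "'s :: unital_cstar_algebra \<Rightarrow> 's \<Rightarrow> 'ss :: unital_cstar_algebra"
    and ss_s :: "'ss \<Rightarrow> 's \<Rightarrow> 'sss :: unital_cstar_algebra"
    and s_ss :: "'s \<Rightarrow> 'ss \<Rightarrow> 'sss"
    and \<Delta> :: "'s \<Rightarrow> 'ss"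
  assumes tensors: "min_tensor3 ss ss ss_s s_ss"
    and coproduct_hom: "unital_star_hom \<Delta>"
    and coassociative: "\<exists>F G. tensor_hom ss ss_s \<Delta> id F \<and> tensor_hom ss s_ss id \<Delta> G \<and>
      F \<circ> \<Delta> = G \<circ> \<Delta>"
    and cancellation_left: "closure (complex_vector.span {\<Delta> a * ss b 1 |a b. True}) = UNIV"
    and cancellation_right: "closure (complex_vector.span {\<Delta> a * ss 1 b |a b. True}) = UNIV"

definition haar_state ::
  "('s :: unital_cstar_algebra \<Rightarrow> 's \<Rightarrow> 'ss :: unital_cstar_algebra) \<Rightarrow> ('s \<Rightarrow> 'ss) \<Rightarrow>
   ('s \<Rightarrow> complex) \<Rightarrow> bool"
  where "haar_state ss \<Delta> h \<longleftrightarrow> is_state h \<and>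
    (\<exists>L R. left_slice ss h L \<and> right_slice ss h R \<and>
      (\<forall>a. R (\<Delta> a) = h a *\<^sub>C 1 \<and> L (\<Delta> a) = h a *\<^sub>C 1))"

text \<open>
  There is at most one Haar state, so the quantifier below refers to the Haar state.
\<close>

definition kac_algebra ::
  "('s :: unital_cstar_algebra \<Rightarrow> 's \<Rightarrow> 'ss :: unital_cstar_algebra) \<Rightarrow> ('s \<Rightarrow> 'ss) \<Rightarrow> bool"
  where "kac_algebra ss \<Delta> \<longleftrightarrow> (\<exists>h. haar_state ss \<Delta> h \<and> tracial h)"

locale cqg_action = compact_quantum_group ss ss_s s_ss \<Delta>
  for ss :: "'s :: unital_cstar_algebra \<Rightarrow> 's \<Rightarrow> 'ss :: unital_cstar_algebra"
    and ss_s :: "'ss \<Rightarrow> 's \<Rightarrow> 'sss :: unital_cstar_algebra"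
    and s_ss :: "'s \<Rightarrow> 'ss \<Rightarrow> 'sss"
    and \<Delta> :: "'s \<Rightarrow> 'ss" +
  fixes cs :: "'c :: unital_cstar_algebra \<Rightarrow> 's \<Rightarrow> 'cs :: unital_cstar_algebra"
    and cs_s :: "'cs \<Rightarrow> 's \<Rightarrow> 'css :: unital_cstar_algebra"
    and c_ss :: "'c \<Rightarrow> 'ss \<Rightarrow> 'css"
    and \<beta> :: "'c \<Rightarrow> 'cs"
  assumes action_tensors: "min_tensor3 cs ss cs_s c_ss"
    and action_hom: "unital_star_hom \<beta>"
    and action_coassociative: "\<exists>F G. tensor_hom cs cs_s \<beta> id F \<and> tensor_hom cs c_ss id \<Delta> G \<and>
      F \<circ> \<beta> = G \<circ> \<beta>"
    and action_density: "closure (complex_vector.span {\<beta> a * cs 1 s |a s. True}) = UNIV"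

definition faithful_action ::
  "('c :: unital_cstar_algebra \<Rightarrow> 's :: unital_cstar_algebra \<Rightarrow> 'cs :: unital_cstar_algebra) \<Rightarrow>
   ('c \<Rightarrow> 'cs) \<Rightarrow> bool"
  where "faithful_action cs \<beta> \<longleftrightarrow>
    closure (star_subalgebra hull
      {E (\<beta> a) |E a. \<exists>\<omega>. bounded_clinear \<omega> \<and> left_slice cs \<omega> E}) = UNIV"

end

theory Submission
  imports Defs
begin

text \<open>
  Let \<open>K \<subseteq> S\<close> be the image of \<open>C(X)\<close> under \<open>(ev\<^sub>x \<otimes> id)\<beta>\<close>. It is a commutative right coideal, and
  the elements \<open>a\<close> with \<open>h(a b) = h(b a)\<close> for all \<open>b\<close> form a closed \<open>*\<close>-subalgebra, so by faithfulness of
  the action it suffices to show that \<open>K\<close> consists of such elements.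

  Put \<open>P(f \<otimes> b) = f\<^sub>1 h(f\<^sub>2 b)\<close> and \<open>Q(f \<otimes> b) = f\<^sub>1 h(b f\<^sub>2)\<close> for \<open>f \<in> K\<close>, \<open>b \<in> S\<close>, as operators
  \<open>L\<^sup>2(K) \<otimes> L\<^sup>2(S) \<rightarrow> L\<^sup>2(K)\<close>. Then \<open>P\<close> is a coisometry for every right coideal, while commutativity makes
  \<open>Q\<close> a contraction with \<open>Q P\<^sup>* = 1\<close> (this replaces \<open>\<kappa>\<^sup>2 = id\<close>). A contractive left inverse of the isometry
  \<open>P\<^sup>*\<close> equals \<open>P\<close>, hence \<open>f\<^sub>1 h(f\<^sub>2 b) = f\<^sub>1 h(b f\<^sub>2)\<close>. Finally \<open>y = h(g\<^sub>1 b) g\<^sub>2 - h(b g\<^sub>1) g\<^sub>2\<close> is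
  orthogonal to all \<open>h(u g\<^sub>1) g\<^sub>2\<close> with \<open>u \<in> K\<close>, which forces \<open>y = 0\<close>; this transfers the identity to the
  other leg of \<open>\<Delta>(g)\<close>, and elements \<open>g\<^sub>1 h(g\<^sub>2 c)\<close> span a dense subspace of \<open>K\<close>.

  Neither the Hopf algebra of matrix coefficients nor its antipode is used. Since \<open>P\<^sup>*\<close> does not map
  into algebraic tensor products, its values are handled as limits of algebraic tensors.
\<close>

text \<open>Let \<open>V\<close> send \<open>f \<otimes> b\<close> to
  \<open>\<beta> f * cs 1 b\<close>. Invariance makes \<open>V\<close> isometric, the density axiom
  makes its range dense, and \<open>P\<close> is \<open>V\<close> followed by
  \<open>id \<otimes> h\<close>. The latter is adjoint to the isometry
  \<open>k \<mapsto> k \<otimes> 1\<close>; this is why \<open>P\<close> is a coisometry. If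
  \<open>T\<close> is an isometry, \<open>S\<close> a contraction and \<open>S T = 1\<close>, then
  \<open>S\<^sup>* x - T x\<close> has squared length at most \<open>(1 - 2 + 1)\<close> times that
  of \<open>x\<close>, so \<open>S\<^sup>* = T\<close>. No Hilbert space is formed; everything is an
  inequality between sesquilinear forms on lists of pairs. No tensor product of \<open>K\<close> is
  formed either: first legs stay in \<open>C(X)\<close> and reach \<open>S\<close> through
  \<open>(ev\<^sub>x \<otimes> id)\<beta>\<close> only after the second leg has been integrated by
  \<open>h\<close>. Boundedness of slices and homomorphisms comes from the spatial norm, from
  concrete states (\<open>h\<close>, evaluations, products of these) and from writing
  \<open>r\<^sup>2 - star x * x\<close> as \<open>star y * y\<close> by a binomial series. Neither
  spectral theory nor extension of functionals is involved.\<close>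

section \<open>Complex linear maps and the star operation\<close>

lemma scaleC_complex [simp]: "c *\<^sub>C (z :: complex) = c * z"
  by (simp add: scaleC_complex_def)

lemma star_complex [simp]: "star (z :: complex) = cnj z"
  by (simp add: star_complex_def)

lemma clinear_iff:
  "clinear f \<longleftrightarrow> (\<forall>x y. f (x + y) = f x + f y) \<and> (\<forall>c x. f (c *\<^sub>C x) = c *\<^sub>C f x)"
  unfolding Vector_Spaces.linear_iff by (simp add: complex_vector.vector_space_axioms)

lemma clinearI:
  "\<lbrakk>\<And>x y. f (x + y) = f x + f y; \<And>c x. f (c *\<^sub>C x) = c *\<^sub>C f x\<rbrakk> \<Longrightarrow> clinear f"
  by (simp add: clinear_iff)

lemma clinear_add: "clinear f \<Longrightarrow> f (x + y) = f x + f y"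
  by (simp add: clinear_iff)

lemma clinear_scaleC: "clinear f \<Longrightarrow> f (c *\<^sub>C x) = c *\<^sub>C f x"
  by (simp add: clinear_iff)

lemma clinear_scaleR: "clinear f \<Longrightarrow> f (r *\<^sub>R x) = r *\<^sub>R f x"
  by (simp add: scaleR_scaleC clinear_scaleC)

lemma clinear_imp_linear: "clinear f \<Longrightarrow> linear f"
  by (rule linearI) (simp_all add: clinear_add clinear_scaleR)

lemma clinear_zero: "clinear f \<Longrightarrow> f 0 = 0"
  by (rule linear_0[OF clinear_imp_linear])

lemma clinear_minus: "clinear f \<Longrightarrow> f (- x) = - f x"
  by (rule linear_neg[OF clinear_imp_linear])

lemma clinear_diff: "clinear f \<Longrightarrow> f (x - y) = f x - f y"
  by (rule linear_diff[OF clinear_imp_linear])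

lemma linear_sum_list: "linear f \<Longrightarrow> f (\<Sum>x\<leftarrow>xs. g x) = (\<Sum>x\<leftarrow>xs. f (g x))"
  by (induction xs) (simp_all add: linear_0 linear_add)

lemma clinear_compose: "clinear f \<Longrightarrow> clinear g \<Longrightarrow> clinear (\<lambda>x. f (g x))"
  by (simp add: clinear_iff)

lemma clinear_mult_left: "clinear (\<lambda>x. a * x)"
  by (simp add: clinear_iff distrib_left mult_scaleC_right)

lemma clinear_mult_right: "clinear (\<lambda>x. x * a)"
  by (simp add: clinear_iff distrib_right mult_scaleC_left)

lemma star_zero [simp]: "star 0 = 0"
  by (rule linear_0[OF bounded_linear.linear[OF bounded_linear_star]])

lemma star_minus: "star (- x) = - star x"
  by (rule linear_neg[OF bounded_linear.linear[OF bounded_linear_star]])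

lemma star_one [simp]: "star 1 = 1"
  by (metis mult.left_neutral mult.right_neutral star_mult star_star)

declare star_star [simp]

lemma star_power: "star (x ^ n) = star x ^ n"
  by (induction n) (simp_all add: star_mult power_commutes)

lemma star_scaleR: "star (r *\<^sub>R x) = r *\<^sub>R star x"
  by (simp add: scaleR_scaleC star_scaleC)

section \<open>Positivity\<close>

text \<open>Binomial series for the square root of \<open>1 - c\<close>: absolute convergence allows
  the Cauchy product of the series with itself, and Vandermonde's identity reduces the product
  coefficients to those of exponent 1. This stands in for functional calculus.\<close>

lemma selfadjoint_sqrt:
  fixes c :: "'a :: unital_cstar_algebra"
  assumes c: "star c = c" and less: "norm c < 1"
  obtains y where "star y = y" "y * y = 1 - c"
proof -
  define a :: "nat \<Rightarrow> real" where "a n = (1/2) gchoose n" for n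
  define f where "f n = a n *\<^sub>R (- c) ^ n" for n
  \<comment> \<open>The scalar series converges at \<open>r\<close>, hence absolutely at the smaller
    radius \<open>norm c\<close>.\<close>
  obtain r where r: "norm c < r" "r < 1"
    using dense less by blast
  then have r0: "0 \<le> r" "\<bar>r\<bar> < 1" using norm_ge_zero[of c] by linarith+
  have "summable (\<lambda>n. a n * r ^ n)"
    using gen_binomial_real[OF r0(2), of "1/2"] by (auto simp: a_def sums_iff)
  then have s: "summable (\<lambda>n. norm (a n * norm c ^ n))"
    by (rule powser_insidea) (use r r0 in auto)
  have le: "norm (f n) \<le> norm (a n * norm c ^ n)" for n
    using norm_power_ineq[of "- c" n] by (auto simp: f_def abs_mult intro!: mult_left_mono)
  have sf: "summable (\<lambda>n. norm (f n))"
    by (rule summable_comparison_test'[OF s, of 0]) (use le in auto)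
  then have sf': "summable f" by (rule summable_norm_cancel)
  define y where "y = (\<Sum>n. f n)"
  have "star y = (\<Sum>n. star (f n))"
    unfolding y_def by (rule bounded_linear.suminf[OF bounded_linear_star sf'])
  also have "\<dots> = y"
    by (simp add: y_def f_def star_scaleR star_power star_minus c)
  finally have "star y = y" .
  have coeff: "(\<Sum>i\<le>k. a i * a (k - i)) = (1 gchoose k)" for k
    using gbinomial_Vandermonde[of "1/2 :: real" "1/2" k]
    by (simp add: a_def atLeast0AtMost)
  have one: "(1 gchoose k :: real) = (if k \<le> 1 then 1 else 0)" for k
  proof -
    have "(1 gchoose k :: real) = of_nat (1 choose k)"
      by (metis binomial_gbinomial of_nat_1)
    then show ?thesis by (cases k) auto
  qed
  have conv: "(\<Sum>i\<le>k. f i * f (k - i)) = (if k \<le> 1 then (- c) ^ k else 0)" for k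
  proof -
    have "(\<Sum>i\<le>k. f i * f (k - i)) = (\<Sum>i\<le>k. (a i * a (k - i)) *\<^sub>R (- c) ^ k)"
      by (rule sum.cong) (simp_all add: f_def flip: power_add)
    also have "\<dots> = (1 gchoose k) *\<^sub>R (- c) ^ k"
      by (simp add: coeff flip: scaleR_sum_left)
    finally show ?thesis by (simp add: one)
  qed
  have "(\<lambda>k. \<Sum>i\<le>k. f i * f (k - i)) sums (y * y)"
    unfolding y_def by (rule Cauchy_product_sums[OF sf sf])
  moreover have "(\<lambda>k. \<Sum>i\<le>k. f i * f (k - i)) sums (\<Sum>k\<in>{0,1}. \<Sum>i\<le>k. f i * f (k - i))"
    by (rule sums_finite) (auto simp: conv)
  ultimately have "y * y = (\<Sum>k\<in>{0,1}. \<Sum>i\<le>k. f i * f (k - i))"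
    by (rule sums_unique2)
  then have "y * y = 1 - c" by (simp only: conv) simp
  with \<open>star y = y\<close> show thesis by (rule that)
qed

text \<open>A witness that \<open>r\<^sup>2 - star x * x\<close> is positive. \<open>r\<close> lies
  strictly above the norm so that the binomial series at \<open>star x * x / r\<^sup>2\<close>
  converges.\<close>

lemma norm_bound_decomp:
  fixes x :: "'a :: unital_cstar_algebra"
  assumes "norm x < r"
  obtains y where "star y = y" "star y * y = of_real (r\<^sup>2) - star x * x"
proof -
  have r: "r > 0" using assms norm_ge_zero[of x] by linarith
  let ?c = "(1 / r\<^sup>2) *\<^sub>R (star x * x)"
  have "norm ?c = (norm x / r)\<^sup>2"
    using r by (simp add: cstar_identity power_divide)
  also have "\<dots> < 1"
    using r assms by (simp add: power_less_one_iff abs_square_less_1)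
  finally have "norm ?c < 1" .
  moreover have "star ?c = ?c"
    by (simp add: star_scaleR star_mult)
  ultimately obtain y where y: "star y = y" "y * y = 1 - ?c"
    using selfadjoint_sqrt by metis
  have "r *\<^sub>R y * (r *\<^sub>R y) = r\<^sup>2 *\<^sub>R (1 - ?c)"
    by (simp add: y(2) power2_eq_square)
  also have "\<dots> = of_real (r\<^sup>2) - star x * x"
    using r by (simp add: scaleR_diff_right of_real_def)
  finally show thesis
    using that[of "r *\<^sub>R y"] y(1) by (simp add: star_scaleR)
qed

section \<open>Positive sesquilinear forms and their tensor products\<close>

text \<open>No definiteness is asked, since GNS forms have null vectors. Symmetry makes the diagonal
  real, so \<open>Re\<close> loses nothing there.\<close>

definition pos_form :: "('a :: unital_cstar_algebra \<Rightarrow> 'a \<Rightarrow> complex) \<Rightarrow> bool"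
  where "pos_form A \<longleftrightarrow> (\<forall>y. clinear (\<lambda>x. A x y)) \<and> (\<forall>x y. A y x = cnj (A x y)) \<and>
    (\<forall>x. 0 \<le> Re (A x x))"

text \<open>The product form on an algebraic tensor product, evaluated on representing lists, so
  that independence of the representation need not be settled first.\<close>

definition tform :: "('a \<Rightarrow> 'a \<Rightarrow> complex) \<Rightarrow> ('b \<Rightarrow> 'b \<Rightarrow> complex) \<Rightarrow>
    ('a \<times> 'b) list \<Rightarrow> ('a \<times> 'b) list \<Rightarrow> complex"
  where "tform A B vs ws = (\<Sum>v\<leftarrow>vs. \<Sum>w\<leftarrow>ws. A (fst v) (fst w) * B (snd v) (snd w))"

lemma gns_inner_tform:
  "gns_inner \<phi> \<psi> = tform (\<lambda>a c. \<phi> (star c * a)) (\<lambda>b d. \<psi> (star d * b))"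
  by (intro ext) (simp add: gns_inner_def tform_def case_prod_unfold)

lemma pos_form_clinear: "pos_form A \<Longrightarrow> clinear (\<lambda>x. A x y)"
  unfolding pos_form_def by blast

lemma pos_form_sym: "pos_form A \<Longrightarrow> A y x = cnj (A x y)"
  unfolding pos_form_def by blast

context
  fixes A :: "'a :: unital_cstar_algebra \<Rightarrow> 'a \<Rightarrow> complex"
  assumes A: "pos_form A"
begin

lemma pos_form_add1: "A (x + y) z = A x z + A y z"
  by (rule clinear_add[OF pos_form_clinear[OF A]])

lemma pos_form_scale1: "A (c *\<^sub>C x) z = c * A x z"
  using clinear_scaleC[OF pos_form_clinear[OF A, of z], of c x] by simp

lemma pos_form_zero1: "A 0 z = 0"
  by (rule clinear_zero[OF pos_form_clinear[OF A]])

lemma pos_form_diff1: "A (x - y) z = A x z - A y z"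
  by (rule clinear_diff[OF pos_form_clinear[OF A]])

lemma pos_form_add2: "A z (x + y) = A z x + A z y"
  unfolding pos_form_sym[OF A, of z "x + y"] pos_form_add1
  using pos_form_sym[OF A, of z x] pos_form_sym[OF A, of z y] by simp

lemma pos_form_scale2: "A z (c *\<^sub>C x) = cnj c * A z x"
  unfolding pos_form_sym[OF A, of z "c *\<^sub>C x"] pos_form_scale1
  using pos_form_sym[OF A, of z x] by simp

lemma pos_form_diff2: "A z (x - y) = A z x - A z y"
  unfolding pos_form_sym[OF A, of z "x - y"] pos_form_diff1
  using pos_form_sym[OF A, of z x] pos_form_sym[OF A, of z y] by simp

lemma pos_form_zero2: "A z 0 = 0"
  unfolding pos_form_sym[OF A, of z 0] pos_form_zero1 by simp

end

lemmas pos_form_simps = pos_form_add1 pos_form_add2 pos_form_scale1 pos_form_scale2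
  pos_form_zero1 pos_form_zero2 pos_form_diff1 pos_form_diff2

lemma pos_form_Re: "pos_form A \<Longrightarrow> 0 \<le> Re (A x x)"
  unfolding pos_form_def by blast

lemma pos_form_self:
  assumes "pos_form A"
  shows "A x x = of_real (Re (A x x))"
proof -
  have "A x x = cnj (A x x)" by (rule pos_form_sym[OF assms])
  then have "Im (A x x) = - Im (A x x)" by (metis cnj.simps(2))
  then show ?thesis by (simp add: complex_eq_iff)
qed

text \<open>Besides the Cauchy-Schwarz inequalities, the case \<open>p = 0\<close> matters: it
  forces \<open>z = 0\<close>, which later turns a first-order comparison into an equality.\<close>

lemma quadratic_discriminant:
  fixes z :: complex
  assumes "\<And>s. 0 \<le> p + 2 * Re (s * z) + (cmod s)\<^sup>2 * r"
  shows "(cmod z)\<^sup>2 \<le> p * r"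
proof -
  have p: "0 \<le> p" using assms[of 0] by simp
  \<comment> \<open>For \<open>s\<close> a real multiple of \<open>cnj z\<close> the linear term is
    real.\<close>
  have q: "0 \<le> p - 2 * t * (cmod z)\<^sup>2 + t\<^sup>2 * (cmod z)\<^sup>2 * r" for t :: real
  proof -
    have "cnj z * z = of_real ((cmod z)\<^sup>2)"
      by (metis complex_norm_square mult.commute)
    then have "Re (- of_real t * cnj z * z) = - t * (cmod z)\<^sup>2"
      by (simp add: mult.assoc)
    then show ?thesis
      using assms[of "- of_real t * cnj z"]
      by (simp add: norm_mult power_mult_distrib)
  qed
  show ?thesis
  proof (cases "z = 0")
    case True
    have "0 \<le> r"
    proof (rule ccontr)
      assume "\<not> 0 \<le> r"
      then have "r < 0" by simp
      then have "(p + 1) / - r \<ge> 0" using p by (intro divide_nonneg_pos) auto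
      have "(cmod (of_real (sqrt ((p + 1) / - r))))\<^sup>2 * r = - (p + 1)"
        using \<open>r < 0\<close> \<open>(p + 1) / - r \<ge> 0\<close> by (simp add: field_simps)
      then show False
        using assms[of "of_real (sqrt ((p + 1) / - r))"] True by simp
    qed
    with p True show ?thesis by simp
  next
    case False
    then have z: "(cmod z)\<^sup>2 > 0" by simp
    have "r > 0"
    proof (rule ccontr)
      assume "\<not> r > 0"
      \<comment> \<open>The linear term becomes \<open>- (p + 1)\<close>, which outweighs
        \<open>p\<close> when the quadratic term is not positive.\<close>
      define t where "t = (p + 1) / (2 * (cmod z)\<^sup>2)"
      have "2 * t * (cmod z)\<^sup>2 = p + 1" using z by (simp add: t_def)
      moreover have "t\<^sup>2 * (cmod z)\<^sup>2 * r \<le> 0"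
        using \<open>\<not> r > 0\<close> by (simp add: mult_nonneg_nonpos)
      ultimately show False using q[of t] by linarith
    qed
    with q[of "1 / r"] show ?thesis
      by (simp add: power2_eq_square field_simps)
  qed
qed

lemma pos_form_Cauchy_Schwarz:
  assumes A: "pos_form A"
  shows "(cmod (A x y))\<^sup>2 \<le> Re (A x x) * Re (A y y)"
proof -
  have "0 \<le> Re (A y y) + 2 * Re (s * A x y) + (cmod s)\<^sup>2 * Re (A x x)" for s
  proof -
    have *: "A y x = cnj (A x y)" "s * cnj s = of_real ((cmod s)\<^sup>2)"
      by (rule pos_form_sym[OF A], simp add: complex_norm_square del: of_real_power)
    have "A (s *\<^sub>C x + y) (s *\<^sub>C x + y) =
        s * cnj s * A x x + s * A x y + cnj (s * A x y) + A y y"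
      by (simp add: pos_form_simps[OF A] *(1) algebra_simps)
    then show ?thesis
      using pos_form_Re[OF A, of "s *\<^sub>C x + y"] by (simp add: *(2))
  qed
  from quadratic_discriminant[OF this] show ?thesis by (simp add: mult.commute)
qed

lemma pos_form_null: "pos_form A \<Longrightarrow> A x x = 0 \<Longrightarrow> A x y = 0"
  using pos_form_Cauchy_Schwarz[of A x y] by simp

lemma tform_Nil [simp]: "tform A B [] ws = 0" "tform A B vs [] = 0"
  by (simp_all add: tform_def)

lemma tform_append1: "tform A B (us @ vs) ws = tform A B us ws + tform A B vs ws"
  by (simp add: tform_def)

lemma tform_Cons1: "tform A B (u # vs) ws = tform A B [u] ws + tform A B vs ws"
  by (simp add: tform_def)

lemma tform_append2: "tform A B ws (us @ vs) = tform A B ws us + tform A B ws vs"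
  by (simp add: tform_def sum_list_addf)

lemma tform_Cons2: "tform A B ws (u # vs) = tform A B ws [u] + tform A B ws vs"
  by (simp add: tform_def sum_list_addf)

lemma tform_sing: "tform A B [(a, b)] [(c, d)] = A a c * B b d"
  by (simp add: tform_def)

lemma sum_list_cnj: "cnj (\<Sum>x\<leftarrow>xs. f x) = (\<Sum>x\<leftarrow>xs. cnj (f x))"
  by (induction xs) auto

lemma sum_list_swap:
  "(\<Sum>x\<leftarrow>xs. \<Sum>y\<leftarrow>ys. f x y) = (\<Sum>y\<leftarrow>ys. \<Sum>x\<leftarrow>xs. (f x y :: 'a :: comm_monoid_add))"
  by (induction xs) (simp_all add: sum_list_addf)

lemma tform_sym:
  assumes "pos_form A" "pos_form B"
  shows "tform A B ws vs = cnj (tform A B vs ws)"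
proof -
  have "cnj (tform A B vs ws) = (\<Sum>v\<leftarrow>vs. \<Sum>w\<leftarrow>ws. A (fst w) (fst v) * B (snd w) (snd v))"
    by (simp add: tform_def sum_list_cnj flip: pos_form_sym[OF assms(1)] pos_form_sym[OF assms(2)])
  also have "\<dots> = tform A B ws vs"
    by (subst sum_list_swap) (simp add: tform_def)
  finally show ?thesis by simp
qed

text \<open>Carries a multiple of \<open>a\<close> in the first leg across the tensor sign: one
  elimination step of the Gram-Schmidt argument in \<open>tform_Schur\<close>.\<close>

lemma tform_shift:
  assumes A: "pos_form A" and B: "pos_form B"
  shows "tform A B [(c, d)] ws = tform A B [(c - k *\<^sub>C a, d)] ws + tform A B [(a, k *\<^sub>C d)] ws"
proof (induction ws)
  case (Cons w ws)
  have "tform A B [(c, d)] [w] = tform A B [(c - k *\<^sub>C a, d)] [w] + tform A B [(a, k *\<^sub>C d)] [w]"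
    by (cases w) (simp add: tform_sing pos_form_diff1[OF A] pos_form_scale1[OF A]
        pos_form_scale1[OF B] algebra_simps)
  with Cons show ?case by (simp only: tform_Cons2[of A B _ w ws] add_ac)
qed simp

lemma tform_add_snd:
  assumes B: "pos_form B"
  shows "tform A B [(a, x + y)] ws = tform A B [(a, x)] ws + tform A B [(a, y)] ws"
proof (induction ws)
  case (Cons w ws)
  have "tform A B [(a, x + y)] [w] = tform A B [(a, x)] [w] + tform A B [(a, y)] [w]"
    by (cases w) (simp add: tform_sing pos_form_add1[OF B] algebra_simps)
  with Cons show ?case by (simp only: tform_Cons2[of A B _ w ws] add_ac)
qed simp

lemma tform_zero_snd: "pos_form B \<Longrightarrow> tform A B [(a, 0)] ws = 0"
  by (induction ws) (auto simp: tform_def pos_form_zero1)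

text \<open>Schur's product theorem by elimination. The parts of the tail along \<open>a\<close> are
  removed from its first legs and collected in \<open>b'\<close>; the head \<open>(a, b')\<close> is
  then orthogonal to the new tail, and the form splits into a product of two diagonal values and a
  shorter instance.\<close>

lemma tform_Schur:
  assumes A: "pos_form A" and B: "pos_form B"
  shows "0 \<le> Re (tform A B vs vs)"
proof (induction "length vs" arbitrary: vs)
  case 0
  then show ?case by simp
next
  case (Suc n)
  then obtain a b vs' where vs: "vs = (a, b) # vs'" and len: "length vs' = n"
    by (metis Suc_length_conv surj_pair)
  \<comment> \<open>If \<open>A a a = 0\<close> the quotient is 0 by convention, which is the right
    value because \<open>A c a\<close> vanishes too.\<close>
  define l where "l c = A c a / A a a" for c
  define vs2 where "vs2 = map (\<lambda>(c, d). (c - l c *\<^sub>C a, d)) vs'"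
  define b' where "b' = b + (\<Sum>(c, d)\<leftarrow>vs'. l c *\<^sub>C d)"
  have l: "l c * A a a = A c a" for c
  proof (cases "A a a = 0")
    case True
    have "A a c = 0" by (rule pos_form_null[OF A True])
    then have "A c a = 0" by (metis pos_form_sym[OF A] complex_cnj_zero)
    with True show ?thesis by simp
  next
    case False
    then show ?thesis by (simp add: l_def)
  qed
  have step: "tform A B vs' ws = tform A B [(a, \<Sum>(c, d)\<leftarrow>vs'. l c *\<^sub>C d)] ws + tform A B vs2 ws" for ws
    unfolding vs2_def
  proof (induction vs')
    case Nil
    show ?case by (simp add: tform_zero_snd[OF B])
  next
    case (Cons p ps)
    obtain c d where p: "p = (c, d)" by force
    note tform_shift[OF A B, of c d ws "l c" a]
    moreover note tform_add_snd[OF B, of A a "l c *\<^sub>C d" "\<Sum>(c, d)\<leftarrow>ps. l c *\<^sub>C d" ws]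
    moreover note tform_Cons1[of A B "(c, d)" ps ws]
      tform_Cons1[of A B "(c - l c *\<^sub>C a, d)" "map (\<lambda>(c, d). (c - l c *\<^sub>C a, d)) ps" ws]
    ultimately show ?case
      using Cons by (simp add: p)
  qed
  have eq: "tform A B vs ws = tform A B [(a, b')] ws + tform A B vs2 ws" for ws
    unfolding vs b'_def tform_Cons1[of A B "(a, b)" vs'] step[of ws] tform_add_snd[OF B]
    by (simp only: add_ac)
  have orth: "tform A B vs2 [(a, d)] = 0" for d
  proof -
    have "A (c - l c *\<^sub>C a) a = 0" for c
      by (simp add: pos_form_diff1[OF A] pos_form_scale1[OF A] l)
    then show ?thesis
      unfolding vs2_def by (induction vs') (auto simp: tform_def)
  qed
  have orth': "tform A B [(a, d)] vs2 = 0" for d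
    by (subst tform_sym[OF A B]) (simp only: orth complex_cnj_zero)
  have "tform A B vs vs = tform A B [(a, b')] vs + tform A B vs2 vs"
    by (rule eq)
  also have "tform A B [(a, b')] vs = cnj (tform A B vs [(a, b')])"
    by (rule tform_sym[OF A B])
  also have "\<dots> = cnj (A a a * B b' b')"
    by (simp only: eq orth tform_sing add_0_right)
  also have "\<dots> = of_real (Re (A a a) * Re (B b' b'))"
    using pos_form_self[OF A, of a] pos_form_self[OF B, of b']
    by (metis complex_cnj_complex_of_real complex_cnj_mult of_real_mult)
  also have "tform A B vs2 vs = cnj (tform A B vs vs2)"
    by (rule tform_sym[OF A B])
  also have "\<dots> = cnj (tform A B vs2 vs2)"
    by (simp only: eq orth' add_0_left)
  finally have "Re (tform A B vs vs) = Re (A a a) * Re (B b' b') + Re (tform A B vs2 vs2)"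
    by simp
  moreover have "0 \<le> Re (tform A B vs2 vs2)"
    by (rule Suc(1)) (simp add: vs2_def len)
  ultimately show ?case
    by (simp add: pos_form_Re[OF A] pos_form_Re[OF B])
qed

text \<open>The difference of the two forms is positive, so \<open>tform_Schur\<close> applies to
  it.\<close>

lemma tform_mono1:
  assumes A: "pos_form A" and A': "pos_form A'" and B: "pos_form B"
    and le: "\<And>x. Re (A' x x) \<le> Re (A x x)"
  shows "Re (tform A' B vs vs) \<le> Re (tform A B vs vs)"
proof -
  have "pos_form (\<lambda>x y. A x y - A' x y)"
    unfolding pos_form_def
  proof (intro conjI allI)
    show "clinear (\<lambda>x. A x y - A' x y)" for y
      by (rule clinearI) (simp_all add: pos_form_simps[OF A] pos_form_simps[OF A'] algebra_simps)
    show "A y x - A' y x = cnj (A x y - A' x y)" for x y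
      by (simp flip: pos_form_sym[OF A] pos_form_sym[OF A'])
  qed (simp add: le)
  from tform_Schur[OF this B, of vs]
  show ?thesis
    by (simp add: tform_def left_diff_distrib sum_list_subtractf)
qed

lemma tform_swap:
  "tform A B vs ws = tform B A (map (\<lambda>(a, b). (b, a)) vs) (map (\<lambda>(a, b). (b, a)) ws)"
  by (simp add: tform_def comp_def case_prod_unfold mult.commute)

lemma tform_mono2:
  assumes "pos_form A" "pos_form B" "pos_form B'" "\<And>x. Re (B' x x) \<le> Re (B x x)"
  shows "Re (tform A B' vs vs) \<le> Re (tform A B vs vs)"
  unfolding tform_swap[of A] by (rule tform_mono1) (use assms in auto)

lemma tform_scale1:
  assumes A: "pos_form A"
  shows "tform A B (map (\<lambda>(a, b). (s *\<^sub>C a, b)) vs) ws = s * tform A B vs ws"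
  by (simp add: tform_def comp_def case_prod_unfold pos_form_scale1[OF A] sum_list_const_mult mult.assoc)

lemma tform_scale2:
  assumes A: "pos_form A"
  shows "tform A B vs (map (\<lambda>(a, b). (s *\<^sub>C a, b)) ws) = cnj s * tform A B vs ws"
  by (simp add: tform_def comp_def case_prod_unfold pos_form_scale2[OF A] sum_list_const_mult mult.assoc)

lemma tform_add_scaled:
  assumes A: "pos_form A" and B: "pos_form B"
  shows "Re (tform A B (vs @ map (\<lambda>(a, b). (s *\<^sub>C a, b)) ws) (vs @ map (\<lambda>(a, b). (s *\<^sub>C a, b)) ws)) =
    Re (tform A B vs vs) + 2 * Re (s * tform A B ws vs) + (cmod s)\<^sup>2 * Re (tform A B ws ws)"
proof -
  have *: "s * cnj s = of_real ((cmod s)\<^sup>2)"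
    by (simp add: complex_norm_square del: of_real_power)
  have "tform A B (vs @ map (\<lambda>(a, b). (s *\<^sub>C a, b)) ws) (vs @ map (\<lambda>(a, b). (s *\<^sub>C a, b)) ws) =
      tform A B vs vs + cnj (s * tform A B ws vs) + s * tform A B ws vs + (s * cnj s) * tform A B ws ws"
    by (simp add: tform_append1 tform_append2 tform_scale1[OF A] tform_scale2[OF A]
        algebra_simps flip: tform_sym[OF A B])
  then show ?thesis by (simp add: *)
qed

lemma tform_Cauchy_Schwarz:
  assumes A: "pos_form A" and B: "pos_form B"
  shows "(cmod (tform A B vs ws))\<^sup>2 \<le> Re (tform A B vs vs) * Re (tform A B ws ws)"
proof -
  have "0 \<le> Re (tform A B ws ws) + 2 * Re (s * tform A B vs ws) + (cmod s)\<^sup>2 * Re (tform A B vs vs)" for s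
    using tform_Schur[OF A B] tform_add_scaled[OF A B] by metis
  from quadratic_discriminant[OF this] show ?thesis by (simp add: mult.commute)
qed

lemma Re_triangle:
  assumes "z = x + 2 * Re w + y" "(cmod w)\<^sup>2 \<le> x * y" "0 \<le> x" "0 \<le> (y :: real)"
  shows "sqrt z \<le> sqrt x + sqrt y"
proof -
  have "cmod w \<le> sqrt x * sqrt y"
    using assms(2) by (metis real_le_rsqrt real_sqrt_mult)
  then have "Re w \<le> sqrt x * sqrt y"
    using complex_Re_le_cmod order_trans by blast
  then have "z \<le> (sqrt x + sqrt y)\<^sup>2"
    using assms by (simp add: power2_sum)
  then show ?thesis
    using assms by (intro real_le_lsqrt) auto
qed

lemma tform_triangle:
  assumes A: "pos_form A" and B: "pos_form B"
  shows "sqrt (Re (tform A B (vs @ ws) (vs @ ws))) \<le>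
    sqrt (Re (tform A B vs vs)) + sqrt (Re (tform A B ws ws))"
proof (rule Re_triangle)
  show "Re (tform A B (vs @ ws) (vs @ ws)) =
      Re (tform A B vs vs) + 2 * Re (tform A B vs ws) + Re (tform A B ws ws)"
    using arg_cong[OF tform_sym[OF A B, of ws vs], of Re]
    by (simp add: tform_append1 tform_append2)
qed (simp_all add: tform_Cauchy_Schwarz[OF A B] tform_Schur[OF A B])

lemma pos_form_triangle:
  assumes A: "pos_form A"
  shows "sqrt (Re (A (x + y) (x + y))) \<le> sqrt (Re (A x x)) + sqrt (Re (A y y))"
proof (rule Re_triangle)
  show "Re (A (x + y) (x + y)) = Re (A x x) + 2 * Re (A x y) + Re (A y y)"
    using arg_cong[OF pos_form_sym[OF A, of y x], of Re]
    by (simp add: pos_form_simps[OF A])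
qed (simp_all add: pos_form_Cauchy_Schwarz[OF A] pos_form_Re[OF A])

section \<open>Positive functionals\<close>

text \<open>States without normalisation, to cover compressions
  \<open>\<phi> (star a * x * a)\<close>.\<close>

definition pos_fun :: "('a :: unital_cstar_algebra \<Rightarrow> complex) \<Rightarrow> bool"
  where "pos_fun \<phi> \<longleftrightarrow> clinear \<phi> \<and> (\<forall>x. \<phi> (star x * x) \<in> \<real>\<^sub>\<ge>\<^sub>0)"

lemma is_state_iff: "is_state \<phi> \<longleftrightarrow> pos_fun \<phi> \<and> \<phi> 1 = 1"
  by (auto simp: is_state_def pos_fun_def)

text \<open>Symmetry by polarization: reality of the diagonal at \<open>x + y\<close> settles the
  imaginary parts, at \<open>x + \<i> *\<^sub>C y\<close> the real parts.\<close>

lemma pos_fun_form: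
  assumes "pos_fun \<phi>"
  shows "pos_form (\<lambda>a c. \<phi> (star c * a))"
proof -
  have lin: "clinear \<phi>" and pos: "\<phi> (star x * x) \<in> \<real>\<^sub>\<ge>\<^sub>0" for x
    using assms by (auto simp: pos_fun_def)
  note lins = clinear_add[OF lin] clinear_scaleC[OF lin]
  have im: "Im (\<phi> (star x * x)) = 0" and re: "0 \<le> Re (\<phi> (star x * x))" for x
    using pos[of x] by (auto simp: complex_nonneg_Reals_iff)
  have "\<phi> (star x * y) = cnj (\<phi> (star y * x))" for x y
  proof (rule complex_eqI)
    have "Im (\<phi> (star x * y)) + Im (\<phi> (star y * x)) = 0"
      using im[of "x + y"] im[of x] im[of y]
      by (simp add: star_add distrib_left distrib_right lins)
    then show "Im (\<phi> (star x * y)) = Im (cnj (\<phi> (star y * x)))" by simp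
    have "star (x + \<i> *\<^sub>C y) * (x + \<i> *\<^sub>C y) =
        star x * x + \<i> *\<^sub>C (star x * y) + (- \<i>) *\<^sub>C (star y * x) + star y * y"
      by (simp add: star_add star_scaleC distrib_left distrib_right left_diff_distrib
          mult_scaleC_left mult_scaleC_right scaleC_scaleC scaleC_add_right
          complex_vector.scale_right_diff_distrib)
    then have "\<phi> (star (x + \<i> *\<^sub>C y) * (x + \<i> *\<^sub>C y)) =
        \<phi> (star x * x) + \<i> * \<phi> (star x * y) + - \<i> * \<phi> (star y * x) + \<phi> (star y * y)"
      by (simp only: lins scaleC_complex)
    then show "Re (\<phi> (star x * y)) = Re (cnj (\<phi> (star y * x)))"
      using im[of "x + \<i> *\<^sub>C y"] im[of x] im[of y] by simp
  qed
  moreover have "clinear (\<lambda>a. \<phi> (star c * a))" for c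
    by (rule clinear_compose[OF lin clinear_mult_left])
  ultimately show ?thesis
    unfolding pos_form_def using re by blast
qed

lemma pos_fun_star:
  assumes "pos_fun \<phi>" shows "\<phi> (star x) = cnj (\<phi> x)"
  using pos_form_sym[OF pos_fun_form[OF assms], of 1 x] by simp

lemma pos_fun_clinear: "pos_fun \<phi> \<Longrightarrow> clinear \<phi>"
  by (simp add: pos_fun_def)

lemma pos_fun_Re: "pos_fun \<phi> \<Longrightarrow> 0 \<le> Re (\<phi> (star x * x))"
  using pos_form_Re[OF pos_fun_form] by metis

lemma pos_fun_self: "pos_fun \<phi> \<Longrightarrow> \<phi> (star x * x) = of_real (Re (\<phi> (star x * x)))"
  using pos_form_self[OF pos_fun_form] by metis

lemma pos_fun_Cauchy_Schwarz:
  "pos_fun \<phi> \<Longrightarrow> (cmod (\<phi> (star y * x)))\<^sup>2 \<le> Re (\<phi> (star x * x)) * Re (\<phi> (star y * y))"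
  using pos_form_Cauchy_Schwarz[OF pos_fun_form] by metis

lemma pos_fun_comp:
  assumes "pos_fun \<phi>" "clinear f" "\<And>x. \<exists>y. f (star x * x) = star y * y"
  shows "pos_fun (\<lambda>x. \<phi> (f x))"
  unfolding pos_fun_def
proof (intro conjI allI)
  show "clinear (\<lambda>x. \<phi> (f x))"
    by (rule clinear_compose[OF pos_fun_clinear[OF assms(1)] assms(2)])
  show "\<phi> (f (star x * x)) \<in> \<real>\<^sub>\<ge>\<^sub>0" for x
    using assms(1) assms(3)[of x] by (auto simp: pos_fun_def)
qed

text \<open>\<open>norm_bound_decomp\<close> works only for \<open>r\<close> strictly above the
  norm; this passes to the limit.\<close>

lemma le_of_all_greater:
  assumes "\<And>r. n < r \<Longrightarrow> t \<le> r\<^sup>2 * (k :: real)"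
  shows "t \<le> n\<^sup>2 * k"
proof (rule tendsto_lowerbound)
  show "((\<lambda>r. r\<^sup>2 * k) \<longlongrightarrow> n\<^sup>2 * k) (at_right n)"
    by (intro tendsto_intros)
  show "\<forall>\<^sub>F r in at_right n. t \<le> r\<^sup>2 * k"
    using assms by (auto simp: eventually_at_right_less eventually_at_filter)
qed simp

lemma of_real_mult_scaleC:
  "star x * of_real k * x = complex_of_real k *\<^sub>C (star x * (x :: 'a :: unital_cstar_algebra))"
  unfolding scaleR_scaleC[symmetric] of_real_def[where 'a = 'a] by simp

text \<open>With \<open>star y * y = r\<^sup>2 - star a * a\<close>, positivity of
  \<open>\<phi>\<close> at \<open>star (y * x) * (y * x)\<close> is the inequality for
  \<open>r\<close>. It bounds left multiplication by \<open>a\<close> on the GNS space.\<close>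

lemma pos_fun_mult_le:
  assumes \<phi>: "pos_fun \<phi>"
  shows "Re (\<phi> (star (a * x) * (a * x))) \<le> (norm a)\<^sup>2 * Re (\<phi> (star x * x))"
proof (rule le_of_all_greater)
  fix r assume "norm a < r"
  then obtain y where y: "star y * y = of_real (r\<^sup>2) - star a * a"
    using norm_bound_decomp by metis
  have "star (y * x) * (y * x) = star x * (star y * y) * x"
    by (simp add: star_mult mult.assoc)
  also have "\<dots> = complex_of_real (r\<^sup>2) *\<^sub>C (star x * x) - star (a * x) * (a * x)"
    unfolding y right_diff_distrib left_diff_distrib of_real_mult_scaleC
    by (simp add: star_mult mult.assoc)
  finally have "\<phi> (star (y * x) * (y * x)) =
      of_real (r\<^sup>2) * \<phi> (star x * x) - \<phi> (star (a * x) * (a * x))"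
    using pos_fun_clinear[OF \<phi>] by (simp only: clinear_diff clinear_scaleC scaleC_complex)
  then show "Re (\<phi> (star (a * x) * (a * x))) \<le> r\<^sup>2 * Re (\<phi> (star x * x))"
    using pos_fun_Re[OF \<phi>, of "y * x"] by simp
qed

lemma pos_fun_norm_le:
  assumes \<phi>: "pos_fun \<phi>"
  shows "cmod (\<phi> x) \<le> Re (\<phi> 1) * norm x"
proof -
  have one: "0 \<le> Re (\<phi> 1)" using pos_fun_Re[OF \<phi>, of 1] by simp
  have "(cmod (\<phi> x))\<^sup>2 \<le> Re (\<phi> (star x * x)) * Re (\<phi> 1)"
    using pos_fun_Cauchy_Schwarz[OF \<phi>, of 1 x] by simp
  also have "\<dots> \<le> ((norm x)\<^sup>2 * Re (\<phi> 1)) * Re (\<phi> 1)"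
    using pos_fun_mult_le[OF \<phi>, of x 1] one by (intro mult_right_mono) auto
  also have "\<dots> = (Re (\<phi> 1) * norm x)\<^sup>2"
    by (simp add: power2_eq_square)
  finally show ?thesis
    using one by (simp add: abs_le_square_iff[symmetric])
qed

lemma pos_fun_square_le:
  "pos_fun \<phi> \<Longrightarrow> Re (\<phi> (star x * x)) \<le> Re (\<phi> 1) * (norm x)\<^sup>2"
  using pos_fun_mult_le[of \<phi> x 1] by (simp add: mult.commute)

lemma pos_fun_bounded_linear:
  assumes "pos_fun \<phi>" shows "bounded_linear \<phi>"
  using pos_fun_clinear[OF assms] pos_fun_norm_le[OF assms]
  by (intro bounded_linear_intro[where K = "Re (\<phi> 1)"])
     (simp_all add: clinear_add clinear_scaleR mult.commute)

lemma state_pos_fun: "is_state \<phi> \<Longrightarrow> pos_fun \<phi>"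
  by (simp add: is_state_iff)

lemma pos_fun_sandwich:
  assumes "pos_fun \<phi>"
  shows "pos_fun (\<lambda>x. \<phi> (star a * x * a))"
proof (rule pos_fun_comp[OF assms])
  show "clinear (\<lambda>x. star a * x * a)"
    by (rule clinear_compose[OF clinear_mult_right clinear_mult_left])
  show "\<exists>y. star a * (star x * x) * a = star y * y" for x
    by (rule exI[of _ "x * a"]) (simp add: star_mult mult.assoc)
qed

section \<open>The spatial norm\<close>

lemma tensor_mult_Nil [simp]: "tensor_mult [] vs = []"
  by (simp add: tensor_mult_def)

lemma tensor_mult_Cons:
  "tensor_mult ((a, b) # us) vs = map (\<lambda>(c, d). (a * c, b * d)) vs @ tensor_mult us vs"
  by (simp add: tensor_mult_def)

lemma tensor_mult_one [simp]:
  "tensor_mult us [(1 :: 'a :: monoid_mult, 1 :: 'b :: monoid_mult)] = us"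
  by (induction us) (auto simp: tensor_mult_Cons)

lemma tform_map_prod:
  "tform A B (map (\<lambda>(c, d). (f c, g d)) vs) (map (\<lambda>(c, d). (f c, g d)) ws) =
    tform (\<lambda>x y. A (f x) (f y)) (\<lambda>x y. B (g x) (g y)) vs ws"
  by (simp add: tform_def comp_def case_prod_unfold)

lemma pos_form_comp:
  assumes A: "pos_form A" and f: "clinear f"
  shows "pos_form (\<lambda>x y. A (f x) (f y))"
  unfolding pos_form_def
  using clinear_compose[OF pos_form_clinear[OF A] f] pos_form_sym[OF A] pos_form_Re[OF A] by blast

lemma pos_form_scaleR:
  assumes A: "pos_form A" and r: "0 \<le> r"
  shows "pos_form (\<lambda>x y. of_real r * A x y)"
  unfolding pos_form_def
proof (intro conjI allI)
  show "clinear (\<lambda>x. of_real r * A x y)" for y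
    by (rule clinearI) (simp_all add: pos_form_simps[OF A] algebra_simps)
  show "of_real r * A y x = cnj (of_real r * A x y)" for x y
    by (simp flip: pos_form_sym[OF A])
  show "0 \<le> Re (of_real r * A x x)" for x
    using r pos_form_Re[OF A] by simp
qed

lemma tform_scaleR_left: "tform (\<lambda>x y. of_real r * A x y) B vs ws = of_real r * tform A B vs ws"
  by (simp add: tform_def sum_list_const_mult mult.assoc)

lemma tform_scaleR_right: "tform A (\<lambda>x y. of_real r * B x y) vs ws = of_real r * tform A B vs ws"
  by (simp add: tform_def sum_list_const_mult mult.left_commute)

text \<open>The two legs are estimated one after the other, each by monotonicity of
  \<open>tform\<close> in one of its forms.\<close>

lemma gns_elementary_bound:
  fixes a :: "'a :: unital_cstar_algebra" and b :: "'b :: unital_cstar_algebra"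
    and vs :: "('a \<times> 'b) list"
  assumes \<phi>: "pos_fun \<phi>" and \<psi>: "pos_fun \<psi>"
  defines "vs' \<equiv> map (\<lambda>(c, d). (a * c, b * d)) vs"
  shows "Re (gns_inner \<phi> \<psi> vs' vs') \<le> (norm a * norm b)\<^sup>2 * Re (gns_inner \<phi> \<psi> vs vs)"
proof -
  define A where "A = (\<lambda>x y. \<phi> (star y * x))"
  define B where "B = (\<lambda>x y. \<psi> (star y * x))"
  have A: "pos_form A" and B: "pos_form B"
    unfolding A_def B_def by (rule pos_fun_form, fact)+
  have A': "pos_form (\<lambda>x y. A (a * x) (a * y))" and B': "pos_form (\<lambda>x y. B (b * x) (b * y))"
    by (rule pos_form_comp[OF A clinear_mult_left] pos_form_comp[OF B clinear_mult_left])+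
  have "Re (tform A B vs' vs') = Re (tform (\<lambda>x y. A (a * x) (a * y)) (\<lambda>x y. B (b * x) (b * y)) vs vs)"
    by (simp add: vs'_def tform_map_prod)
  also have "\<dots> \<le> Re (tform (\<lambda>x y. of_real ((norm a)\<^sup>2) * A x y) (\<lambda>x y. B (b * x) (b * y)) vs vs)"
    by (rule tform_mono1[OF pos_form_scaleR[OF A] A' B'])
       (use pos_fun_mult_le[OF \<phi>] in \<open>auto simp: A_def\<close>)
  also have "\<dots> = (norm a)\<^sup>2 * Re (tform A (\<lambda>x y. B (b * x) (b * y)) vs vs)"
    by (simp add: tform_scaleR_left del: of_real_power)
  also have "\<dots> \<le> (norm a)\<^sup>2 * Re (tform A (\<lambda>x y. of_real ((norm b)\<^sup>2) * B x y) vs vs)"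
    by (intro mult_left_mono tform_mono2[OF A pos_form_scaleR[OF B] B'])
       (use pos_fun_mult_le[OF \<psi>] in \<open>auto simp: B_def\<close>)
  also have "\<dots> = (norm a * norm b)\<^sup>2 * Re (tform A B vs vs)"
    by (simp add: tform_scaleR_right power_mult_distrib del: of_real_power)
  finally show ?thesis
    by (simp add: gns_inner_tform A_def B_def)
qed

text \<open>A crude bound whose purpose is to show that the supremum in \<open>spatial_norm\<close>
  is over a bounded set.\<close>

lemma gns_tensor_mult_bound:
  assumes \<phi>: "pos_fun \<phi>" and \<psi>: "pos_fun \<psi>"
  shows "sqrt (Re (gns_inner \<phi> \<psi> (tensor_mult us vs) (tensor_mult us vs))) \<le>
    (\<Sum>(a, b)\<leftarrow>us. norm a * norm b) * sqrt (Re (gns_inner \<phi> \<psi> vs vs))"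
proof (induction us)
  case Nil
  show ?case by (simp add: gns_inner_tform)
next
  case (Cons u us)
  obtain a b where u: "u = (a, b)" by force
  let ?vs = "map (\<lambda>(c, d). (a * c, b * d)) vs"
  have "sqrt (Re (gns_inner \<phi> \<psi> ?vs ?vs)) \<le> sqrt ((norm a * norm b)\<^sup>2 * Re (gns_inner \<phi> \<psi> vs vs))"
    using gns_elementary_bound[OF \<phi> \<psi>] by simp
  also have "\<dots> = norm a * norm b * sqrt (Re (gns_inner \<phi> \<psi> vs vs))"
    by (simp add: real_sqrt_mult)
  finally have "sqrt (Re (gns_inner \<phi> \<psi> ?vs ?vs)) \<le> norm a * norm b * sqrt (Re (gns_inner \<phi> \<psi> vs vs))" .
  moreover have "sqrt (Re (gns_inner \<phi> \<psi> (?vs @ tensor_mult us vs) (?vs @ tensor_mult us vs))) \<le>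
      sqrt (Re (gns_inner \<phi> \<psi> ?vs ?vs)) + sqrt (Re (gns_inner \<phi> \<psi> (tensor_mult us vs) (tensor_mult us vs)))"
    unfolding gns_inner_tform by (rule tform_triangle) (rule pos_fun_form, fact)+
  ultimately show ?case
    using Cons by (simp add: u tensor_mult_Cons distrib_right)
qed

lemma gns_inner_nonneg:
  "pos_fun \<phi> \<Longrightarrow> pos_fun \<psi> \<Longrightarrow> 0 \<le> Re (gns_inner \<phi> \<psi> vs vs)"
  unfolding gns_inner_tform by (rule tform_Schur) (rule pos_fun_form, assumption)+

lemma spatial_norm_upper:
  assumes \<phi>: "is_state \<phi>" and \<psi>: "is_state \<psi>" and "Re (gns_inner \<phi> \<psi> vs vs) \<le> 1"
  shows "sqrt (Re (gns_inner \<phi> \<psi> (tensor_mult us vs) (tensor_mult us vs))) \<le> spatial_norm us"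
  unfolding spatial_norm_def
proof (rule cSup_upper)
  let ?C = "\<Sum>(a, b)\<leftarrow>us. norm a * norm b"
  have C: "0 \<le> ?C" by (rule sum_list_nonneg) auto
  have "sqrt (Re (gns_inner \<phi> \<psi> (tensor_mult us vs) (tensor_mult us vs))) \<le> ?C"
    if "is_state \<phi>" "is_state \<psi>" "Re (gns_inner \<phi> \<psi> vs vs) \<le> 1" for \<phi> \<psi> vs
  proof -
    note gns_tensor_mult_bound[OF that(1,2)[THEN state_pos_fun], of us vs]
    also have "?C * sqrt (Re (gns_inner \<phi> \<psi> vs vs)) \<le> ?C * 1"
      using C that(3) by (intro mult_left_mono) auto
    finally show ?thesis by simp
  qed
  then show "bdd_above {sqrt (Re (gns_inner \<phi> \<psi> (tensor_mult us vs) (tensor_mult us vs))) |\<phi> \<psi> vs.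
      is_state \<phi> \<and> is_state \<psi> \<and> Re (gns_inner \<phi> \<psi> vs vs) \<le> 1}"
    by (intro bdd_aboveI[of _ ?C]) blast
qed (use assms in blast)

lemma tensor_mult_scale:
  "tensor_mult us (map (\<lambda>(a, b). (s *\<^sub>C a, b)) vs) =
    map (\<lambda>(a, b). (s *\<^sub>C a, b :: 'b :: unital_cstar_algebra)) (tensor_mult us vs)"
  by (induction us) (auto simp: tensor_mult_Cons mult_scaleC_right)

text \<open>Homogeneous form of the supremum, by rescaling. For a vector of length 0 every multiple
  lies in the unit ball, which forces its image to have length 0 as well.\<close>

lemma gns_tensor_mult_le:
  assumes \<phi>: "is_state \<phi>" and \<psi>: "is_state \<psi>"
  shows "Re (gns_inner \<phi> \<psi> (tensor_mult us vs) (tensor_mult us vs)) \<le>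
    (spatial_norm us)\<^sup>2 * Re (gns_inner \<phi> \<psi> vs vs)"
proof -
  note p\<phi> = state_pos_fun[OF \<phi>] and p\<psi> = state_pos_fun[OF \<psi>]
  define g where "g = Re (gns_inner \<phi> \<psi> vs vs)"
  define G where "G = Re (gns_inner \<phi> \<psi> (tensor_mult us vs) (tensor_mult us vs))"
  have g: "0 \<le> g" and G: "0 \<le> G"
    unfolding g_def G_def by (rule gns_inner_nonneg[OF p\<phi> p\<psi>])+
  have scale: "Re (gns_inner \<phi> \<psi> (map (\<lambda>(a, b). (of_real s *\<^sub>C a, b)) ws) (map (\<lambda>(a, b). (of_real s *\<^sub>C a, b)) ws))
      = s\<^sup>2 * Re (gns_inner \<phi> \<psi> ws ws)" for s :: real and ws
    unfolding gns_inner_tform tform_scale1[OF pos_fun_form[OF p\<phi>]] tform_scale2[OF pos_fun_form[OF p\<phi>]]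
    by (simp add: power2_eq_square)
  have *: "s\<^sup>2 * G \<le> (spatial_norm us)\<^sup>2" if "s\<^sup>2 * g \<le> 1" for s :: real
  proof -
    have "sqrt (s\<^sup>2 * G) \<le> spatial_norm us"
      using spatial_norm_upper[OF \<phi> \<psi>, of "map (\<lambda>(a, b). (of_real s *\<^sub>C a, b)) vs" us] that
      by (simp add: tensor_mult_scale scale g_def G_def)
    moreover have "0 \<le> s\<^sup>2 * G" using G by simp
    ultimately show ?thesis
      by (metis power_mono real_sqrt_ge_zero real_sqrt_pow2)
  qed
  have "G \<le> (spatial_norm us)\<^sup>2 * g"
  proof (cases "g = 0")
    case True
    have "G = 0"
    proof (rule ccontr)
      assume "G \<noteq> 0"
      define s where "s = sqrt (((spatial_norm us)\<^sup>2 + 1) / G)"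
      have "s\<^sup>2 * G = (spatial_norm us)\<^sup>2 + 1"
        using G \<open>G \<noteq> 0\<close> by (simp add: s_def)
      with *[of s] True show False by simp
    qed
    with True show ?thesis by simp
  next
    case False
    with g have "(1 / sqrt g)\<^sup>2 * g \<le> 1" by (simp add: power_divide)
    from *[OF this] show ?thesis
      using g False by (simp add: power_divide field_simps)
  qed
  then show ?thesis by (simp add: g_def G_def)
qed

text \<open>The two given states ensure that the supremum ranges over a nonempty set. Callers supply
  concrete ones: the Haar state, evaluations and products.\<close>

lemma spatial_norm_le:
  assumes \<phi>0: "is_state (\<phi>0 :: 'a :: unital_cstar_algebra \<Rightarrow> complex)"
    and \<psi>0: "is_state (\<psi>0 :: 'b :: unital_cstar_algebra \<Rightarrow> complex)"
    and N: "0 \<le> N"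
    and le: "\<And>\<phi> \<psi> vs. is_state \<phi> \<Longrightarrow> is_state \<psi> \<Longrightarrow>
      Re (gns_inner \<phi> \<psi> (tensor_mult us vs) (tensor_mult us vs)) \<le> N\<^sup>2 * Re (gns_inner \<phi> \<psi> vs vs)"
  shows "spatial_norm (us :: ('a \<times> 'b) list) \<le> N"
  unfolding spatial_norm_def
proof (rule cSup_least)
  show "{sqrt (Re (gns_inner \<phi> \<psi> (tensor_mult us vs) (tensor_mult us vs))) |\<phi> \<psi> vs.
      is_state \<phi> \<and> is_state \<psi> \<and> Re (gns_inner \<phi> \<psi> vs vs) \<le> 1} \<noteq> {}"
  proof -
    have "Re (gns_inner \<phi>0 \<psi>0 [] []) \<le> 1" by (simp add: gns_inner_def)
    with \<phi>0 \<psi>0 show ?thesis by blast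
  qed
  fix x
  assume "x \<in> {sqrt (Re (gns_inner \<phi> \<psi> (tensor_mult us vs) (tensor_mult us vs))) |\<phi> \<psi> vs.
      is_state \<phi> \<and> is_state \<psi> \<and> Re (gns_inner \<phi> \<psi> vs vs) \<le> 1}"
  then obtain \<phi> \<psi> vs where x: "x = sqrt (Re (gns_inner \<phi> \<psi> (tensor_mult us vs) (tensor_mult us vs)))"
    and *: "is_state \<phi>" "is_state \<psi>" "Re (gns_inner \<phi> \<psi> vs vs) \<le> 1" by blast
  have "Re (gns_inner \<phi> \<psi> (tensor_mult us vs) (tensor_mult us vs)) \<le> N\<^sup>2 * 1"
    using le[OF *(1,2), of vs] mult_left_mono[OF *(3), of "N\<^sup>2"] by simp
  then show "x \<le> N"
    using N by (simp add: x real_le_lsqrt)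
qed

section \<open>Minimal tensor products\<close>

text \<open>Reads a formal tensor through any map of two variables, so that one list can be compared
  under \<open>t\<close>, \<open>P\<close> or \<open>\<beta> f * cs 1 b\<close>.\<close>

definition tsum :: "('a \<Rightarrow> 'b \<Rightarrow> 'c :: monoid_add) \<Rightarrow> ('a \<times> 'b) list \<Rightarrow> 'c"
  where "tsum t us = (\<Sum>u\<leftarrow>us. t (fst u) (snd u))"

lemma tsum_simps [simp]:
  "tsum t [] = 0" "tsum t (u # us) = t (fst u) (snd u) + tsum t us"
  "tsum t (us @ vs) = tsum t us + tsum t vs"
  by (simp_all add: tsum_def)

lemma linear_tsum: "linear f \<Longrightarrow> f (tsum t us) = tsum (\<lambda>a b. f (t a b)) us"
  by (induction us) (simp_all add: linear_0 linear_add)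

lemma tsum_map: "tsum t (map (\<lambda>(a, b). (f a b, g a b)) us) = tsum (\<lambda>a b. t (f a b) (g a b)) us"
  by (simp add: tsum_def comp_def case_prod_unfold)

lemma span_tsum:
  fixes t :: "'a \<Rightarrow> 'b \<Rightarrow> 'c :: unital_cstar_algebra"
  assumes "\<And>c a b. \<exists>a'. c *\<^sub>C t a b = t a' b"
  shows "complex_vector.span {t a b |a b. True} = range (tsum t)"
proof (rule subset_antisym)
  have "complex_vector.subspace (range (tsum t))"
    unfolding complex_vector.subspace_def
  proof (intro conjI ballI allI)
    show "0 \<in> range (tsum t)" by (rule range_eqI[of _ _ "[]"]) simp
    show "x + y \<in> range (tsum t)" if xy: "x \<in> range (tsum t)" "y \<in> range (tsum t)" for x y
    proof -
      from xy obtain us vs where "x = tsum t us" "y = tsum t vs" by blast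
      then show ?thesis by (intro range_eqI[of _ _ "us @ vs"]) simp
    qed
    show "c *\<^sub>C x \<in> range (tsum t)" if x: "x \<in> range (tsum t)" for c x
    proof -
      from x obtain us where us: "x = tsum t us" by blast
      obtain f where f: "\<And>a b. c *\<^sub>C t a b = t (f a b) b" using assms by metis
      have "c *\<^sub>C x = tsum t (map (\<lambda>(a, b). (f a b, b)) us)"
        unfolding us tsum_map
        by (subst linear_tsum[OF bounded_linear.linear[OF bounded_linear_scaleC]]) (simp add: f)
      then show ?thesis by blast
    qed
  qed
  moreover have "{t a b |a b. True} \<subseteq> range (tsum t)"
  proof
    fix x assume "x \<in> {t a b |a b. True}"
    then obtain a b where "x = t a b" by blast
    then show "x \<in> range (tsum t)" by (intro range_eqI[of _ _ "[(a, b)]"]) simp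
  qed
  ultimately show "complex_vector.span {t a b |a b. True} \<subseteq> range (tsum t)"
    by (rule complex_vector.span_minimal[rotated])
next
  have "tsum t us \<in> complex_vector.span {t a b |a b. True}" for us
  proof (induction us)
    case (Cons u us)
    have "t (fst u) (snd u) \<in> complex_vector.span {t a b |a b. True}"
      by (rule complex_vector.span_base) blast
    with Cons show ?case by (simp only: tsum_simps complex_vector.span_add)
  qed (simp add: complex_vector.span_zero)
  then show "range (tsum t) \<subseteq> complex_vector.span {t a b |a b. True}" by blast
qed

lemma closure_range_seq:
  assumes "closure (range f) = (UNIV :: 'a :: real_normed_vector set)"
  obtains us where "(\<lambda>n :: nat. f (us n)) \<longlonglongrightarrow> z"
proof -
  have "z \<in> closure (range f)" using assms by simp
  then obtain x where x: "\<And>n :: nat. x n \<in> range f" "x \<longlonglongrightarrow> z"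
    unfolding closure_sequential by blast
  then have "\<forall>n. \<exists>u. x n = f u" by blast
  then obtain us where "\<forall>n. x n = f (us n)" by (rule choice[THEN exE])
  then have "x = (\<lambda>n. f (us n))" by blast
  with x(2) show thesis using that[of us] by simp
qed

locale tensor =
  fixes t :: "'a :: unital_cstar_algebra \<Rightarrow> 'b :: unital_cstar_algebra \<Rightarrow> 'c :: unital_cstar_algebra"
  assumes min_tensor: "min_tensor t"
begin

lemma clinear1: "clinear (\<lambda>a. t a b)" and clinear2: "clinear (t a)"
  and one [simp]: "t 1 1 = 1"
  and mult: "t a b * t c d = t (a * c) (b * d)"
  and star_t: "star (t a b) = t (star a) (star b)"
  and norm_tsum: "norm (tsum t us) = spatial_norm us"
  using min_tensor unfolding min_tensor_def tsum_def case_prod_unfold by blast+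

lemma scale1: "t (c *\<^sub>C a) b = c *\<^sub>C t a b" and add1: "t (a + a') b = t a b + t a' b"
  using clinear1[of b] unfolding clinear_iff by blast+

lemma scale2: "t a (c *\<^sub>C b) = c *\<^sub>C t a b" and add2: "t a (b + b') = t a b + t a b'"
  using clinear2[of a] unfolding clinear_iff by blast+

lemma dense: "closure (range (tsum t)) = UNIV"
proof -
  have "\<exists>a'. c *\<^sub>C t a b = t a' b" for c a b
    by (rule exI[of _ "c *\<^sub>C a"]) (simp only: scale1)
  then have "complex_vector.span {t a b |a b. True} = range (tsum t)"
    by (rule span_tsum)
  moreover have "closure (complex_vector.span {t a b |a b. True}) = UNIV"
    using min_tensor unfolding min_tensor_def by blast
  ultimately show ?thesis by simp
qed

lemma seq: obtains us where "(\<lambda>n :: nat. tsum t (us n)) \<longlonglongrightarrow> z"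
  using closure_range_seq[OF dense] .

lemma closed_induct:
  assumes "closed {z. P z}" "\<And>us. P (tsum t us)"
  shows "P z"
proof -
  have "closure (range (tsum t)) \<subseteq> {z. P z}"
    by (rule closure_minimal) (use assms in auto)
  with dense show ?thesis by auto
qed

text \<open>Real linearity is enough, so that identities involving the antilinear
  \<open>star\<close> are covered.\<close>

lemma eqI:
  fixes f g :: "'c \<Rightarrow> 'd :: real_normed_vector"
  assumes "bounded_linear f" "bounded_linear g" "\<And>a b. f (t a b) = g (t a b)"
  shows "f z = g z"
proof (rule closed_induct)
  show "closed {z. f z = g z}"
    by (intro closed_Collect_eq linear_continuous_on assms)
  show "f (tsum t us) = g (tsum t us)" for us
    using assms(3) by (simp add: linear_tsum bounded_linear.linear assms(1,2))
qed

lemma tsum_tensor_mult: "tsum t (tensor_mult us vs) = tsum t us * tsum t vs"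
proof (induction us)
  case (Cons u us)
  obtain a b where u: "u = (a, b)" by force
  have "tsum t (map (\<lambda>(c, d). (a * c, b * d)) vs) = t a b * tsum t vs"
    by (induction vs) (auto simp: mult distrib_left)
  with Cons show ?case by (simp add: u tensor_mult_Cons distrib_right)
qed simp

lemma tsum_star: "star (tsum t us) = tsum t (map (\<lambda>(a, b). (star a, star b)) us)"
  by (induction us) (auto simp: star_add star_t)

lemma clinear_of_elementary:
  fixes f :: "'c \<Rightarrow> 'd :: unital_cstar_algebra"
  assumes f: "bounded_linear f" and s: "\<And>c a b. f (t (c *\<^sub>C a) b) = c *\<^sub>C f (t a b)"
  shows "clinear f"
proof (rule clinearI)
  show "f (x + y) = f x + f y" for x y by (rule linear_add[OF bounded_linear.linear[OF f]])
  show "f (c *\<^sub>C x) = c *\<^sub>C f x" for c x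
  proof (rule eqI)
    show "bounded_linear (\<lambda>x. f (c *\<^sub>C x))"
      by (rule bounded_linear_compose[OF f bounded_linear_scaleC])
    show "bounded_linear (\<lambda>x. c *\<^sub>C f x)"
      by (rule bounded_linear_compose[OF bounded_linear_scaleC f])
  qed (simp add: s flip: scale1)
qed

text \<open>The bound makes the value independent of the representing list and Lipschitz on
  algebraic tensors; completeness of the target then gives the extension. Negatives and real
  multiples of a list are formed in its first components.\<close>

lemma extension:
  fixes \<phi> :: "'a \<Rightarrow> 'b \<Rightarrow> 'd :: unital_cstar_algebra"
  assumes \<phi>1: "\<And>b. clinear (\<lambda>a. \<phi> a b)"
    and bound: "\<And>us. norm (tsum \<phi> us) \<le> C * norm (tsum t us)"
  obtains E where "bounded_clinear E" "\<And>a b. E (t a b) = \<phi> a b"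
proof -
  define e where "e z = tsum \<phi> (SOME us. tsum t us = z)" for z
  define neg where "neg us = map (\<lambda>(a :: 'a, b :: 'b). (- a, b)) us" for us
  have neg: "tsum \<psi> (neg us) = - tsum \<psi> us" if "\<And>b. clinear (\<lambda>a. \<psi> a b)" for \<psi> :: "'a \<Rightarrow> 'b \<Rightarrow> 'e :: unital_cstar_algebra" and us
    by (induction us) (auto simp: neg_def clinear_minus[OF that])
  have dist: "norm (tsum \<phi> us - tsum \<phi> vs) \<le> C * norm (tsum t us - tsum t vs)" for us vs
    using bound[of "us @ neg vs"] by (simp add: neg[OF \<phi>1] neg[OF clinear1])
  have e: "e (tsum t us) = tsum \<phi> us" for us
  proof -
    have "tsum t (SOME vs. tsum t vs = tsum t us) = tsum t us"
      by (rule someI) simp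
    then show ?thesis
      using dist[of "SOME vs. tsum t vs = tsum t us" us] by (simp add: e_def)
  qed
  have "0 \<le> C"
    using bound[of "[(1, 1)]"] order_trans[OF norm_ge_zero[of "\<phi> 1 1"]] by simp
  then have "C-lipschitz_on (range (tsum t)) e"
    by (intro lipschitz_onI) (auto simp: e dist_norm dist)
  then have "uniformly_continuous_on (range (tsum t)) e"
    by (rule lipschitz_on_uniformly_continuous)
  then obtain g where uc: "uniformly_continuous_on (closure (range (tsum t))) g"
    and eg: "\<And>x. x \<in> range (tsum t) \<Longrightarrow> e x = g x"
    by (rule uniformly_continuous_on_extension_on_closure) (rule that)
  from uc have g: "continuous_on UNIV g"
    unfolding dense by (rule uniformly_continuous_imp_continuous)
  have gt: "g (tsum t us) = tsum \<phi> us" for us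
    unfolding e[symmetric] by (rule eg[symmetric]) (rule rangeI)
  have lim: "(\<lambda>n. tsum \<phi> (us n)) \<longlonglongrightarrow> g z" if "(\<lambda>n. tsum t (us n)) \<longlonglongrightarrow> z" for us z
    using continuous_on_tendsto_compose[OF g that] by (simp add: gt)
  have lin: "bounded_linear g"
  proof (rule bounded_linear_intro)
    show "g (x + y) = g x + g y" for x y
    proof -
      obtain us where us: "(\<lambda>n. tsum t (us n)) \<longlonglongrightarrow> x" using seq .
      obtain vs where vs: "(\<lambda>n. tsum t (vs n)) \<longlonglongrightarrow> y" using seq .
      have "(\<lambda>n. tsum t (us n @ vs n)) \<longlonglongrightarrow> x + y" using tendsto_add[OF us vs] by simp
      from lim[OF this] have "(\<lambda>n. tsum \<phi> (us n) + tsum \<phi> (vs n)) \<longlonglongrightarrow> g (x + y)" by simp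
      with tendsto_add[OF lim[OF us] lim[OF vs]] show ?thesis by (metis LIMSEQ_unique)
    qed
    show "g (r *\<^sub>R x) = r *\<^sub>R g x" for r x
    proof -
      obtain us where us: "(\<lambda>n. tsum t (us n)) \<longlonglongrightarrow> x" using seq .
      define vs where "vs n = map (\<lambda>(a, b). (r *\<^sub>R a, b)) (us n)" for n
      have *: "tsum \<psi> (vs n) = r *\<^sub>R tsum \<psi> (us n)" if "\<And>b. clinear (\<lambda>a. \<psi> a b)"
        for \<psi> :: "'a \<Rightarrow> 'b \<Rightarrow> 'e :: unital_cstar_algebra" and n
        unfolding vs_def tsum_map linear_tsum[OF linear_scaleR] by (simp add: clinear_scaleR[OF that])
      have "(\<lambda>n. tsum t (vs n)) \<longlonglongrightarrow> r *\<^sub>R x"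
        unfolding *[OF clinear1] by (rule tendsto_scaleR[OF tendsto_const us])
      from lim[OF this] have "(\<lambda>n. r *\<^sub>R tsum \<phi> (us n)) \<longlonglongrightarrow> g (r *\<^sub>R x)"
        unfolding *[OF \<phi>1] .
      with tendsto_scaleR[OF tendsto_const lim[OF us]] show ?thesis by (metis LIMSEQ_unique)
    qed
    show "norm (g x) \<le> norm x * C" for x
    proof -
      obtain us where us: "(\<lambda>n. tsum t (us n)) \<longlonglongrightarrow> x" using seq .
      show ?thesis
        by (rule LIMSEQ_le[OF tendsto_norm[OF lim[OF us]] tendsto_mult[OF tendsto_norm[OF us] tendsto_const]])
           (use bound in \<open>auto simp: mult.commute\<close>)
    qed
  qed
  have gab: "g (t a b) = \<phi> a b" for a b
    using gt[of "[(a, b)]"] by simp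
  have "clinear g"
    by (rule clinear_of_elementary[OF lin]) (simp add: gab clinear_scaleC[OF \<phi>1])
  with lin gab show thesis by (intro that) (simp_all add: bounded_clinear_def)
qed

section \<open>Positive functionals on a tensor product and contractive homomorphisms\<close>

text \<open>After normalisation this is the spatial norm tested on the vector
  \<open>1 \<otimes> 1\<close>. A positive functional vanishing at 1 is zero, so the division is
  harmless.\<close>

lemma gns_tsum_le:
  assumes "pos_fun \<phi>" "pos_fun \<psi>"
  shows "Re (gns_inner \<phi> \<psi> us us) \<le> Re (\<phi> 1) * Re (\<psi> 1) * (norm (tsum t us))\<^sup>2"
proof -
  have scaled: "\<exists>\<phi>0. is_state \<phi>0 \<and> (\<forall>x. \<phi> x = of_real (Re (\<phi> 1)) * \<phi>0 x)"
    if \<phi>: "pos_fun \<phi>" "Re (\<phi> 1) \<noteq> 0" for \<phi> :: "'e :: unital_cstar_algebra \<Rightarrow> complex"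
  proof -
    have one: "\<phi> 1 = of_real (Re (\<phi> 1))" using pos_fun_self[OF \<phi>(1), of 1] unfolding star_one mult_1_left .
    have "0 < Re (\<phi> 1)" using pos_fun_Re[OF \<phi>(1), of 1] \<phi>(2) by simp
    define \<phi>0 where "\<phi>0 x = of_real (1 / Re (\<phi> 1)) * \<phi> x" for x
    have "clinear \<phi>0"
      unfolding \<phi>0_def
      by (rule clinear_compose[OF clinear_mult_left pos_fun_clinear[OF \<phi>(1)]])
    moreover have "\<phi>0 (star x * x) = of_real (Re (\<phi> (star x * x)) / Re (\<phi> 1))" for x
      unfolding \<phi>0_def by (subst pos_fun_self[OF \<phi>(1)]) simp
    then have "\<phi>0 (star x * x) \<in> \<real>\<^sub>\<ge>\<^sub>0" for x
      using \<open>0 < Re (\<phi> 1)\<close> pos_fun_Re[OF \<phi>(1), of x] by (simp add: complex_nonneg_Reals_iff)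
    moreover have "\<phi>0 1 = 1"
      unfolding \<phi>0_def by (subst one) (use \<phi>(2) in simp)
    ultimately have "is_state \<phi>0" by (simp add: is_state_def)
    moreover have "\<phi> x = of_real (Re (\<phi> 1)) * \<phi>0 x" for x
      using \<phi>(2) by (simp add: \<phi>0_def)
    ultimately show ?thesis by blast
  qed
  have zero: "\<phi> x = 0" if "pos_fun \<phi>" "Re (\<phi> 1) = 0" for \<phi> :: "'e :: unital_cstar_algebra \<Rightarrow> complex" and x
    using pos_fun_norm_le[OF that(1), of x] that(2) by simp
  show ?thesis
  proof (cases "Re (\<phi> 1) = 0 \<or> Re (\<psi> 1) = 0")
    case True
    then have "(\<forall>x. \<phi> x = 0) \<or> (\<forall>x. \<psi> x = 0)"
      using zero[OF assms(1)] zero[OF assms(2)] by blast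
    then have "gns_inner \<phi> \<psi> us us = 0"
      by (auto simp: gns_inner_def case_prod_unfold)
    with True show ?thesis by auto
  next
    case False
    obtain \<phi>0 where \<phi>0: "is_state \<phi>0" "\<And>x. \<phi> x = of_real (Re (\<phi> 1)) * \<phi>0 x"
      using scaled[OF assms(1)] False by blast
    obtain \<psi>0 where \<psi>0: "is_state \<psi>0" "\<And>x. \<psi> x = of_real (Re (\<psi> 1)) * \<psi>0 x"
      using scaled[OF assms(2)] False by blast
    have "gns_inner \<phi> \<psi> us us =
        tform (\<lambda>x y. of_real (Re (\<phi> 1)) * \<phi>0 (star y * x)) (\<lambda>x y. of_real (Re (\<psi> 1)) * \<psi>0 (star y * x)) us us"
      unfolding gns_inner_tform \<phi>0(2)[symmetric] \<psi>0(2)[symmetric] ..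
    also have "\<dots> = of_real (Re (\<phi> 1) * Re (\<psi> 1)) * gns_inner \<phi>0 \<psi>0 us us"
      unfolding tform_scaleR_left tform_scaleR_right gns_inner_tform by simp
    finally have "Re (gns_inner \<phi> \<psi> us us) = Re (\<phi> 1) * Re (\<psi> 1) * Re (gns_inner \<phi>0 \<psi>0 us us)"
      by simp
    also have "\<dots> \<le> Re (\<phi> 1) * Re (\<psi> 1) * (norm (tsum t us))\<^sup>2"
    proof (rule mult_left_mono)
      show "Re (gns_inner \<phi>0 \<psi>0 us us) \<le> (norm (tsum t us))\<^sup>2"
        using gns_tensor_mult_le[OF \<phi>0(1) \<psi>0(1), of us "[(1, 1)]"] \<phi>0(1) \<psi>0(1)
        by (simp add: norm_tsum gns_inner_tform tform_sing is_state_iff)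
      show "0 \<le> Re (\<phi> 1) * Re (\<psi> 1)"
        using pos_fun_Re[OF assms(1), of 1] pos_fun_Re[OF assms(2), of 1] by simp
    qed
    finally show ?thesis .
  qed
qed

lemma gns_tsum:
  assumes \<Omega>: "linear \<Omega>" and eq: "\<And>a b. \<Omega> (t a b) = \<phi> a * \<psi> b"
  shows "\<Omega> (star (tsum t ws) * tsum t vs) = gns_inner \<phi> \<psi> vs ws"
proof -
  have "\<Omega> (star (tsum t ws) * t a b) = gns_inner \<phi> \<psi> [(a, b)] ws" for a b
    by (induction ws)
       (simp_all add: star_add distrib_right linear_add[OF \<Omega>] linear_0[OF \<Omega>] star_t mult eq
          gns_inner_tform tform_Cons2[of _ _ _ _ "_ # _"] tform_def)
  then show ?thesis
  proof (induction vs)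
    case (Cons v vs)
    then show ?case
      unfolding gns_inner_tform tform_Cons1[of _ _ v vs]
      by (simp add: distrib_left linear_add[OF \<Omega>])
  qed (simp add: linear_0[OF \<Omega>] gns_inner_def)
qed

text \<open>Cauchy-Schwarz against \<open>1 \<otimes> 1\<close> bounds
  \<open>\<phi> \<otimes> \<psi>\<close> on algebraic tensors; positivity holds there by
  \<open>tform_Schur\<close> and survives limits.\<close>

lemma product_state:
  assumes \<phi>: "is_state \<phi>" and \<psi>: "is_state \<psi>"
  obtains \<Omega> where "is_state \<Omega>" "\<And>a b. \<Omega> (t a b) = \<phi> a * \<psi> b"
proof -
  note p\<phi> = state_pos_fun[OF \<phi>] and p\<psi> = state_pos_fun[OF \<psi>]
  have "norm (tsum (\<lambda>a b. \<phi> a * \<psi> b) us) \<le> 1 * norm (tsum t us)" for us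
  proof -
    have "tsum (\<lambda>a b. \<phi> a * \<psi> b) us = gns_inner \<phi> \<psi> us [(1, 1)]"
      by (simp add: gns_inner_tform tform_def tsum_def)
    then have "(norm (tsum (\<lambda>a b. \<phi> a * \<psi> b) us))\<^sup>2 \<le>
        Re (gns_inner \<phi> \<psi> us us) * Re (gns_inner \<phi> \<psi> [(1, 1)] [(1, 1)])"
      unfolding gns_inner_tform
      using tform_Cauchy_Schwarz[OF pos_fun_form[OF p\<phi>] pos_fun_form[OF p\<psi>], of us "[(1, 1)]"] by simp
    also have "\<dots> \<le> (norm (tsum t us))\<^sup>2"
      using gns_tsum_le[OF p\<phi> p\<psi>, of us] \<phi> \<psi> by (simp add: gns_inner_tform tform_sing is_state_iff)
    finally show ?thesis by (simp add: power2_le_iff_abs_le)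
  qed
  moreover have "clinear (\<lambda>a. \<phi> a * \<psi> b)" for b
    by (rule clinear_compose[OF clinear_mult_right pos_fun_clinear[OF p\<phi>]])
  ultimately obtain \<Omega> where \<Omega>: "bounded_clinear \<Omega>" "\<And>a b. \<Omega> (t a b) = \<phi> a * \<psi> b"
    using extension[of "\<lambda>a b. \<phi> a * \<psi> b" 1] by metis
  have bl: "bounded_linear \<Omega>" using \<Omega>(1) by (simp add: bounded_clinear_def)
  have "\<Omega> (star z * z) \<in> \<real>\<^sub>\<ge>\<^sub>0" for z
  proof (rule closed_induct[where P = "\<lambda>z. \<Omega> (star z * z) \<in> \<real>\<^sub>\<ge>\<^sub>0"])
    have "continuous_on UNIV (\<lambda>z. \<Omega> (star z * z))"
      by (rule bounded_linear.continuous_on[OF bl continuous_on_mult[OF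
          bounded_linear.continuous_on[OF bounded_linear_star continuous_on_id] continuous_on_id]])
    from closed_vimage[OF closed_nonneg_Reals_complex this]
    show "closed {z. \<Omega> (star z * z) \<in> \<real>\<^sub>\<ge>\<^sub>0}"
      by (simp add: vimage_def)
    fix us
    have "\<Omega> (star (tsum t us) * tsum t us) = gns_inner \<phi> \<psi> us us"
      by (rule gns_tsum[OF bounded_linear.linear[OF bl] \<Omega>(2)])
    moreover have "0 \<le> Re (gns_inner \<phi> \<psi> us us)"
      by (rule gns_inner_nonneg[OF p\<phi> p\<psi>])
    moreover have "gns_inner \<phi> \<psi> us us = cnj (gns_inner \<phi> \<psi> us us)"
      unfolding gns_inner_tform by (rule tform_sym[OF pos_fun_form[OF p\<phi>] pos_fun_form[OF p\<psi>]])
    then have "Im (gns_inner \<phi> \<psi> us us) = - Im (gns_inner \<phi> \<psi> us us)"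
      by (metis cnj.simps(2))
    ultimately show "\<Omega> (star (tsum t us) * tsum t us) \<in> \<real>\<^sub>\<ge>\<^sub>0"
      by (simp add: complex_nonneg_Reals_iff)
  qed
  moreover have "\<Omega> 1 = 1"
    using \<Omega>(2)[of 1 1] \<phi> \<psi> by (simp add: is_state_iff)
  ultimately have "is_state \<Omega>"
    using \<Omega>(1) by (simp add: is_state_def bounded_clinear_def)
  from this \<Omega>(2) show thesis by (rule that)
qed

lemma norm_elementary_le:
  assumes \<phi>0: "is_state (\<phi>0 :: 'a \<Rightarrow> complex)" and \<psi>0: "is_state (\<psi>0 :: 'b \<Rightarrow> complex)"
  shows "norm (t a b) \<le> norm a * norm b"
proof -
  have "spatial_norm [(a, b)] \<le> norm a * norm b"
  proof (rule spatial_norm_le[OF \<phi>0 \<psi>0])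
    fix \<phi> :: "'a \<Rightarrow> complex" and \<psi> :: "'b \<Rightarrow> complex" and vs
    assume "is_state \<phi>" "is_state \<psi>"
    from gns_elementary_bound[OF this[THEN state_pos_fun], of a b vs]
    show "Re (gns_inner \<phi> \<psi> (tensor_mult [(a, b)] vs) (tensor_mult [(a, b)] vs)) \<le>
        (norm a * norm b)\<^sup>2 * Re (gns_inner \<phi> \<psi> vs vs)"
      by (simp add: tensor_mult_Cons)
  qed simp
  then show ?thesis by (simp flip: norm_tsum)
qed

lemma bounded_linear1:
  assumes "is_state (\<phi>0 :: 'a \<Rightarrow> complex)" "is_state (\<psi>0 :: 'b \<Rightarrow> complex)"
  shows "bounded_linear (\<lambda>a. t a b)"
  by (rule bounded_linear_intro[where K = "norm b"])
     (simp_all add: add1 scaleR_scaleC scale1 norm_elementary_le[OF assms])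

lemma bounded_linear2:
  assumes "is_state (\<phi>0 :: 'a \<Rightarrow> complex)" "is_state (\<psi>0 :: 'b \<Rightarrow> complex)"
  shows "bounded_linear (t a)"
  by (rule bounded_linear_intro[where K = "norm a"])
     (simp_all add: add2 scaleR_scaleC scale2 mult.commute[of "norm _" "norm a"] norm_elementary_le[OF assms])

text \<open>The spatial norm is a supremum over product states and algebraic vectors, so a bound
  seen by all states bounds the norm. This is the converse of
  \<open>pos_fun_mult_le\<close>.\<close>

lemma norm_le_of_states:
  fixes z :: 'c
  assumes \<phi>0: "is_state (\<phi>0 :: 'a \<Rightarrow> complex)" and \<psi>0: "is_state (\<psi>0 :: 'b \<Rightarrow> complex)"
    and N: "0 \<le> N"
    and le: "\<And>(\<Omega> :: 'c \<Rightarrow> complex) v. is_state \<Omega> \<Longrightarrow> Re (\<Omega> (star (z * v) * (z * v))) \<le> N\<^sup>2 * Re (\<Omega> (star v * v))"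
  shows "norm z \<le> N"
proof (rule field_le_epsilon)
  fix \<epsilon> :: real assume \<epsilon>: "0 < \<epsilon>"
  have "z \<in> closure (range (tsum t))" using dense by simp
  \<comment> \<open>One half of \<open>\<epsilon>\<close> pays for replacing \<open>z\<close> by
    \<open>tsum t us\<close> under the states, the other for returning to \<open>z\<close> in
    norm.\<close>
  then obtain us where us: "norm (tsum t us - z) < \<epsilon> / 2"
    unfolding closure_approachable dist_norm using \<epsilon> by (metis half_gt_zero imageE)
  have "spatial_norm us \<le> N + \<epsilon> / 2"
  proof (rule spatial_norm_le[OF \<phi>0 \<psi>0])
    show "0 \<le> N + \<epsilon> / 2" using N \<epsilon> by simp
    fix \<phi> :: "'a \<Rightarrow> complex" and \<psi> :: "'b \<Rightarrow> complex" and vs assume st: "is_state \<phi>" "is_state \<psi>"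
    obtain \<Omega> where \<Omega>: "is_state \<Omega>" "\<And>a b. \<Omega> (t a b) = \<phi> a * \<psi> b"
      using product_state[OF st] by metis
    note p = state_pos_fun[OF \<Omega>(1)]
    have lin: "linear \<Omega>" by (rule clinear_imp_linear[OF pos_fun_clinear[OF p]])
    define v where "v = tsum t vs"
    define q where "q x = sqrt (Re (\<Omega> (star x * x)))" for x
    have q: "0 \<le> q x" "(q x)\<^sup>2 = Re (\<Omega> (star x * x))" for x
      using pos_fun_Re[OF p] by (simp_all add: q_def)
    have "q (tsum t us * v) \<le> q (z * v) + q ((tsum t us - z) * v)"
      using pos_form_triangle[OF pos_fun_form[OF p], of "z * v" "(tsum t us - z) * v"]
      by (simp add: q_def algebra_simps)
    moreover have "q (z * v) \<le> N * q v"
    proof (rule power2_le_imp_le)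
      show "(q (z * v))\<^sup>2 \<le> (N * q v)\<^sup>2"
        using le[OF \<Omega>(1), of v] by (simp add: q(2) power_mult_distrib)
      show "0 \<le> N * q v" using N q by simp
    qed
    moreover have "q ((tsum t us - z) * v) \<le> \<epsilon> / 2 * q v"
    proof (rule power2_le_imp_le)
      have "(q ((tsum t us - z) * v))\<^sup>2 \<le> (norm (tsum t us - z))\<^sup>2 * (q v)\<^sup>2"
        using pos_fun_mult_le[OF p] by (simp add: q(2))
      also have "\<dots> \<le> (\<epsilon> / 2)\<^sup>2 * (q v)\<^sup>2"
        using us by (intro mult_right_mono power_mono) auto
      finally show "(q ((tsum t us - z) * v))\<^sup>2 \<le> (\<epsilon> / 2 * q v)\<^sup>2"
        unfolding power_mult_distrib .
      show "0 \<le> \<epsilon> / 2 * q v" using \<epsilon> q by simp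
    qed
    ultimately have "q (tsum t us * v) \<le> (N + \<epsilon> / 2) * q v"
      by (simp add: distrib_right)
    then have "(q (tsum t us * v))\<^sup>2 \<le> ((N + \<epsilon> / 2) * q v)\<^sup>2"
      using q by (intro power_mono) auto
    then show "Re (gns_inner \<phi> \<psi> (tensor_mult us vs) (tensor_mult us vs)) \<le>
        (N + \<epsilon> / 2)\<^sup>2 * Re (gns_inner \<phi> \<psi> vs vs)"
      by (simp add: q(2) power_mult_distrib v_def gns_tsum[OF lin \<Omega>(2)] flip: tsum_tensor_mult)
  qed
  then have "norm (tsum t us) \<le> N + \<epsilon> / 2" by (simp add: norm_tsum)
  moreover have "norm z \<le> norm (tsum t us) + norm (tsum t us - z)"
    by (metis norm_triangle_sub norm_minus_commute)
  ultimately show "norm z \<le> N + \<epsilon>" using us by linarith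
qed

text \<open>Apply \<open>f\<close> to \<open>star y * y = r\<^sup>2 - star x * x\<close> and
  evaluate states of the target, whose norm they control by
  \<open>norm_le_of_states\<close>.\<close>

lemma star_hom_contractive:
  fixes f :: "'e :: unital_cstar_algebra \<Rightarrow> 'c"
  assumes \<phi>0: "is_state (\<phi>0 :: 'a \<Rightarrow> complex)" and \<psi>0: "is_state (\<psi>0 :: 'b \<Rightarrow> complex)"
    and f: "unital_star_hom f"
  shows "norm (f x) \<le> norm x"
proof (rule norm_le_of_states[OF \<phi>0 \<psi>0 norm_ge_zero])
  fix \<Omega> :: "'c \<Rightarrow> complex" and v assume "is_state \<Omega>"
  then have p: "pos_fun \<Omega>" by (rule state_pos_fun)
  have lin: "clinear f" and f1: "f 1 = 1" and fm: "\<And>x y. f (x * y) = f x * f y"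
    and fs: "\<And>x. f (star x) = star (f x)"
    using f by (auto simp: unital_star_hom_def)
  show "Re (\<Omega> (star (f x * v) * (f x * v))) \<le> (norm x)\<^sup>2 * Re (\<Omega> (star v * v))"
  proof (rule le_of_all_greater)
    fix r assume "norm x < r"
    then obtain y where y: "star y * y = of_real (r\<^sup>2) - star x * x"
      using norm_bound_decomp by metis
    have "star (f y) * f y = f (star y * y)" by (simp add: fm fs)
    also have "\<dots> = of_real (r\<^sup>2) - star (f x) * f x"
      unfolding y clinear_diff[OF lin] of_real_def clinear_scaleR[OF lin] fm fs f1 ..
    finally have fy: "star (f y) * f y = of_real (r\<^sup>2) - star (f x) * f x" .
    have "star (f y * v) * (f y * v) = star v * (star (f y) * f y) * v"
      by (simp add: star_mult mult.assoc)
    also have "\<dots> = complex_of_real (r\<^sup>2) *\<^sub>C (star v * v) - star (f x * v) * (f x * v)"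
      unfolding fy right_diff_distrib left_diff_distrib of_real_mult_scaleC
      by (simp add: star_mult mult.assoc)
    finally have "\<Omega> (star (f y * v) * (f y * v)) =
        of_real (r\<^sup>2) * \<Omega> (star v * v) - \<Omega> (star (f x * v) * (f x * v))"
      using pos_fun_clinear[OF p] by (simp only: clinear_diff clinear_scaleC scaleC_complex)
    then show "Re (\<Omega> (star (f x * v) * (f x * v))) \<le> r\<^sup>2 * Re (\<Omega> (star v * v))"
      using pos_fun_Re[OF p, of "f y * v"] by simp
  qed
qed

lemma star_hom_bounded_linear:
  fixes f :: "'e :: unital_cstar_algebra \<Rightarrow> 'c"
  assumes "is_state (\<phi>0 :: 'a \<Rightarrow> complex)" "is_state (\<psi>0 :: 'b \<Rightarrow> complex)" "unital_star_hom f"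
  shows "bounded_linear f"
proof (rule bounded_linear_intro)
  have lin: "clinear f" using assms(3) by (simp add: unital_star_hom_def)
  show "f (x + y) = f x + f y" "f (r *\<^sub>R x) = r *\<^sub>R f x" for x y r
    by (fact clinear_add[OF lin] clinear_scaleR[OF lin])+
  show "norm (f x) \<le> norm x * 1" for x
    using star_hom_contractive[OF assms] by simp
qed

end

section \<open>Compact quantum groups with faithful Haar state\<close>

locale cqg_haar = compact_quantum_group ss ss_s s_ss \<Delta>
  for ss :: "'s :: unital_cstar_algebra \<Rightarrow> 's \<Rightarrow> 'ss :: unital_cstar_algebra"
    and ss_s :: "'ss \<Rightarrow> 's \<Rightarrow> 'sss :: unital_cstar_algebra"
    and s_ss :: "'s \<Rightarrow> 'ss \<Rightarrow> 'sss"
    and \<Delta> :: "'s \<Rightarrow> 'ss" +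
  fixes h :: "'s \<Rightarrow> complex" and L R :: "'ss \<Rightarrow> 's"
  assumes state: "is_state h"
    and faithful: "faithful_functional h"
    and L: "left_slice ss h L" and R: "right_slice ss h R"
    and R_\<Delta>: "R (\<Delta> a) = h a *\<^sub>C 1" and L_\<Delta>: "L (\<Delta> a) = h a *\<^sub>C 1"
begin

sublocale S2: tensor ss
  using tensors by unfold_locales (simp add: min_tensor3_def)

sublocale S3: tensor ss_s
  using tensors by unfold_locales (simp add: min_tensor3_def)

sublocale S3': tensor s_ss
  using tensors by unfold_locales (simp add: min_tensor3_def)

lemma assoc: "ss_s (ss a b) c = s_ss a (ss b c)"
  using tensors by (simp add: min_tensor3_def)

lemma h_pos_fun: "pos_fun h" by (rule state_pos_fun[OF state])

lemma h_form: "pos_form (\<lambda>a c. h (star c * a))" by (rule pos_fun_form[OF h_pos_fun])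

lemma h_clinear: "clinear h" by (rule pos_fun_clinear[OF h_pos_fun])

lemma h_bounded: "bounded_linear h" by (rule pos_fun_bounded_linear[OF h_pos_fun])

lemma h_one [simp]: "h 1 = 1" using state by (simp add: is_state_def)

lemma h_star: "h (star a) = cnj (h a)" by (rule pos_fun_star[OF h_pos_fun])

lemmas h_add = clinear_add[OF h_clinear] and h_diff = clinear_diff[OF h_clinear]
  and h_zero = clinear_zero[OF h_clinear]

lemma h_scale: "h (c *\<^sub>C a) = c * h a"
  using clinear_scaleC[OF h_clinear, of c a] by simp

lemma h_faithful: "h (star a * a) = 0 \<Longrightarrow> a = 0"
  using faithful by (simp add: faithful_functional_def)

lemma eq_of_h:
  assumes "\<And>c. h (c * a) = h (c * b)"
  shows "a = b"
proof -
  have "h (star (a - b) * (a - b)) = 0"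
    using assms[of "star (a - b)"] by (simp add: right_diff_distrib h_diff)
  then show ?thesis using h_faithful by fastforce
qed

lemma L_bounded: "bounded_linear L" and L_ss: "L (ss a b) = h a *\<^sub>C b"
  using L by (auto simp: left_slice_def bounded_clinear_def)

lemma R_bounded: "bounded_linear R" and R_clinear: "clinear R" and R_ss: "R (ss a b) = h b *\<^sub>C a"
  using R by (auto simp: right_slice_def bounded_clinear_def)

section \<open>The product Haar state and its slices\<close>

definition hh :: "'ss \<Rightarrow> complex"
  where "hh z = h (L z)"

lemma hh_ss: "hh (ss a b) = h a * h b"
  by (simp add: hh_def L_ss h_scale)

lemma hh_bounded: "bounded_linear hh"
  unfolding hh_def[abs_def] by (rule bounded_linear_compose[OF h_bounded L_bounded])

text \<open>Fubini for the two slices. With \<open>eq_of_h\<close> it reduces identities between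
  elements to identities between scalars.\<close>

lemma hh_R: "h (R z) = hh z"
  by (rule S2.eqI[OF bounded_linear_compose[OF h_bounded R_bounded] hh_bounded])
     (simp add: hh_ss R_ss h_scale)

lemma hh_L: "h (L z) = hh z"
  by (simp add: hh_def)

lemma hh_state: "is_state hh"
proof -
  obtain \<Omega> where \<Omega>: "is_state \<Omega>" "\<And>a b. \<Omega> (ss a b) = h a * h b"
    using S2.product_state[OF state state] by metis
  have "\<Omega> z = hh z" for z
    by (rule S2.eqI[OF pos_fun_bounded_linear[OF state_pos_fun[OF \<Omega>(1)]] hh_bounded])
       (simp add: \<Omega>(2) hh_ss)
  then have "\<Omega> = hh" by blast
  with \<Omega>(1) show ?thesis by simp
qed

lemma hh_pos_fun: "pos_fun hh" by (rule state_pos_fun[OF hh_state])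

lemma hh_form: "pos_form (\<lambda>a c. hh (star c * a))" by (rule pos_fun_form[OF hh_pos_fun])

lemma hh_clinear: "clinear hh" by (rule pos_fun_clinear[OF hh_pos_fun])

lemma hh_scale: "hh (c *\<^sub>C a) = c * hh a"
  using clinear_scaleC[OF hh_clinear, of c a] by simp

lemmas bounded_linear_intros = bounded_linear_ident bounded_linear_const_mult
  bounded_linear_mult_const bounded_linear_compose[OF h_bounded] bounded_linear_compose[OF L_bounded]
  bounded_linear_compose[OF R_bounded] bounded_linear_compose[OF hh_bounded]
  bounded_linear_compose[OF bounded_linear_scaleC]

lemma R_mult: "R (ss a 1 * z * ss b 1) = a * R z * b"
proof (rule S2.eqI)
  show "bounded_linear (\<lambda>z. R (ss a 1 * z * ss b 1))" "bounded_linear (\<lambda>z. a * R z * b)"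
    by (intro bounded_linear_intros)+
qed (simp add: S2.mult R_ss mult_scaleC_left mult_scaleC_right)

lemma L_mult: "L (ss 1 a * z * ss 1 b) = a * L z * b"
proof (rule S2.eqI)
  show "bounded_linear (\<lambda>z. L (ss 1 a * z * ss 1 b))" "bounded_linear (\<lambda>z. a * L z * b)"
    by (intro bounded_linear_intros)+
qed (simp add: S2.mult L_ss mult_scaleC_left mult_scaleC_right)

lemma R_mult1: "R (ss a 1 * z) = a * R z" and R_mult2: "R (z * ss b 1) = R z * b"
  using R_mult[of a z 1] R_mult[of 1 z b] by simp_all

lemma L_mult1: "L (ss 1 a * z) = a * L z" and L_mult2: "L (z * ss 1 b) = L z * b"
  using L_mult[of a z 1] L_mult[of 1 z b] by simp_all

lemma R_star: "R (star z) = star (R z)"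
proof (rule S2.eqI)
  show "bounded_linear (\<lambda>z. R (star z))" "bounded_linear (\<lambda>z. star (R z))"
    by (rule bounded_linear_compose[OF R_bounded bounded_linear_star]
        bounded_linear_compose[OF bounded_linear_star R_bounded])+
qed (simp add: S2.star_t R_ss star_scaleC h_star)

lemma L_star: "L (star z) = star (L z)"
proof (rule S2.eqI)
  show "bounded_linear (\<lambda>z. L (star z))" "bounded_linear (\<lambda>z. star (L z))"
    by (rule bounded_linear_compose[OF L_bounded bounded_linear_star]
        bounded_linear_compose[OF bounded_linear_star L_bounded])+
qed (simp add: S2.star_t L_ss star_scaleC h_star)

lemma \<Delta>_clinear: "clinear \<Delta>" and \<Delta>_one [simp]: "\<Delta> 1 = 1"
  and \<Delta>_mult: "\<Delta> (a * b) = \<Delta> a * \<Delta> b" and \<Delta>_star: "\<Delta> (star a) = star (\<Delta> a)"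
  using coproduct_hom by (auto simp: unital_star_hom_def)

lemma \<Delta>_bounded: "bounded_linear \<Delta>"
  by (rule S2.star_hom_bounded_linear[OF state state coproduct_hom])

lemma hh_sandwich1: "hh (ss a 1 * \<Delta> x * ss b 1) = h x * h (a * b)"
  by (simp flip: hh_R add: R_mult R_\<Delta> mult_scaleC_left mult_scaleC_right h_scale)

lemma hh_sandwich2: "hh (ss 1 a * \<Delta> x * ss 1 b) = h x * h (a * b)"
  by (simp flip: hh_L add: L_mult L_\<Delta> mult_scaleC_left mult_scaleC_right h_scale)

section \<open>Coassociativity and strong invariance\<close>

text \<open>\<open>F = \<Delta> \<otimes> id\<close>, \<open>G = id \<otimes> \<Delta>\<close> and
  \<open>hhh = h \<otimes> h \<otimes> h\<close>. The product state is built on one bracketing, and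
  \<open>assoc\<close> identifies it on the other.\<close>

lemma threefold:
  obtains F G hhh where
    "bounded_linear F" "bounded_linear G" "bounded_linear hhh"
    "\<And>x y. F (x * y) = F x * F y" "\<And>x y. G (x * y) = G x * G y"
    "\<And>a b. F (ss a b) = ss_s (\<Delta> a) b" "\<And>a b. G (ss a b) = s_ss a (\<Delta> b)"
    "\<And>a. F (\<Delta> a) = G (\<Delta> a)"
    "\<And>x c. hhh (ss_s x c) = hh x * h c" "\<And>a y. hhh (s_ss a y) = h a * hh y"
proof -
  obtain F G where FG: "tensor_hom ss ss_s \<Delta> id F" "tensor_hom ss s_ss id \<Delta> G" "F \<circ> \<Delta> = G \<circ> \<Delta>"
    using coassociative by blast
  obtain hhh where hhh: "is_state hhh" "\<And>x c. hhh (ss_s x c) = hh x * h c"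
    using S3.product_state[OF hh_state state] by metis
  have hhh_bounded: "bounded_linear hhh"
    by (rule pos_fun_bounded_linear[OF state_pos_fun[OF hhh(1)]])
  have hhh': "hhh (s_ss a y) = h a * hh y" for a y
  proof (rule S2.eqI)
    show "bounded_linear (\<lambda>y. hhh (s_ss a y))"
      by (rule bounded_linear_compose[OF hhh_bounded S3'.bounded_linear2[OF state hh_state]])
    show "bounded_linear (\<lambda>y. h a * hh y)"
      by (intro bounded_linear_intros hh_bounded)
  qed (simp add: hh_ss hhh(2) flip: assoc)
  have F: "unital_star_hom F" "\<And>a b. F (ss a b) = ss_s (\<Delta> a) b"
    using FG(1) by (simp_all add: tensor_hom_def)
  have G: "unital_star_hom G" "\<And>a b. G (ss a b) = s_ss a (\<Delta> b)"
    using FG(2) by (simp_all add: tensor_hom_def)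
  show thesis
  proof (rule that[OF _ _ hhh_bounded _ _ F(2) G(2) _ hhh(2) hhh'])
    show "bounded_linear F" "bounded_linear G"
      by (rule S3.star_hom_bounded_linear[OF hh_state state F(1)]
          S3.star_hom_bounded_linear[OF hh_state state G(1)])+
    show "F (x * y) = F x * F y" "G (x * y) = G x * G y" for x y
      using F(1) G(1) by (simp_all add: unital_star_hom_def)
    show "F (\<Delta> a) = G (\<Delta> a)" for a
      using FG(3) by (metis comp_apply)
  qed
qed

text \<open>
  In Sweedler notation, \<open>P f b = f\<^sub>1 h(f\<^sub>2 b)\<close>, \<open>Q b f = f\<^sub>1 h(b f\<^sub>2)\<close>, \<open>lt c b = h(c b\<^sub>1) b\<^sub>2\<close> and
  \<open>rt b c = h(b\<^sub>1 c) b\<^sub>2\<close>.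
\<close>

definition P :: "'s \<Rightarrow> 's \<Rightarrow> 's" where "P f b = R (\<Delta> f * ss 1 b)"
definition Q :: "'s \<Rightarrow> 's \<Rightarrow> 's" where "Q b f = R (ss 1 b * \<Delta> f)"
definition lt :: "'s \<Rightarrow> 's \<Rightarrow> 's" where "lt c b = L (ss c 1 * \<Delta> b)"
definition rt :: "'s \<Rightarrow> 's \<Rightarrow> 's" where "rt b c = L (\<Delta> b * ss c 1)"

lemma star_P: "star (P f b) = Q (star b) (star f)" and star_Q: "star (Q b f) = P (star f) (star b)"
  by (simp_all add: P_def Q_def star_mult S2.star_t \<Delta>_star flip: R_star)

lemma star_lt: "star (lt c b) = rt (star b) (star c)" and star_rt: "star (rt b c) = lt (star c) (star b)"
  by (simp_all add: lt_def rt_def star_mult S2.star_t \<Delta>_star flip: L_star)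

lemma ss_split: "ss a b = ss a 1 * ss 1 b" "ss a b = ss 1 b * ss a 1"
  by (simp_all add: S2.mult)

lemma hh_P: "hh (ss u 1 * \<Delta> f * ss 1 b) = h (u * P f b)"
  by (simp add: P_def mult.assoc R_mult1 flip: hh_R)

lemma hh_Q: "hh (ss 1 b * \<Delta> f * ss u 1) = h (Q b f * u)"
  by (simp add: Q_def R_mult2 flip: hh_R)

lemma h_lt: "h (lt u f * b) = h (u * P f b)"
  unfolding hh_P[symmetric] by (simp add: lt_def L_mult2 flip: hh_L)

lemma h_rt: "h (b * rt f u) = h (Q b f * u)"
  unfolding hh_Q[symmetric] by (simp add: rt_def mult.assoc L_mult1 flip: hh_L)

text \<open>Each identity evaluates one threefold element in two ways, by invariance on the first
  two legs or on the last two. With an antipode \<kappa>, both sides of the first would be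
  \<open>h(u f\<^sub>1) h(c \<kappa>(f\<^sub>2)) h(f\<^sub>3 b)\<close>: this is strong invariance
  with the antipode eliminated.\<close>

lemma Haar_identities:
  shows hh_lt_\<Delta>: "hh (ss c (lt u f) * \<Delta> b) = h (Q c u * P f b)"
    and hh_\<Delta>_rt: "hh (ss c 1 * \<Delta> b * ss 1 (rt f v)) = h (Q b f * Q c v)"
proof -
  obtain F G hhh where bl: "bounded_linear F" "bounded_linear G" "bounded_linear hhh"
    and mult: "\<And>x y. F (x * y) = F x * F y" "\<And>x y. G (x * y) = G x * G y"
    and F: "\<And>a b. F (ss a b) = ss_s (\<Delta> a) b" and G: "\<And>a b. G (ss a b) = s_ss a (\<Delta> b)"
    and FG: "\<And>a. F (\<Delta> a) = G (\<Delta> a)"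
    and hhh: "\<And>x c. hhh (ss_s x c) = hh x * h c" "\<And>a y. hhh (s_ss a y) = h a * hh y"
    by (rule threefold) (rule that)
  note intros = bounded_linear_intros bounded_linear_compose[OF bl(1)] bounded_linear_compose[OF bl(2)]
    bounded_linear_compose[OF bl(3)] bounded_linear_compose[OF S2.bounded_linear1[OF state state]]
    bounded_linear_compose[OF S2.bounded_linear2[OF state state]]
    bounded_linear_compose[OF S3.bounded_linear1[OF hh_state state]]
    bounded_linear_compose[OF S3'.bounded_linear2[OF state hh_state]]
  let ?c = "s_ss 1 (ss c 1)"
  have c: "?c = ss_s (ss 1 c) 1" by (simp add: assoc)
  have sw1: "hh (ss a 1 * \<Delta> x) = h x * h a" for a x
    using hh_sandwich1[of a x 1] by simp
  have sw2: "hh (ss 1 a * \<Delta> x) = h x * h a" for a x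
    using hh_sandwich2[of a x 1] by simp
  \<comment> \<open>\<open>F\<close> puts a coproduct on legs 1 and 2, and invariance integrates out
    leg 1. In \<open>GL\<close> the coproduct is on legs 2 and 3, and leg 3 is integrated
    out.\<close>
  have FL: "hhh (?c * F X * s_ss 1 Y) = hh (ss c (L X) * Y)" for X Y
  proof (rule S2.eqI[where f = "\<lambda>X. hhh (?c * F X * s_ss 1 Y)"])
    show "bounded_linear (\<lambda>X. hhh (?c * F X * s_ss 1 Y))" "bounded_linear (\<lambda>X. hh (ss c (L X) * Y))"
      by (intro intros)+
    fix p q
    show "hhh (?c * F (ss p q) * s_ss 1 Y) = hh (ss c (L (ss p q)) * Y)"
    proof (rule S2.eqI[where f = "\<lambda>Y. hhh (?c * F (ss p q) * s_ss 1 Y)"])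
      show "bounded_linear (\<lambda>Y. hhh (?c * F (ss p q) * s_ss 1 Y))"
        "bounded_linear (\<lambda>Y. hh (ss c (L (ss p q)) * Y))"
        by (intro intros)+
      show "hhh (?c * F (ss p q) * s_ss 1 (ss r t)) = hh (ss c (L (ss p q)) * ss r t)" for r t
        unfolding c F assoc[symmetric] S3.mult hhh hh_sandwich2
        by (simp add: S2.mult L_ss hh_ss h_scale mult_scaleC_left)
    qed
  qed
  have GL: "hhh (?c * ss_s X 1 * G Y) = hh (ss 1 c * X * ss (R Y) 1)" for X Y
  proof (rule S2.eqI[where f = "\<lambda>X. hhh (?c * ss_s X 1 * G Y)"])
    show "bounded_linear (\<lambda>X. hhh (?c * ss_s X 1 * G Y))" "bounded_linear (\<lambda>X. hh (ss 1 c * X * ss (R Y) 1))"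
      by (intro intros)+
    fix p q
    show "hhh (?c * ss_s (ss p q) 1 * G Y) = hh (ss 1 c * ss p q * ss (R Y) 1)"
    proof (rule S2.eqI[where f = "\<lambda>Y. hhh (?c * ss_s (ss p q) 1 * G Y)"])
      show "bounded_linear (\<lambda>Y. hhh (?c * ss_s (ss p q) 1 * G Y))"
        "bounded_linear (\<lambda>Y. hh (ss 1 c * ss p q * ss (R Y) 1))"
        by (intro intros)+
      show "hhh (?c * ss_s (ss p q) 1 * G (ss r t)) = hh (ss 1 c * ss p q * ss (R (ss r t)) 1)" for r t
        unfolding G assoc S3'.mult hhh
        by (simp add: S2.mult R_ss hh_ss h_scale mult_scaleC_right sw1)
    qed
  qed
  have FL': "hhh (?c * s_ss 1 Y * F X) = hh (ss c 1 * Y * ss 1 (L X))" for X Y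
  proof (rule S2.eqI[where f = "\<lambda>X. hhh (?c * s_ss 1 Y * F X)"])
    show "bounded_linear (\<lambda>X. hhh (?c * s_ss 1 Y * F X))" "bounded_linear (\<lambda>X. hh (ss c 1 * Y * ss 1 (L X)))"
      by (intro intros)+
    fix p q
    show "hhh (?c * s_ss 1 Y * F (ss p q)) = hh (ss c 1 * Y * ss 1 (L (ss p q)))"
    proof (rule S2.eqI[where f = "\<lambda>Y. hhh (?c * s_ss 1 Y * F (ss p q))"])
      show "bounded_linear (\<lambda>Y. hhh (?c * s_ss 1 Y * F (ss p q)))"
        "bounded_linear (\<lambda>Y. hh (ss c 1 * Y * ss 1 (L (ss p q))))"
        by (intro intros)+
      show "hhh (?c * s_ss 1 (ss r t) * F (ss p q)) = hh (ss c 1 * ss r t * ss 1 (L (ss p q)))" for r t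
        unfolding c F assoc[symmetric] S3.mult hhh
        by (simp add: S2.mult L_ss hh_ss h_scale mult_scaleC_right sw2)
    qed
  qed
  have GL': "hhh (?c * G Y * ss_s X 1) = hh (ss (R Y) c * X)" for X Y
  proof (rule S2.eqI[where f = "\<lambda>X. hhh (?c * G Y * ss_s X 1)"])
    show "bounded_linear (\<lambda>X. hhh (?c * G Y * ss_s X 1))" "bounded_linear (\<lambda>X. hh (ss (R Y) c * X))"
      by (intro intros)+
    fix p q
    show "hhh (?c * G Y * ss_s (ss p q) 1) = hh (ss (R Y) c * ss p q)"
    proof (rule S2.eqI[where f = "\<lambda>Y. hhh (?c * G Y * ss_s (ss p q) 1)"])
      show "bounded_linear (\<lambda>Y. hhh (?c * G Y * ss_s (ss p q) 1))"
        "bounded_linear (\<lambda>Y. hh (ss (R Y) c * ss p q))"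
        by (intro intros)+
      show "hhh (?c * G (ss r t) * ss_s (ss p q) 1) = hh (ss (R (ss r t)) c * ss p q)" for r t
        unfolding G assoc S3'.mult hhh hh_sandwich1
        by (simp add: S2.mult R_ss hh_ss h_scale mult_scaleC_left)
    qed
  qed
  have "hh (ss c (lt u f) * \<Delta> b) = hhh (?c * F (ss u 1 * \<Delta> f) * s_ss 1 (\<Delta> b))"
    by (simp add: FL lt_def)
  \<comment> \<open>The double coproduct of \<open>f\<close> changes its bracketing;
    \<open>\<Delta> u\<close> splits off on its left, and \<open>\<Delta> b\<close> is absorbed on
    its right.\<close>
  also have "\<dots> = hhh (?c * ss_s (\<Delta> u) 1 * G (\<Delta> f * ss 1 b))"
    by (simp add: mult F G FG mult.assoc)
  also have "\<dots> = hh (ss 1 c * \<Delta> u * ss (P f b) 1)"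
    by (simp add: GL P_def)
  also have "\<dots> = h (Q c u * P f b)"
    by (rule hh_Q)
  finally show "hh (ss c (lt u f) * \<Delta> b) = h (Q c u * P f b)" .
  have "hh (ss c 1 * \<Delta> b * ss 1 (rt f v)) = hhh (?c * s_ss 1 (\<Delta> b) * F (\<Delta> f * ss v 1))"
    by (simp add: FL' rt_def)
  also have "\<dots> = hhh (?c * G (ss 1 b * \<Delta> f) * ss_s (\<Delta> v) 1)"
    by (simp add: mult F G FG mult.assoc)
  also have "\<dots> = hh (ss (Q b f) c * \<Delta> v)"
    by (simp add: GL' Q_def)
  also have "\<dots> = h (Q b f * Q c v)"
    unfolding ss_split(1)[of "Q b f" c] mult.assoc
    by (simp add: R_mult1 Q_def[of c v] flip: hh_R)
  finally show "hh (ss c 1 * \<Delta> b * ss 1 (rt f v)) = h (Q b f * Q c v)" .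
qed

text \<open>This and the next two lemmas are the working forms of strong invariance: here for
  pairings with the adjoint of \<open>P\<close>, in \<open>h_Q_lt\<close> for bounding
  \<open>Q\<close>, in \<open>h_P_rt\<close> for evaluating \<open>Q\<close> on that
  adjoint.\<close>

lemma h_P_lt: "h (u * P f (lt c b)) = h (Q c u * P f b)"
proof -
  have "h (u * P f (lt c b)) = hh (ss 1 (lt u f) * (ss c 1 * \<Delta> b))"
    by (simp add: lt_def L_mult1 flip: h_lt hh_L)
  also have "\<dots> = hh (ss c (lt u f) * \<Delta> b)"
    by (simp add: S2.mult flip: mult.assoc)
  finally show ?thesis by (simp add: hh_lt_\<Delta>)
qed

lemma h_Q_lt: "h (Q (lt c b) f * v) = h (Q b f * Q c v)"
proof -
  have "h (Q (lt c b) f * v) = hh (ss c 1 * \<Delta> b * ss 1 (rt f v))"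
    by (simp add: lt_def L_mult2 flip: h_rt hh_L)
  then show ?thesis by (simp add: hh_\<Delta>_rt)
qed

lemma h_P_rt: "h (v * P f (rt b c)) = h (P v c * P f b)"
proof -
  have "cnj (h (v * P f (rt b c))) = h (Q (lt (star c) (star b)) (star f) * star v)"
    by (simp add: star_mult star_P star_rt flip: h_star)
  also have "\<dots> = cnj (h (P v c * P f b))"
    by (simp add: h_Q_lt star_mult star_Q star_P flip: h_star)
  finally show ?thesis by simp
qed

text \<open>The right side is \<open>rt u (P f b)\<close>. This moves values of \<open>Q\<close> to
  where centrality is known, in the final transfer to the other leg.\<close>

lemma Q_lt: "Q (lt u f) b = L (\<Delta> u * ss (P f b) 1)"
proof (rule eq_of_h)
  fix c
  have "h (c * Q (lt u f) b) = hh (ss c (lt u f) * \<Delta> b)"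
    by (simp add: Q_def ss_split(1)[of c "lt u f"] mult.assoc R_mult1 flip: hh_R)
  also have "\<dots> = hh (ss 1 c * \<Delta> u * ss (P f b) 1)"
    by (simp add: hh_lt_\<Delta> hh_Q)
  also have "\<dots> = h (c * L (\<Delta> u * ss (P f b) 1))"
    by (simp add: mult.assoc L_mult1 flip: hh_L)
  finally show "h (c * Q (lt u f) b) = h (c * L (\<Delta> u * ss (P f b) 1))" .
qed

end

section \<open>Commutative right coideals\<close>

lemma tendsto_sum_list:
  fixes f :: "'a \<Rightarrow> nat \<Rightarrow> 'b :: real_normed_vector"
  assumes "\<And>x. x \<in> set xs \<Longrightarrow> (\<lambda>n. f x n) \<longlonglongrightarrow> l x"
  shows "(\<lambda>n. \<Sum>x\<leftarrow>xs. f x n) \<longlonglongrightarrow> (\<Sum>x\<leftarrow>xs. l x)"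
  using assms by (induction xs) (auto intro!: tendsto_add)

lemma tform_concat1: "tform A B (concat (map g xs)) ws = (\<Sum>x\<leftarrow>xs. tform A B (g x) ws)"
  by (induction xs) (simp_all add: tform_append1)

lemma tform_concat2: "tform A B ws (concat (map g xs)) = (\<Sum>x\<leftarrow>xs. tform A B ws (g x))"
  by (induction xs) (simp_all add: tform_append2)

lemma tform_map: "tform A B (map f vs) (map g ws) = (\<Sum>v\<leftarrow>vs. \<Sum>w\<leftarrow>ws. A (fst (f v)) (fst (g w)) * B (snd (f v)) (snd (g w)))"
  by (simp add: tform_def comp_def)

text \<open>In the applications the limits can be computed only on the range of \<open>V\<close>;
  the uniform bound carries them over to vectors such as \<open>cs k 1\<close>.\<close>

lemma tendsto_of_dense:
  fixes \<Phi> :: "nat \<Rightarrow> 'a :: real_normed_vector \<Rightarrow> 'b :: real_normed_vector"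
  assumes lin: "\<And>n. linear (\<Phi> n)" and bd: "\<And>n z. norm (\<Phi> n z) \<le> B * norm z"
    and \<Psi>: "bounded_linear \<Psi>" and dense: "closure (range V) = UNIV"
    and lim: "\<And>\<eta>. (\<lambda>n. \<Phi> n (V \<eta>)) \<longlonglongrightarrow> \<Psi> (V \<eta>)"
  shows "(\<lambda>n. \<Phi> n z) \<longlonglongrightarrow> \<Psi> z"
proof (rule LIMSEQ_I)
  fix r :: real assume r: "0 < r"
  obtain K where K: "K > 0" "\<And>x. norm (\<Psi> x) \<le> norm x * K"
    using bounded_linear.pos_bounded[OF \<Psi>] by blast
  \<comment> \<open>The approximation error enters once through \<open>\<Phi> n\<close> and once
    through \<open>\<Psi>\<close>, with total factor \<open>\<bar>B\<bar> + K\<close>.\<close>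
  define \<delta> where "\<delta> = r / 2 / (\<bar>B\<bar> + K)"
  have pos: "0 < \<bar>B\<bar> + K" using K(1) by linarith
  then have "0 < \<delta>" using r by (simp add: \<delta>_def)
  moreover have "z \<in> closure (range V)" using dense by simp
  ultimately obtain \<eta> where \<eta>: "norm (V \<eta> - z) < \<delta>"
    unfolding closure_approachable dist_norm by blast
  obtain n0 where n0: "\<And>n. n \<ge> n0 \<Longrightarrow> norm (\<Phi> n (V \<eta>) - \<Psi> (V \<eta>)) < r / 2"
    using LIMSEQ_D[OF lim[of \<eta>], of "r / 2"] r by auto
  show "\<exists>no. \<forall>n\<ge>no. norm (\<Phi> n z - \<Psi> z) < r"
  proof (intro exI allI impI)
    fix n assume n: "n0 \<le> n"
    have "\<Phi> n z - \<Psi> z = (\<Phi> n (V \<eta>) - \<Psi> (V \<eta>)) - (\<Phi> n (V \<eta> - z) - \<Psi> (V \<eta> - z))"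
      by (simp add: linear_diff[OF lin] linear_diff[OF bounded_linear.linear[OF \<Psi>]])
    then have "norm (\<Phi> n z - \<Psi> z) \<le> norm (\<Phi> n (V \<eta>) - \<Psi> (V \<eta>)) +
        (norm (\<Phi> n (V \<eta> - z)) + norm (\<Psi> (V \<eta> - z)))"
      by (metis norm_triangle_ineq4 order_trans add_left_mono)
    also have "norm (\<Phi> n (V \<eta> - z)) \<le> \<bar>B\<bar> * norm (V \<eta> - z)"
      by (rule order_trans[OF bd]) (simp add: mult_right_mono)
    also have "norm (\<Psi> (V \<eta> - z)) \<le> K * norm (V \<eta> - z)"
      using K(2)[of "V \<eta> - z"] by (simp add: mult.commute)
    finally have "norm (\<Phi> n z - \<Psi> z) \<le> norm (\<Phi> n (V \<eta>) - \<Psi> (V \<eta>)) + (\<bar>B\<bar> + K) * norm (V \<eta> - z)"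
      by (simp add: distrib_right)
    moreover have "(\<bar>B\<bar> + K) * norm (V \<eta> - z) \<le> (\<bar>B\<bar> + K) * \<delta>"
      using \<eta> pos by (intro mult_left_mono) auto
    moreover have "(\<bar>B\<bar> + K) * \<delta> = r / 2"
    proof -
      have "c * (r / 2 / c) = r / 2" if "0 < c" for c
        using that by simp
      from this[OF pos] show ?thesis by (simp only: \<delta>_def)
    qed
    ultimately show "norm (\<Phi> n z - \<Psi> z) < r"
      using n0[OF n] by linarith
  qed
qed

text \<open>In the application \<open>\<gamma> = (ev\<^sub>x \<otimes> id)\<beta>\<close> and
  \<open>H = id \<otimes> h\<close>. The coideal property is stated after integrating the last leg,
  so that it compares elements of \<open>'s\<close> and needs no tensor product of
  \<open>K\<close>.\<close>

locale commutative_coaction = cqg_haar ss ss_s s_ss \<Delta> h L R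
  for ss :: "'s :: unital_cstar_algebra \<Rightarrow> 's \<Rightarrow> 'ss :: unital_cstar_algebra"
    and ss_s :: "'ss \<Rightarrow> 's \<Rightarrow> 'sss :: unital_cstar_algebra"
    and s_ss :: "'s \<Rightarrow> 'ss \<Rightarrow> 'sss"
    and \<Delta> :: "'s \<Rightarrow> 'ss" and h :: "'s \<Rightarrow> complex" and L R :: "'ss \<Rightarrow> 's" +
  fixes cs :: "'c :: unital_cstar_algebra \<Rightarrow> 's \<Rightarrow> 'cs :: unital_cstar_algebra"
    and \<beta> :: "'c \<Rightarrow> 'cs" and \<gamma> :: "'c \<Rightarrow> 's" and H :: "'cs \<Rightarrow> 'c"
  assumes cs: "min_tensor cs"
    and commute: "(f :: 'c) * g = g * f"
    and \<beta>_hom: "unital_star_hom \<beta>"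
    and density: "closure (complex_vector.span {\<beta> a * cs 1 s |a s. True}) = UNIV"
    and \<gamma>_hom: "unital_star_hom \<gamma>" and \<gamma>_bounded: "bounded_linear \<gamma>"
    and H: "right_slice cs h H"
    and coideal: "\<gamma> (H (cs 1 a * \<beta> f * cs 1 b)) = R (ss 1 a * \<Delta> (\<gamma> f) * ss 1 b)"
begin

sublocale CS: tensor cs by unfold_locales (rule cs)

lemma \<beta>_clinear: "clinear \<beta>" and \<beta>_one: "\<beta> 1 = 1"
  and \<beta>_mult: "\<beta> (a * b) = \<beta> a * \<beta> b" and \<beta>_star: "\<beta> (star a) = star (\<beta> a)"
  using \<beta>_hom by (auto simp: unital_star_hom_def)

lemma \<gamma>_clinear: "clinear \<gamma>" and \<gamma>_one: "\<gamma> 1 = 1"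
  and \<gamma>_mult: "\<gamma> (a * b) = \<gamma> a * \<gamma> b" and \<gamma>_star: "\<gamma> (star a) = star (\<gamma> a)"
  using \<gamma>_hom by (auto simp: unital_star_hom_def)

lemma \<gamma>_scale: "\<gamma> (c *\<^sub>C a) = c *\<^sub>C \<gamma> a"
  by (rule clinear_scaleC[OF \<gamma>_clinear])

lemma H_bounded: "bounded_linear H" and H_clinear: "clinear H" and H_cs: "H (cs f s) = h s *\<^sub>C f"
  using H by (auto simp: right_slice_def bounded_clinear_def)

lemmas bl_intros = bounded_linear_intros bounded_linear_compose[OF H_bounded]
  bounded_linear_compose[OF \<gamma>_bounded]

lemma H_mult: "H (cs a 1 * z * cs b 1) = a * H z * b"
proof (rule CS.eqI)
  show "bounded_linear (\<lambda>z. H (cs a 1 * z * cs b 1))" "bounded_linear (\<lambda>z. a * H z * b)"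
    by (intro bl_intros)+
qed (simp add: CS.mult H_cs mult_scaleC_left mult_scaleC_right)

lemma H_mult_right: "H (z * cs b 1) = H z * b"
  using H_mult[of 1 z b] by simp

definition K :: "'s set" where "K = range \<gamma>"

lemma K_commute: "a \<in> K \<Longrightarrow> b \<in> K \<Longrightarrow> a * b = b * a"
  unfolding K_def by (metis imageE \<gamma>_mult commute)

lemma K_star: "a \<in> K \<Longrightarrow> star a \<in> K"
  unfolding K_def by (metis imageE \<gamma>_star rangeI)

lemma \<gamma>_H_P: "\<gamma> (H (\<beta> f * cs 1 b)) = P (\<gamma> f) b"
  using coideal[of 1 f b] by (simp add: P_def)

lemma \<gamma>_H_Q: "\<gamma> (H (cs 1 b * \<beta> f)) = Q b (\<gamma> f)"
  using coideal[of b f 1] by (simp add: Q_def)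

lemma P_in_K: "f \<in> K \<Longrightarrow> P f b \<in> K" and Q_in_K: "f \<in> K \<Longrightarrow> Q b f \<in> K"
  unfolding K_def by (metis imageE \<gamma>_H_P rangeI, metis imageE \<gamma>_H_Q rangeI)

lemma \<gamma>_in_K [simp]: "\<gamma> f \<in> K" by (simp add: K_def)

text \<open>The state \<open>(h \<circ> \<gamma>) \<otimes> h\<close>; its GNS space plays the role
  of \<open>L\<^sup>2(K) \<otimes> L\<^sup>2(S)\<close>.\<close>

definition tt :: "'cs \<Rightarrow> complex" where "tt z = h (\<gamma> (H z))"

lemma tt_bounded: "bounded_linear tt"
  unfolding tt_def[abs_def] by (intro bl_intros)

lemma tt_cs: "tt (cs f s) = h (\<gamma> f) * h s"
  by (simp add: tt_def H_cs \<gamma>_scale h_scale)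

lemma \<gamma>_state: "is_state (\<lambda>f. h (\<gamma> f))"
  unfolding is_state_iff
proof
  show "pos_fun (\<lambda>f. h (\<gamma> f))"
    by (rule pos_fun_comp[OF h_pos_fun \<gamma>_clinear]) (metis \<gamma>_mult \<gamma>_star)
qed (simp add: \<gamma>_one)

lemma tt_state: "is_state tt"
proof -
  obtain \<Omega> where \<Omega>: "is_state \<Omega>" "\<And>a b. \<Omega> (cs a b) = h (\<gamma> a) * h b"
    using CS.product_state[OF \<gamma>_state state] by metis
  have "\<Omega> z = tt z" for z
    by (rule CS.eqI[OF pos_fun_bounded_linear[OF state_pos_fun[OF \<Omega>(1)]] tt_bounded])
       (simp add: \<Omega>(2) tt_cs)
  then have "\<Omega> = tt" by blast
  with \<Omega>(1) show ?thesis by simp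
qed

lemma tt_pos_fun: "pos_fun tt" by (rule state_pos_fun[OF tt_state])

lemma tt_one: "Re (tt 1) = 1" using tt_state by (simp add: is_state_def)

lemma tt_\<beta>: "tt (cs 1 a * \<beta> f * cs 1 b) = h (\<gamma> f) * h (a * b)"
  unfolding tt_def coideal by (simp add: hh_R hh_sandwich2)

section \<open>The isometry behind P, and contractivity of Q\<close>

definition V :: "('c \<times> 's) list \<Rightarrow> 'cs" where "V = tsum (\<lambda>f b. \<beta> f * cs 1 b)"

lemma V_dense: "closure (range V) = UNIV"
proof -
  have "\<exists>a'. c *\<^sub>C (\<beta> a * cs 1 b) = \<beta> a' * cs 1 b" for c a b
    by (rule exI[of _ "c *\<^sub>C a"]) (simp add: clinear_scaleC[OF \<beta>_clinear] mult_scaleC_left)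
  from span_tsum[of "\<lambda>f b. \<beta> f * cs 1 b", OF this] show ?thesis
    using density by (simp add: V_def)
qed

lemma V_seq: obtains \<eta> where "(\<lambda>n :: nat. V (\<eta> n)) \<longlonglongrightarrow> z"
  using closure_range_seq[OF V_dense] .

definition gm :: "('c \<times> 's) list \<Rightarrow> ('s \<times> 's) list" where "gm = map (\<lambda>(f, b). (\<gamma> f, b))"

abbreviation PP :: "('s \<times> 's) list \<Rightarrow> 's" where "PP \<equiv> tsum P"
abbreviation QQ :: "('s \<times> 's) list \<Rightarrow> 's" where "QQ \<equiv> tsum (\<lambda>f b. Q b f)"

abbreviation ip :: "('s \<times> 's) list \<Rightarrow> ('s \<times> 's) list \<Rightarrow> complex"
  where "ip \<equiv> tform (\<lambda>a c. h (star c * a)) (\<lambda>a c. h (star c * a))"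

lemma gm_Nil [simp]: "gm [] = []" and gm_Cons [simp]: "gm (u # us) = (\<gamma> (fst u), snd u) # gm us"
  and gm_append [simp]: "gm (us @ vs) = gm us @ gm vs"
  by (simp_all add: gm_def case_prod_unfold)

lemma V_simps [simp]: "V [] = 0" "V (u # us) = \<beta> (fst u) * cs 1 (snd u) + V us"
  "V (us @ vs) = V us + V vs"
  by (simp_all add: V_def)

lemma \<gamma>_H_V: "\<gamma> (H (V \<eta>)) = PP (gm \<eta>)"
proof (induction \<eta>)
  case Nil
  then show ?case by (simp add: clinear_zero[OF H_clinear] clinear_zero[OF \<gamma>_clinear])
next
  case (Cons u \<eta>)
  then show ?case
    by (simp add: clinear_add[OF H_clinear] clinear_add[OF \<gamma>_clinear] \<gamma>_H_P)
qed

text \<open>Invariance, in the form \<open>tt_\<beta>\<close>, makes \<open>V\<close> preserve inner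
  products. With \<open>V_dense\<close> it acts as a unitary, and \<open>\<gamma>_H_V\<close> writes
  \<open>P\<close> as this unitary followed by a slice.\<close>

lemma tt_V: "tt (star (V \<eta>) * V \<zeta>) = ip (gm \<zeta>) (gm \<eta>)"
proof -
  have el: "tt (star (\<beta> g * cs 1 d) * (\<beta> f * cs 1 b)) = ip [(\<gamma> f, b)] [(\<gamma> g, d)]" for f b g d
  proof -
    have "star (\<beta> g * cs 1 d) * (\<beta> f * cs 1 b) = cs 1 (star d) * \<beta> (star g * f) * cs 1 b"
      by (simp add: star_mult CS.star_t \<beta>_mult \<beta>_star mult.assoc)
    then show ?thesis by (simp add: tt_\<beta> tform_sing \<gamma>_mult \<gamma>_star)
  qed
  note add = linear_add[OF bounded_linear.linear[OF tt_bounded]]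
    and zero = linear_0[OF bounded_linear.linear[OF tt_bounded]]
  have 1: "tt (star (V \<eta>) * (\<beta> f * cs 1 b)) = ip [(\<gamma> f, b)] (gm \<eta>)" for f b
  proof (induction \<eta>)
    case (Cons u \<eta>)
    then show ?case
      unfolding V_simps gm_Cons tform_Cons2[of _ _ _ _ "gm \<eta>"] star_add distrib_right add el by simp
  qed (simp add: zero)
  show ?thesis
  proof (induction \<zeta>)
    case (Cons u \<zeta>)
    then show ?case
      unfolding V_simps gm_Cons tform_Cons1[of _ _ _ "gm \<zeta>"] distrib_left add 1 by simp
  qed (simp add: zero)
qed

lemma QQ_in_K: "QQ (gm \<eta>) \<in> K"
proof -
  have add: "a + b \<in> K" if "a \<in> K" "b \<in> K" for a b
  proof -
    from that obtain f g where "a = \<gamma> f" "b = \<gamma> g" unfolding K_def by blast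
    then have "a + b = \<gamma> (f + g)" by (simp add: clinear_add[OF \<gamma>_clinear])
    then show ?thesis by simp
  qed
  have "0 \<in> K" using \<gamma>_in_K[of 0] unfolding clinear_zero[OF \<gamma>_clinear] .
  then show ?thesis
    by (induction \<eta>) (simp_all add: add Q_in_K)
qed

lemma ip_nonneg: "0 \<le> Re (ip \<zeta> \<zeta>)" by (rule tform_Schur[OF h_form h_form])

lemma h_PP_QQ:
  "h (star (PP ws) * QQ vs) = (\<Sum>v\<leftarrow>vs. \<Sum>w\<leftarrow>ws. h (star (P (fst w) (snd w)) * Q (snd v) (fst v)))"
proof -
  have 1: "h (star (PP ws) * q) = (\<Sum>w\<leftarrow>ws. h (star (P (fst w) (snd w)) * q))" for q
    by (induction ws) (simp_all add: h_zero h_add star_add distrib_right)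
  show ?thesis
    by (induction vs) (simp_all add: h_zero h_add distrib_left 1)
qed

text \<open>
  By commutativity of \<open>K\<close>, the inner product below is that of \<open>f\<^sub>1 \<otimes> \<Delta>(b)(1 \<otimes> f\<^sub>2)\<close> with \<open>u \<otimes> (c \<otimes> 1)\<close>,
  where \<open>(f, b)\<close> and \<open>(u, c)\<close> run through the two lists, and both vectors have the right norm by
  invariance. Together with density this makes \<open>QQ\<close> a contraction for the Haar norms.
\<close>

lemma PP_QQ_bound:
  "(cmod (h (star (PP (gm \<eta>)) * QQ (gm \<zeta>))))\<^sup>2 \<le> Re (ip (gm \<eta>) (gm \<eta>)) * Re (ip (gm \<zeta>) (gm \<zeta>))"
proof -
  \<comment> \<open>\<open>\<Delta> f\<close> is only a limit of algebraic tensors, so the vectors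
    \<open>f\<^sub>1 \<otimes> \<Delta>(b)(1 \<otimes> f\<^sub>2)\<close> are approximated by lists,
    and limits are taken of scalar products alone.\<close>
  have "\<forall>f. \<exists>X. (\<lambda>n :: nat. tsum ss (X n)) \<longlonglongrightarrow> \<Delta> f"
  proof
    fix f
    obtain us where "(\<lambda>n :: nat. tsum ss (us n)) \<longlonglongrightarrow> \<Delta> f" using S2.seq .
    then show "\<exists>X. (\<lambda>n :: nat. tsum ss (X n)) \<longlonglongrightarrow> \<Delta> f" by blast
  qed
  then have "\<exists>X. \<forall>f. (\<lambda>n. tsum ss (X f n)) \<longlonglongrightarrow> \<Delta> f" by (rule choice)
  then obtain X where X: "\<And>f. (\<lambda>n. tsum ss (X f n)) \<longlonglongrightarrow> \<Delta> f" by blast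
  let ?A = "\<lambda>a c. h (star c * a)" and ?B = "\<lambda>a c. hh (star c * a)"
  define x where "x n v = map (\<lambda>(p, q). (p, \<Delta> (snd v) * ss 1 q)) (X (fst v) n)" for n and v :: "'s \<times> 's"
  define XX where "XX n = concat (map (x n) (gm \<zeta>))" for n
  define YY where "YY = map (\<lambda>(u, c). (u, ss c 1)) (gm \<eta>)"
  have ev: "bounded_linear (\<lambda>z. hh (a * z))" for a by (intro bounded_linear_intros)
  have lim1: "(\<lambda>n. tform ?A ?B (x n v) [(u, ss c 1)]) \<longlonglongrightarrow> h (star (P u c) * Q (snd v) (fst v))"
    if v: "fst v \<in> K" and u: "u \<in> K" for v u c
  proof -
    let ?d = "lt (star c) (snd v)"
    have "tform ?A ?B (x n v) [(u, ss c 1)] = hh (ss (star u) ?d * tsum ss (X (fst v) n))" for n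
    proof -
      have "hh (ss (star u) ?d * tsum ss (X (fst v) n)) =
          (\<Sum>w\<leftarrow>X (fst v) n. h (star u * fst w) * h (?d * snd w))"
        unfolding tsum_def linear_sum_list[OF bounded_linear.linear[OF ev]] by (simp add: S2.mult hh_ss)
      moreover have "h (?d * q) = hh (star (ss c 1) * (\<Delta> (snd v) * ss 1 q))" for q
        by (simp add: lt_def S2.star_t hh_L mult.assoc flip: L_mult2)
      ultimately show ?thesis
        by (simp add: tform_def x_def comp_def case_prod_unfold)
    qed
    moreover have "(\<lambda>n. hh (ss (star u) ?d * tsum ss (X (fst v) n))) \<longlonglongrightarrow> hh (ss (star u) ?d * \<Delta> (fst v))"
      by (rule bounded_linear.tendsto[OF ev X])
    moreover have "hh (ss (star u) ?d * \<Delta> (fst v)) = h (star (P u c) * Q (snd v) (fst v))"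
    proof -
      have "hh (ss (star u) ?d * \<Delta> (fst v)) = h (star u * Q ?d (fst v))"
        unfolding ss_split(1)[of "star u" ?d] mult.assoc by (simp add: R_mult1 Q_def flip: hh_R)
      \<comment> \<open>Commutativity of \<open>K\<close>, here and once more below, brings the
        factors into the order of \<open>h_Q_lt\<close> and then into that of the target.\<close>
      also have "\<dots> = h (Q ?d (fst v) * star u)"
        by (simp only: K_commute[OF K_star[OF u] Q_in_K[OF v]])
      also have "\<dots> = h (Q (snd v) (fst v) * Q (star c) (star u))"
        by (rule h_Q_lt)
      also have "\<dots> = h (star (P u c) * Q (snd v) (fst v))"
        by (simp only: star_P K_commute[OF Q_in_K[OF v] Q_in_K[OF K_star[OF u]]])
      finally show ?thesis .
    qed
    ultimately show ?thesis by simp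
  qed
  have K: "fst v \<in> K" if "v \<in> set (gm \<theta>)" for v \<theta>
    using that by (auto simp: gm_def)
  have YY: "YY = concat (map (\<lambda>v. [(fst v, ss (snd v) 1)]) (gm \<eta>))"
    by (simp add: YY_def case_prod_unfold)
  have "(\<lambda>n. tform ?A ?B (XX n) YY) \<longlonglongrightarrow>
      (\<Sum>v\<leftarrow>gm \<zeta>. \<Sum>w\<leftarrow>gm \<eta>. h (star (P (fst w) (snd w)) * Q (snd v) (fst v)))"
    unfolding XX_def tform_concat1 unfolding YY tform_concat2
    by (intro tendsto_sum_list lim1; erule K)
  also have "(\<Sum>v\<leftarrow>gm \<zeta>. \<Sum>w\<leftarrow>gm \<eta>. h (star (P (fst w) (snd w)) * Q (snd v) (fst v))) =
      h (star (PP (gm \<eta>)) * QQ (gm \<zeta>))"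
    by (rule h_PP_QQ[symmetric])
  finally have lim: "(\<lambda>n. tform ?A ?B (XX n) YY) \<longlonglongrightarrow> h (star (PP (gm \<eta>)) * QQ (gm \<zeta>))" .
  \<comment> \<open>Invariance is used twice for the lengths: first for \<open>\<Delta> b\<close>
    inside \<open>hh\<close>, then in the limit for \<open>\<Delta> f\<close>.\<close>
  have lim2: "(\<lambda>n. tform ?A ?B (x n v) (x n w)) \<longlonglongrightarrow> h (star (fst w) * fst v) * h (star (snd w) * snd v)"
    for v w
  proof -
    have B: "?B (\<Delta> b * ss 1 q) (\<Delta> d * ss 1 s) = h (star d * b) * h (star s * q)" for b q d s
    proof -
      have "star (\<Delta> d * ss 1 s) * (\<Delta> b * ss 1 q) = ss 1 (star s) * \<Delta> (star d * b) * ss 1 q"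
        by (simp add: star_mult S2.star_t \<Delta>_mult \<Delta>_star mult.assoc)
      then show ?thesis by (simp add: hh_sandwich2)
    qed
    have "tform ?A ?B (x n v) (x n w) =
        h (star (snd w) * snd v) * tform ?A ?A (X (fst v) n) (X (fst w) n)" for n
      unfolding x_def tform_map by (simp add: case_prod_unfold B tform_def mult_ac flip: sum_list_const_mult)
    also have "\<dots> n = h (star (snd w) * snd v) * hh (star (tsum ss (X (fst w) n)) * tsum ss (X (fst v) n))" for n
      by (simp add: S2.gns_tsum[OF bounded_linear.linear[OF hh_bounded] hh_ss] gns_inner_tform)
    finally have eq: "tform ?A ?B (x n v) (x n w) =
        h (star (snd w) * snd v) * hh (star (tsum ss (X (fst w) n)) * tsum ss (X (fst v) n))" for n .
    have "(\<lambda>n. h (star (snd w) * snd v) * hh (star (tsum ss (X (fst w) n)) * tsum ss (X (fst v) n))) \<longlonglongrightarrow>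
        h (star (snd w) * snd v) * hh (star (\<Delta> (fst w)) * \<Delta> (fst v))"
      by (intro tendsto_mult tendsto_const bounded_linear.tendsto[OF hh_bounded]
          bounded_linear.tendsto[OF bounded_linear_star] X)
    moreover have "hh (star (\<Delta> (fst w)) * \<Delta> (fst v)) = h (star (fst w) * fst v)"
      using hh_sandwich2[of 1 "star (fst w) * fst v" 1] by (simp add: \<Delta>_mult \<Delta>_star)
    ultimately show ?thesis by (simp add: eq mult.commute)
  qed
  have "(\<lambda>n. tform ?A ?B (XX n) (XX n)) \<longlonglongrightarrow> (\<Sum>v\<leftarrow>gm \<zeta>. \<Sum>w\<leftarrow>gm \<zeta>. h (star (fst w) * fst v) * h (star (snd w) * snd v))"
    unfolding XX_def tform_concat1 unfolding tform_concat2 by (intro tendsto_sum_list lim2)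
  then have limX: "(\<lambda>n. tform ?A ?B (XX n) (XX n)) \<longlonglongrightarrow> ip (gm \<zeta>) (gm \<zeta>)"
    by (simp add: tform_def)
  have Y: "tform ?A ?B YY YY = ip (gm \<eta>) (gm \<eta>)"
    unfolding YY_def tform_map by (simp add: case_prod_unfold S2.star_t S2.mult hh_ss tform_def)
  have "(cmod (tform ?A ?B (XX n) YY))\<^sup>2 \<le> Re (tform ?A ?B (XX n) (XX n)) * Re (ip (gm \<eta>) (gm \<eta>))" for n
    using tform_Cauchy_Schwarz[OF h_form hh_form, of "XX n" YY] by (simp add: Y)
  moreover have "(\<lambda>n. (cmod (tform ?A ?B (XX n) YY))\<^sup>2) \<longlonglongrightarrow> (cmod (h (star (PP (gm \<eta>)) * QQ (gm \<zeta>))))\<^sup>2"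
    by (intro tendsto_power tendsto_norm lim)
  moreover have "(\<lambda>n. Re (tform ?A ?B (XX n) (XX n)) * Re (ip (gm \<eta>) (gm \<eta>))) \<longlonglongrightarrow>
      Re (ip (gm \<zeta>) (gm \<zeta>)) * Re (ip (gm \<eta>) (gm \<eta>))"
    by (intro tendsto_mult tendsto_Re limX tendsto_const)
  ultimately have "(cmod (h (star (PP (gm \<eta>)) * QQ (gm \<zeta>))))\<^sup>2 \<le> Re (ip (gm \<zeta>) (gm \<zeta>)) * Re (ip (gm \<eta>) (gm \<eta>))"
    by (meson LIMSEQ_le)
  then show ?thesis by (simp add: mult.commute)
qed

lemma tendsto_PP:
  assumes "(\<lambda>n. V (\<eta> n)) \<longlonglongrightarrow> cs k 1"
  shows "(\<lambda>n. PP (gm (\<eta> n))) \<longlonglongrightarrow> \<gamma> k"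
proof -
  have "(\<lambda>n. \<gamma> (H (V (\<eta> n)))) \<longlonglongrightarrow> \<gamma> (H (cs k 1))"
    by (intro bounded_linear.tendsto[OF \<gamma>_bounded] bounded_linear.tendsto[OF H_bounded] assms)
  then show ?thesis by (simp add: \<gamma>_H_V H_cs)
qed

text \<open>Choose lists with \<open>V \<eta>\<close> tending to \<open>k \<otimes> 1\<close>: their
  \<open>P\<close> images tend to \<open>\<gamma> k\<close> and their lengths to that of
  \<open>\<gamma> k\<close>, so \<open>PP_QQ_bound\<close> becomes contractivity of
  \<open>QQ\<close> tested on \<open>K\<close>.\<close>

lemma QQ_bound:
  "(cmod (h (star (\<gamma> k) * QQ (gm \<zeta>))))\<^sup>2 \<le> Re (h (star (\<gamma> k) * \<gamma> k)) * Re (ip (gm \<zeta>) (gm \<zeta>))"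
proof -
  obtain \<eta> where \<eta>: "(\<lambda>n :: nat. V (\<eta> n)) \<longlonglongrightarrow> cs k 1" using V_seq .
  have "(\<lambda>n. (cmod (h (star (PP (gm (\<eta> n))) * QQ (gm \<zeta>))))\<^sup>2) \<longlonglongrightarrow> (cmod (h (star (\<gamma> k) * QQ (gm \<zeta>))))\<^sup>2"
    by (intro tendsto_power tendsto_norm bounded_linear.tendsto[OF h_bounded] tendsto_mult
        bounded_linear.tendsto[OF bounded_linear_star] tendsto_const tendsto_PP \<eta>)
  moreover have "(\<lambda>n. Re (tt (star (V (\<eta> n)) * V (\<eta> n))) * Re (ip (gm \<zeta>) (gm \<zeta>))) \<longlonglongrightarrow>
      Re (tt (star (cs k 1) * cs k 1)) * Re (ip (gm \<zeta>) (gm \<zeta>))"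
    by (intro tendsto_mult tendsto_Re bounded_linear.tendsto[OF tt_bounded]
        bounded_linear.tendsto[OF bounded_linear_star] tendsto_const \<eta>)
  moreover have "tt (star (cs k 1) * cs k 1) = h (star (\<gamma> k) * \<gamma> k)"
    by (simp add: CS.star_t CS.mult tt_cs \<gamma>_mult \<gamma>_star)
  ultimately show ?thesis
    using PP_QQ_bound[of "\<eta> _" \<zeta>] by (simp add: tt_V) (meson LIMSEQ_le)
qed

end

section \<open>Estimates for approximations to the adjoint of P\<close>

lemma norm_diff_less_thirds:
  fixes a :: "'a :: real_normed_vector"
  assumes "norm (a - b) \<le> r / 3" "norm (b - c) < r / 3" "norm (c - d) < r / 3"
  shows "norm (a - d) < r"
  using assms dist_triangle[of a d b] dist_triangle[of b d c] unfolding dist_norm by linarith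

context cqg_haar
begin

text \<open>Pairing \<open>z\<close> with \<open>ss (R z) 1\<close> gives exactly the left side, so
  Cauchy-Schwarz yields the claim after cancelling one factor.\<close>

lemma R_Kadison_Schwarz: "Re (h (star (R z) * R z)) \<le> Re (hh (star z * z))"
proof -
  define r where "r = Re (h (star (R z) * R z))"
  have r0: "0 \<le> r" unfolding r_def by (rule pos_fun_Re[OF h_pos_fun])
  have eq: "hh (star (ss (R z) 1) * z) = h (star (R z) * R z)"
    by (simp add: S2.star_t R_mult1 flip: hh_R)
  have "r \<le> cmod (hh (star (ss (R z) 1) * z))"
    unfolding eq r_def by (rule complex_Re_le_cmod)
  then have "r\<^sup>2 \<le> (cmod (hh (star (ss (R z) 1) * z)))\<^sup>2"
    using r0 by (rule power_mono)
  also have "\<dots> \<le> Re (hh (star z * z)) * Re (hh (star (ss (R z) 1) * ss (R z) 1))"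
    by (rule pos_fun_Cauchy_Schwarz[OF hh_pos_fun])
  also have "hh (star (ss (R z) 1) * ss (R z) 1) = h (star (R z) * R z)"
    by (simp add: S2.star_t S2.mult hh_ss)
  finally have "r * r \<le> Re (hh (star z * z)) * r"
    by (simp add: r_def power2_eq_square)
  then show ?thesis
    using r0 pos_fun_Re[OF hh_pos_fun, of z] unfolding r_def[symmetric]
    by (cases "r = 0") auto
qed

text \<open>Multipliers on different legs commute, so the two slices can be taken in either
  order.\<close>

lemma h_Q_left: "h (u * Q t c) = h (t * lt u c)"
proof -
  have "h (u * Q t c) = hh (ss u 1 * (ss 1 t * \<Delta> c))"
    by (simp add: Q_def R_mult1 flip: hh_R)
  also have "\<dots> = hh (ss 1 t * (ss u 1 * \<Delta> c))"
    by (simp add: S2.mult flip: mult.assoc)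
  also have "\<dots> = h (t * lt u c)"
    by (simp add: lt_def L_mult1 flip: hh_L)
  finally show ?thesis .
qed

lemma h_rt_left: "h (rt g b * c) = h (P g c * b)"
proof -
  have "h (rt g b * c) = hh (\<Delta> g * ss b 1 * ss 1 c)"
    by (simp add: rt_def L_mult2 flip: hh_L)
  also have "\<dots> = hh (\<Delta> g * ss 1 c * ss b 1)"
    by (simp add: S2.mult mult.assoc)
  also have "\<dots> = h (P g c * b)"
    by (simp add: P_def R_mult2 flip: hh_R)
  finally show ?thesis .
qed

end

context commutative_coaction
begin

lemma H_star: "H (star z) = star (H z)"
proof (rule CS.eqI)
  show "bounded_linear (\<lambda>z. H (star z))" "bounded_linear (\<lambda>z. star (H z))"
    by (rule bounded_linear_compose[OF H_bounded bounded_linear_star]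
        bounded_linear_compose[OF bounded_linear_star H_bounded])+
qed (simp add: CS.star_t H_cs star_scaleC h_star)

text \<open>Kadison-Schwarz removes \<open>R\<close> and leaves the product form of two positive
  functionals, which the norm of \<open>tsum cs X\<close> controls. Approximations therefore stay
  bounded however long their lists grow.\<close>

lemma ip_slice_le:
  assumes T: "clinear T" and \<rho>: "pos_fun \<rho>" and eq: "\<And>s s'. hh (star (T s') * T s) = \<rho> (star s' * s)"
  defines "\<zeta> \<equiv> \<lambda>X. gm (map (\<lambda>(f, s). (f, R (T s))) X)"
  shows "Re (ip (\<zeta> X) (\<zeta> X)) \<le> Re (\<rho> 1) * (norm (tsum cs X))\<^sup>2"
proof -
  have RT: "clinear (\<lambda>s. R (T s))" by (rule clinear_compose[OF R_clinear T])
  have \<gamma>p: "pos_fun (\<lambda>f. h (\<gamma> f))" by (rule state_pos_fun[OF \<gamma>_state])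
  have \<zeta>: "\<zeta> X = map (\<lambda>(f, s). (\<gamma> f, R (T s))) X"
    by (simp add: \<zeta>_def gm_def case_prod_unfold)
  have "Re (ip (\<zeta> X) (\<zeta> X)) =
      Re (tform (\<lambda>x y. h (star (\<gamma> y) * \<gamma> x)) (\<lambda>x y. h (star (R (T y)) * R (T x))) X X)"
    unfolding \<zeta> tform_map_prod ..
  also have "\<dots> \<le> Re (tform (\<lambda>x y. h (star (\<gamma> y) * \<gamma> x)) (\<lambda>x y. hh (star (T y) * T x)) X X)"
    by (rule tform_mono2[OF pos_form_comp[OF h_form \<gamma>_clinear] pos_form_comp[OF hh_form T]
          pos_form_comp[OF h_form RT]]) (rule R_Kadison_Schwarz)
  also have "\<dots> = Re (gns_inner (\<lambda>f. h (\<gamma> f)) \<rho> X X)"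
    by (simp add: gns_inner_tform eq \<gamma>_mult \<gamma>_star)
  also have "\<dots> \<le> Re (h (\<gamma> 1)) * Re (\<rho> 1) * (norm (tsum cs X))\<^sup>2"
    by (rule CS.gns_tsum_le[OF \<gamma>p \<rho>])
  finally show ?thesis by (simp add: \<gamma>_one)
qed

text \<open>
  If \<open>X\<close> represents an approximation of \<open>\<beta> g\<close>, then \<open>Z c X\<close> represents an approximation of
  \<open>g\<^sub>0 \<otimes> c\<^sub>1 h(g\<^sub>1 c\<^sub>2)\<close>, which is the image of \<open>P (\<gamma> g) c\<close> under the adjoint of \<open>PP\<close>.
\<close>

definition Z :: "'s \<Rightarrow> ('c \<times> 's) list \<Rightarrow> ('c \<times> 's) list"
  where "Z c = map (\<lambda>(f, s). (f, Q s c))"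

lemma Z_simps [simp]: "Z c [] = []" "Z c (u # us) = (fst u, Q (snd u) c) # Z c us"
  "Z c (us @ vs) = Z c us @ Z c vs"
  by (simp_all add: Z_def case_prod_unfold)

lemma ip_Z_le: "Re (ip (gm (Z c X)) (gm (Z c X))) \<le> Re (h (star c * c)) * (norm (tsum cs X))\<^sup>2"
proof -
  define \<rho> where "\<rho> x = hh (star (\<Delta> c) * ss 1 x * \<Delta> c)" for x
  have \<rho>: "pos_fun \<rho>"
    unfolding \<rho>_def[abs_def]
  proof (rule pos_fun_comp[OF pos_fun_sandwich[OF hh_pos_fun] S2.clinear2])
    show "\<exists>y. ss 1 (star x * x) = star y * y" for x
      by (rule exI[of _ "ss 1 x"]) (simp add: S2.star_t S2.mult)
  qed
  have T: "clinear (\<lambda>s. ss 1 s * \<Delta> c)"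
    by (rule clinear_compose[OF clinear_mult_right S2.clinear2])
  have "hh (star (ss 1 s' * \<Delta> c) * (ss 1 s * \<Delta> c)) = \<rho> (star s' * s)" for s s'
  proof -
    have "star (ss 1 s' * \<Delta> c) * (ss 1 s * \<Delta> c) = star (\<Delta> c) * (ss 1 (star s') * ss 1 s) * \<Delta> c"
      by (simp add: star_mult S2.star_t mult.assoc)
    then show ?thesis by (simp add: \<rho>_def S2.mult)
  qed
  from ip_slice_le[OF T \<rho> this, of X]
  have "Re (ip (gm (Z c X)) (gm (Z c X))) \<le> Re (\<rho> 1) * (norm (tsum cs X))\<^sup>2"
    by (simp add: Z_def Q_def)
  moreover have "\<rho> 1 = h (star c * c)"
    using hh_sandwich2[of 1 "star c * c" 1] by (simp add: \<rho>_def \<Delta>_mult \<Delta>_star)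
  ultimately show ?thesis by simp
qed

text \<open>Counterpart of \<open>V (Z c X)\<close> with the second leg multiplied from the left, so
  that slicing yields \<open>QQ\<close> instead of \<open>PP\<close>.\<close>

definition Y :: "'s \<Rightarrow> ('c \<times> 's) list \<Rightarrow> 'cs"
  where "Y c = tsum (\<lambda>f s. cs 1 (Q s c) * \<beta> f)"

lemma \<gamma>_H_Y: "\<gamma> (H (Y c X)) = QQ (gm (Z c X))"
  unfolding Y_def
  by (induction X) (simp_all add: clinear_add[OF H_clinear] clinear_add[OF \<gamma>_clinear] \<gamma>_H_Q
      clinear_zero[OF H_clinear] clinear_zero[OF \<gamma>_clinear])

text \<open>The adjoint of \<open>Y c X\<close> is a value of \<open>V\<close> on starred data,
  which makes \<open>tt_V\<close> and \<open>ip_slice_le\<close> applicable. The order of the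
  factors fits the later use of \<open>Y c X\<close> as a left factor inside
  \<open>tt\<close>.\<close>

lemma tt_Y_le: "Re (tt (Y c X * star (Y c X))) \<le> Re (h (c * star c)) * (norm (tsum cs X))\<^sup>2"
proof -
  define c' where "c' = star c"
  define X' where "X' = map (\<lambda>(f, s). (star f, star s)) X"
  define \<rho> where "\<rho> x = h (star c' * c') * h x" for x
  have \<rho>: "pos_fun \<rho>"
    unfolding pos_fun_def
  proof (intro conjI allI)
    show "clinear \<rho>"
      unfolding \<rho>_def[abs_def] by (rule clinear_compose[OF clinear_mult_left h_clinear])
    show "\<rho> (star x * x) \<in> \<real>\<^sub>\<ge>\<^sub>0" for x
      unfolding \<rho>_def using h_pos_fun unfolding pos_fun_def by (intro nonneg_Reals_mult_I) blast+
  qed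
  have T: "clinear (\<lambda>s. \<Delta> c' * ss 1 s)"
    by (rule clinear_compose[OF clinear_mult_left S2.clinear2])
  have "hh (star (\<Delta> c' * ss 1 s') * (\<Delta> c' * ss 1 s)) = \<rho> (star s' * s)" for s s'
  proof -
    have "star (\<Delta> c' * ss 1 s') * (\<Delta> c' * ss 1 s) = ss 1 (star s') * \<Delta> (star c' * c') * ss 1 s"
      by (simp add: star_mult S2.star_t \<Delta>_mult \<Delta>_star mult.assoc)
    then show ?thesis by (simp add: \<rho>_def hh_sandwich2)
  qed
  note le = ip_slice_le[OF T \<rho> this, of X']
  have "star (Y c X) = V (map (\<lambda>(f, s). (f, R (\<Delta> c' * ss 1 s))) X')"
    unfolding Y_def X'_def
    by (induction X) (auto simp: star_add star_mult CS.star_t star_Q P_def c'_def \<beta>_star)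
  then have "tt (Y c X * star (Y c X)) =
      ip (gm (map (\<lambda>(f, s). (f, R (\<Delta> c' * ss 1 s))) X')) (gm (map (\<lambda>(f, s). (f, R (\<Delta> c' * ss 1 s))) X'))"
    by (metis star_star tt_V)
  moreover have "norm (tsum cs X') = norm (tsum cs X)"
    unfolding X'_def CS.tsum_star[symmetric] by simp
  moreover have "\<rho> 1 = h (c * star c)"
    by (simp add: \<rho>_def c'_def)
  ultimately show ?thesis using le by simp
qed

lemma tt_square_le: "Re (tt (star z * z)) \<le> (norm z)\<^sup>2"
  using pos_fun_square_le[OF tt_pos_fun, of z] by (simp add: tt_one)

text \<open>Supplies the uniform bounds required by \<open>tendsto_of_dense\<close>.\<close>

lemma tt_bound:
  assumes "Re (tt (star y * y)) \<le> C * M\<^sup>2" "0 \<le> C" "0 \<le> M"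
  shows "norm (tt (star y * z)) \<le> sqrt C * M * norm z"
proof (rule power2_le_imp_le)
  have "(cmod (tt (star y * z)))\<^sup>2 \<le> Re (tt (star z * z)) * Re (tt (star y * y))"
    by (rule pos_fun_Cauchy_Schwarz[OF tt_pos_fun])
  also have "\<dots> \<le> (norm z)\<^sup>2 * (C * M\<^sup>2)"
    by (rule mult_mono[OF tt_square_le assms(1)]) (simp_all add: pos_fun_Re[OF tt_pos_fun])
  also have "\<dots> = (sqrt C * M * norm z)\<^sup>2"
    using assms(2) by (simp add: power_mult_distrib)
  finally show "(cmod (tt (star y * z)))\<^sup>2 \<le> (sqrt C * M * norm z)\<^sup>2" .
qed (use assms in simp)

section \<open>Limits along approximations of the coaction\<close>

context
  fixes g :: 'c and c :: 's and X :: "nat \<Rightarrow> ('c \<times> 's) list" and w :: 's and w0 :: 'c and M :: real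
  assumes X: "(\<lambda>n. tsum cs (X n)) \<longlonglongrightarrow> \<beta> g"
    and M: "\<And>n. norm (tsum cs (X n)) \<le> M"
  defines "w \<equiv> P (\<gamma> g) c" and "w0 \<equiv> H (\<beta> g * cs 1 c)"
begin

lemma w_eq: "w = \<gamma> w0"
  by (simp add: w_def w0_def \<gamma>_H_P)

lemma w_in_K: "w \<in> K"
  by (simp add: w_eq)

lemma M_nonneg: "0 \<le> M"
  using M[of 0] norm_ge_zero order_trans by blast

text \<open>Weak convergence of \<open>Z c (X n)\<close> to the adjoint of \<open>P\<close> at
  \<open>w\<close>: each pairing is a bounded functional of \<open>tsum cs (X n)\<close>, and
  \<open>h_P_lt\<close> evaluates the limit.\<close>

lemma tendsto_ip_Z: "(\<lambda>n. ip (gm (Z c (X n))) (gm \<eta>)) \<longlonglongrightarrow> h (star (PP (gm \<eta>)) * w)"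
proof (induction \<eta>)
  case Nil
  then show ?case by (simp add: h_zero)
next
  case (Cons u \<eta>)
  obtain v s where u: "u = (v, s)" by force
  \<comment> \<open>By \<open>h_Q_left\<close> this turns \<open>h (star s * Q t c)\<close> into
    \<open>h (t * e)\<close>, which is a slice in the leg \<open>t\<close>.\<close>
  define e where "e = lt (star s) c"
  have bl: "bounded_linear (\<lambda>x. h (star (\<gamma> v) * \<gamma> (H (x * cs 1 e))))"
    by (intro bl_intros)
  have el: "h (star (\<gamma> v) * \<gamma> (H (cs f t * cs 1 e))) = h (star (\<gamma> v) * \<gamma> f) * h (star s * Q t c)" for f t
    by (simp add: CS.mult H_cs \<gamma>_scale mult_scaleC_right h_scale h_Q_left e_def)
  have "ip (gm (Z c us)) [(\<gamma> v, s)] = h (star (\<gamma> v) * \<gamma> (H (tsum cs us * cs 1 e)))" for us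
    unfolding linear_tsum[OF bounded_linear.linear[OF bl]] el
    by (simp add: tform_def tsum_def gm_def Z_def comp_def case_prod_unfold)
  moreover have "(\<lambda>n. h (star (\<gamma> v) * \<gamma> (H (tsum cs (X n) * cs 1 e)))) \<longlonglongrightarrow>
      h (star (\<gamma> v) * \<gamma> (H (\<beta> g * cs 1 e)))"
    by (rule bounded_linear.tendsto[OF bl X])
  moreover have "h (star (\<gamma> v) * \<gamma> (H (\<beta> g * cs 1 e))) = h (star (P (\<gamma> v) s) * w)"
    by (simp add: \<gamma>_H_P e_def h_P_lt w_def star_P)
  ultimately have "(\<lambda>n. ip (gm (Z c (X n))) [(\<gamma> v, s)]) \<longlonglongrightarrow> h (star (P (\<gamma> v) s) * w)"
    by simp
  from tendsto_add[OF this Cons] show ?case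
    by (simp add: u tform_Cons2[of _ _ _ _ "gm \<eta>"] star_add distrib_right h_add)
qed

text \<open>The weak form of \<open>Q P\<^sup>* = 1\<close>. On vectors \<open>V \<eta>\<close> the
  limit follows from \<open>h_rt\<close>, commutativity of \<open>K\<close> and
  \<open>h_P_rt\<close>; the bound \<open>tt_Y_le\<close> extends it to
  \<open>cs k 1\<close>.\<close>

lemma tendsto_QQ_Z: "(\<lambda>n. h (QQ (gm (Z c (X n))) * \<gamma> k)) \<longlonglongrightarrow> h (\<gamma> k * w)"
proof -
  have "(\<lambda>n. tt (Y c (X n) * cs k 1)) \<longlonglongrightarrow> h (\<gamma> (H (cs k 1)) * w)"
  proof (rule tendsto_of_dense[OF _ _ _ V_dense])
    show "linear (\<lambda>z. tt (Y c (X n) * z))" for n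
      by (intro bounded_linear.linear bounded_linear_compose[OF tt_bounded] bl_intros)
    show "bounded_linear (\<lambda>z. h (\<gamma> (H z) * w))"
      by (intro bl_intros)
    have C: "0 \<le> Re (h (c * star c))"
      using pos_fun_Re[OF h_pos_fun, of "star c"] by simp
    show "norm (tt (Y c (X n) * z)) \<le> sqrt (Re (h (c * star c))) * M * norm z" for n z
    proof -
      have "Re (tt (star (star (Y c (X n))) * star (Y c (X n)))) \<le> Re (h (c * star c)) * M\<^sup>2"
        using tt_Y_le[of c "X n"] mult_left_mono[OF power_mono[OF M norm_ge_zero, of n 2] C]
        by simp
      from tt_bound[OF this C M_nonneg] show ?thesis by simp
    qed
    show "(\<lambda>n. tt (Y c (X n) * V \<eta>)) \<longlonglongrightarrow> h (\<gamma> (H (V \<eta>)) * w)" for \<eta>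
    proof (induction \<eta>)
      case Nil
      have "tt 0 = 0" by (rule linear_0[OF bounded_linear.linear[OF tt_bounded]])
      then show ?case
        by (simp add: clinear_zero[OF H_clinear] clinear_zero[OF \<gamma>_clinear] h_zero)
    next
      case (Cons u \<eta>)
      obtain z y where u: "u = (z, y)" by force
      define e where "e = rt c y"
      have bl: "bounded_linear (\<lambda>x. h (\<gamma> (H (x * cs 1 e)) * \<gamma> z))"
        by (intro bl_intros)
      have el: "h (\<gamma> (H (cs f s * cs 1 e)) * \<gamma> z) = tt (cs 1 (Q s c) * \<beta> f * (\<beta> z * cs 1 y))" for f s
      proof -
        have "h (\<gamma> (H (cs f s * cs 1 e)) * \<gamma> z) = h (s * rt c y) * h (\<gamma> f * \<gamma> z)"
          by (simp add: CS.mult H_cs \<gamma>_scale mult_scaleC_left h_scale e_def)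
        also have "\<dots> = tt (cs 1 (Q s c) * \<beta> (f * z) * cs 1 y)"
          by (simp add: tt_\<beta> \<gamma>_mult h_rt)
        also have "\<dots> = tt (cs 1 (Q s c) * \<beta> f * (\<beta> z * cs 1 y))"
          by (simp add: \<beta>_mult mult.assoc)
        finally show ?thesis .
      qed
      have bl2: "bounded_linear (\<lambda>x. tt (x * (\<beta> z * cs 1 y)))"
        by (intro bounded_linear_compose[OF tt_bounded] bl_intros)
      have "tt (Y c us * (\<beta> z * cs 1 y)) = h (\<gamma> (H (tsum cs us * cs 1 e)) * \<gamma> z)" for us
        unfolding Y_def linear_tsum[OF bounded_linear.linear[OF bl]] el
          linear_tsum[OF bounded_linear.linear[OF bl2]] ..
      moreover have "(\<lambda>n. h (\<gamma> (H (tsum cs (X n) * cs 1 e)) * \<gamma> z)) \<longlonglongrightarrow> h (\<gamma> (H (\<beta> g * cs 1 e)) * \<gamma> z)"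
        by (rule bounded_linear.tendsto[OF bl X])
      moreover have "h (\<gamma> (H (\<beta> g * cs 1 e)) * \<gamma> z) = h (P (\<gamma> z) y * w)"
      proof -
        have "h (\<gamma> (H (\<beta> g * cs 1 e)) * \<gamma> z) = h (\<gamma> z * P (\<gamma> g) e)"
          using K_commute[OF \<gamma>_in_K[of "H (\<beta> g * cs 1 e)"] \<gamma>_in_K[of z]] by (simp add: \<gamma>_H_P)
        then show ?thesis by (simp add: e_def h_P_rt w_def)
      qed
      ultimately have "(\<lambda>n. tt (Y c (X n) * (\<beta> z * cs 1 y))) \<longlonglongrightarrow> h (P (\<gamma> z) y * w)"
        by simp
      from tendsto_add[OF this Cons] show ?case
        by (simp add: u distrib_left distrib_right clinear_add[OF H_clinear] clinear_add[OF \<gamma>_clinear] \<gamma>_H_P h_add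
            linear_add[OF bounded_linear.linear[OF tt_bounded]])
    qed
  qed
  then show ?thesis
    by (simp add: tt_def H_mult_right \<gamma>_mult \<gamma>_H_Y H_cs)
qed

lemma ip_Z_bound: "Re (ip (gm (Z c (X n))) (gm (Z c (X n)))) \<le> Re (h (star c * c)) * M\<^sup>2"
  using ip_Z_le[of c "X n"]
    mult_left_mono[OF power_mono[OF M norm_ge_zero, of n 2] pos_fun_Re[OF h_pos_fun, of c]]
  by simp

text \<open>The identity \<open>P P\<^sup>* w = w\<close>, tested against \<open>w\<close>; the weak
  limits are extended from values of \<open>V\<close> to \<open>cs w0 1\<close>.\<close>

lemma tendsto_PP_Z: "(\<lambda>m. h (star (PP (gm (Z c (X m)))) * w)) \<longlonglongrightarrow> h (star w * w)"
proof -
  have "(\<lambda>m. tt (star (V (Z c (X m))) * cs w0 1)) \<longlonglongrightarrow> h (star w * \<gamma> (H (cs w0 1)))"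
  proof (rule tendsto_of_dense[OF _ _ _ V_dense])
    show "linear (\<lambda>z. tt (star (V (Z c (X m))) * z))" for m
      by (intro bounded_linear.linear bounded_linear_compose[OF tt_bounded] bl_intros)
    show "bounded_linear (\<lambda>z. h (star w * \<gamma> (H z)))"
      by (intro bl_intros)
    show "norm (tt (star (V (Z c (X m))) * z)) \<le> sqrt (Re (h (star c * c))) * M * norm z" for m z
      by (rule tt_bound[OF _ pos_fun_Re[OF h_pos_fun] M_nonneg]) (simp add: tt_V ip_Z_bound)
    show "(\<lambda>m. tt (star (V (Z c (X m))) * V \<eta>)) \<longlonglongrightarrow> h (star w * \<gamma> (H (V \<eta>)))" for \<eta>
    proof -
      have "(\<lambda>m. cnj (ip (gm (Z c (X m))) (gm \<eta>))) \<longlonglongrightarrow> cnj (h (star (PP (gm \<eta>)) * w))"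
        by (intro tendsto_cnj tendsto_ip_Z)
      then show ?thesis
        by (simp add: tt_V \<gamma>_H_V star_mult flip: tform_sym[OF h_form h_form] h_star)
    qed
  qed
  then show ?thesis
    by (simp add: tt_def H_mult_right H_star \<gamma>_mult \<gamma>_star \<gamma>_H_V H_cs w_eq)
qed

text \<open>Weak convergence alone does not control lengths. By \<open>ip_Z_le\<close> the lists
  \<open>Z c (X n)\<close> are Cauchy in length because \<open>X\<close> is, and comparison with one
  late \<open>Z c (X m)\<close> reduces the diagonal to the two weak limits.\<close>

lemma tendsto_ip_Z_self: "(\<lambda>n. ip (gm (Z c (X n))) (gm (Z c (X n)))) \<longlonglongrightarrow> h (star w * w)"
proof (rule LIMSEQ_I)
  fix r :: real assume r: "0 < r"
  define C where "C = Re (h (star c * c))"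
  have C: "0 \<le> C" unfolding C_def by (rule pos_fun_Re[OF h_pos_fun])
  let ?z = "\<lambda>n. gm (Z c (X n))"
  let ?neg = "map (\<lambda>(a, b). ((- 1) *\<^sub>C a, b))"
  have diff: "cmod (ip (?z n) (?z n) - ip (?z n) (?z m)) \<le> C * M * norm (tsum cs (X n) - tsum cs (X m))"
    for n m
  proof (rule power2_le_imp_le)
    \<comment> \<open>A list representing the difference of two approximations, so that
      \<open>ip_Z_le\<close> bounds the difference of their images.\<close>
    let ?Y = "X n @ ?neg (X m)"
    have Z: "gm (Z c ?Y) = ?z n @ ?neg (?z m)"
      by (simp add: gm_def Z_def comp_def case_prod_unfold clinear_minus[OF \<gamma>_clinear])
    have Y: "tsum cs ?Y = tsum cs (X n) - tsum cs (X m)"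
    proof -
      have "tsum cs (?neg us) = - tsum cs us" for us
        by (induction us) (auto simp: clinear_minus[OF CS.clinear1])
      then show ?thesis by simp
    qed
    have eq: "ip (?z n) (?z n) - ip (?z n) (?z m) = ip (?z n) (gm (Z c ?Y))"
      unfolding Z tform_append2 tform_scale2[OF h_form] by simp
    have "(cmod (ip (?z n) (gm (Z c ?Y))))\<^sup>2 \<le> Re (ip (?z n) (?z n)) * Re (ip (gm (Z c ?Y)) (gm (Z c ?Y)))"
      by (rule tform_Cauchy_Schwarz[OF h_form h_form])
    also have "\<dots> \<le> (C * M\<^sup>2) * (C * (norm (tsum cs ?Y))\<^sup>2)"
      unfolding C_def
      by (intro mult_mono ip_Z_bound ip_Z_le ip_nonneg mult_nonneg_nonneg C[unfolded C_def]) simp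
    also have "\<dots> = (C * M * norm (tsum cs (X n) - tsum cs (X m)))\<^sup>2"
      unfolding Y by (simp add: power_mult_distrib power2_eq_square)
    finally show "(cmod (ip (?z n) (?z n) - ip (?z n) (?z m)))\<^sup>2 \<le>
        (C * M * norm (tsum cs (X n) - tsum cs (X m)))\<^sup>2"
      unfolding eq .
  qed (use C M_nonneg in simp)
  \<comment> \<open>The summand 1 keeps the divisor positive when \<open>C * M\<close>
    vanishes.\<close>
  define d where "d = r / 3 / (C * M + 1)"
  have CM: "0 \<le> C * M" using C M_nonneg by simp
  then have d: "0 < d" using r by (simp add: d_def)
  have "Cauchy (\<lambda>n. tsum cs (X n))" using X by (rule LIMSEQ_imp_Cauchy)
  from CauchyD[OF this d] obtain n0
    where n0: "\<forall>m\<ge>n0. \<forall>n\<ge>n0. norm (tsum cs (X m) - tsum cs (X n)) < d" by blast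
  obtain m0 where m0: "\<And>m. m \<ge> m0 \<Longrightarrow> norm (h (star (PP (?z m)) * w) - h (star w * w)) < r / 3"
    using LIMSEQ_D[OF tendsto_PP_Z, of "r / 3"] r by auto
  define m where "m = max n0 m0"
  obtain n1 where n1: "\<And>n. n \<ge> n1 \<Longrightarrow> norm (ip (?z n) (?z m) - h (star (PP (?z m)) * w)) < r / 3"
    using LIMSEQ_D[OF tendsto_ip_Z[of "Z c (X m)"], of "r / 3"] r by auto
  show "\<exists>no. \<forall>n\<ge>no. norm (ip (?z n) (?z n) - h (star w * w)) < r"
  proof (intro exI allI impI)
    fix n assume n: "max n0 n1 \<le> n"
    have "norm (ip (?z n) (?z n) - ip (?z n) (?z m)) \<le> C * M * norm (tsum cs (X n) - tsum cs (X m))"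
      by (rule diff)
    also have "\<dots> \<le> C * M * d"
      using n0 n CM by (intro mult_left_mono) (auto simp: m_def less_imp_le)
    also have "\<dots> \<le> (C * M + 1) * d" using d by simp
    also have "\<dots> = r / 3"
    proof -
      have "x * (r / 3 / x) = r / 3" if "0 < x" for x using that by simp
      from this[of "C * M + 1"] CM show ?thesis by (simp only: d_def)
    qed
    finally have 1: "norm (ip (?z n) (?z n) - ip (?z n) (?z m)) \<le> r / 3" .
    have 2: "norm (ip (?z n) (?z m) - h (star (PP (?z m)) * w)) < r / 3"
      using n by (intro n1) simp
    have 3: "norm (h (star (PP (?z m)) * w) - h (star w * w)) < r / 3"
      by (rule m0) (simp add: m_def)
    show "norm (ip (?z n) (?z n) - h (star w * w)) < r"
      using norm_diff_less_thirds[OF 1 2 3] .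
  qed
qed

text \<open>
  Along \<open>Z c (X n)\<close>, the contraction \<open>QQ\<close> attains its norm bound in the limit, so the bound
  is tight to first order in every direction \<open>\<zeta>\<close>; the first-order terms give the equality.
\<close>

lemma QQ_eq_PP_weak: "h (star w * QQ (gm \<zeta>)) = h (star w * PP (gm \<zeta>))"
proof -
  define W where "W = Re (h (star w * w))"
  define p q where "p = h (star w * PP (gm \<zeta>))" and "q = h (star w * QQ (gm \<zeta>))"
  have W: "h (star w * w) = of_real W"
    unfolding W_def by (rule pos_fun_self[OF h_pos_fun])
  have W0: "0 \<le> W" unfolding W_def by (rule pos_fun_Re[OF h_pos_fun])
  let ?N = "Re (ip (gm \<zeta>) (gm \<zeta>))"
  \<comment> \<open>\<open>QQ_bound\<close> at \<open>w\<close> for the lists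
    \<open>Z c (X n)\<close> perturbed by \<open>s\<close> times \<open>\<zeta>\<close>, in the
    limit.\<close>
  have key: "(cmod (of_real W + s * q))\<^sup>2 \<le> W * (W + 2 * Re (s * p) + (cmod s)\<^sup>2 * ?N)" for s
  proof -
    let ?sc = "map (\<lambda>(a, b). (s *\<^sub>C a, b))"
    let ?\<theta> = "\<lambda>n. Z c (X n) @ ?sc \<zeta>"
    have gm: "gm (?\<theta> n) = gm (Z c (X n)) @ ?sc (gm \<zeta>)" for n
      by (simp add: gm_def comp_def case_prod_unfold \<gamma>_scale)
    have Qs: "Q b (s *\<^sub>C f) = s *\<^sub>C Q b f" for b f
      by (simp add: Q_def clinear_scaleC[OF \<Delta>_clinear] clinear_scaleC[OF R_clinear] mult_scaleC_right)
    have "QQ (?sc us) = s *\<^sub>C QQ us" for us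
      by (induction us) (auto simp: Qs scaleC_add_right)
    then have "h (star w * QQ (gm (?\<theta> n))) = h (QQ (gm (Z c (X n))) * star w) + s * q" for n
      using K_commute[OF K_star[OF w_in_K] QQ_in_K[of "Z c (X n)"]]
      unfolding gm by (simp add: q_def distrib_left h_add mult_scaleC_right h_scale)
    moreover have "(\<lambda>n. h (QQ (gm (Z c (X n))) * star w) + s * q) \<longlonglongrightarrow> of_real W + s * q"
      using tendsto_QQ_Z[of "star w0"]
      by (intro tendsto_add tendsto_const) (simp add: w_eq \<gamma>_star flip: W)
    ultimately have "(\<lambda>n. (cmod (h (star w * QQ (gm (?\<theta> n)))))\<^sup>2) \<longlonglongrightarrow> (cmod (of_real W + s * q))\<^sup>2"
      by (intro tendsto_power tendsto_norm) simp
    moreover have "(\<lambda>n. W * Re (ip (gm (?\<theta> n)) (gm (?\<theta> n)))) \<longlonglongrightarrow> W * (W + 2 * Re (s * p) + (cmod s)\<^sup>2 * ?N)"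
    proof -
      have "(\<lambda>n. ip (gm \<zeta>) (gm (Z c (X n)))) \<longlonglongrightarrow> p"
        using tendsto_cnj[OF tendsto_ip_Z[of \<zeta>]]
        by (simp add: p_def star_mult flip: tform_sym[OF h_form h_form] h_star)
      moreover have "(\<lambda>n. Re (ip (gm (Z c (X n))) (gm (Z c (X n))))) \<longlonglongrightarrow> W"
        using tendsto_Re[OF tendsto_ip_Z_self] by (simp add: W)
      ultimately show ?thesis
        unfolding gm tform_add_scaled[OF h_form h_form]
        by (intro tendsto_mult tendsto_add tendsto_const tendsto_Re)
    qed
    moreover have "(cmod (h (star w * QQ (gm (?\<theta> n)))))\<^sup>2 \<le> W * Re (ip (gm (?\<theta> n)) (gm (?\<theta> n)))" for n
      using QQ_bound[of w0 "?\<theta> n"] by (simp add: W_def w_eq)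
    ultimately show ?thesis by (meson LIMSEQ_le)
  qed
  have "p = q"
  proof (cases "W = 0")
    case True
    then have "w = 0" using h_faithful[of w] W by simp
    then show ?thesis by (simp add: p_def q_def h_zero)
  next
    case False
    with W0 have pos: "0 < W" by simp
    \<comment> \<open>At \<open>s = 0\<close> the inequality \<open>key\<close> is an equality, so
      after cancellation a quadratic without constant term remains, and its linear coefficient must
      vanish.\<close>
    have "0 \<le> 0 + 2 * Re (s * (p - q)) + (cmod s)\<^sup>2 * ?N" for s
    proof -
      have "(cmod (of_real W + s * q))\<^sup>2 = W * W + W * (2 * Re (s * q)) + (cmod (s * q))\<^sup>2"
        by (simp only: cmod_power2) (simp add: power2_eq_square algebra_simps)
      with key[of s] have "W * (2 * Re (s * q)) \<le> W * (2 * Re (s * p) + (cmod s)\<^sup>2 * ?N)"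
        by (simp add: distrib_left add_ac) (smt (verit) zero_le_power2)
      then have "2 * Re (s * q) \<le> 2 * Re (s * p) + (cmod s)\<^sup>2 * ?N"
        using pos by (rule mult_left_le_imp_le)
      then show ?thesis by (simp add: right_diff_distrib)
    qed
    from quadratic_discriminant[OF this] show ?thesis by simp
  qed
  then show ?thesis by (simp add: p_def q_def)
qed

end

section \<open>Equality of P and Q, and centrality of K\<close>

text \<open>The difference \<open>D\<close> lies in \<open>K\<close>, so it is a limit of sums of
  the test vectors \<open>P (\<gamma> g) c\<close>; orthogonal to all of these, it is orthogonal to
  itself.\<close>

lemma P_eq_Q:
  assumes f: "f \<in> K" shows "P f b = Q b f"
proof -
  obtain f0 where f0: "f = \<gamma> f0" using f unfolding K_def by blast
  define D where "D = Q b f - P f b"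
  have weak: "h (star (P (\<gamma> g) c) * D) = 0" for g c
  proof -
    obtain X where X: "(\<lambda>n :: nat. tsum cs (X n)) \<longlonglongrightarrow> \<beta> g" using CS.seq .
    from X have "Bseq (\<lambda>n. tsum cs (X n))" by (rule convergent_imp_Bseq[OF convergentI])
    then obtain M where M: "\<And>n. norm (tsum cs (X n)) \<le> M"
      by (rule BseqE) (use that in blast)
    from QQ_eq_PP_weak[OF X M, of c "[(f0, b)]"] show ?thesis
      by (simp add: f0 D_def right_diff_distrib h_diff)
  qed
  have weak': "h (star (PP (gm \<eta>)) * D) = 0" for \<eta>
    by (induction \<eta>) (simp_all add: star_add distrib_right h_add h_zero weak)
  have "D \<in> K"
  proof -
    obtain a b' where ab: "Q b f = \<gamma> a" "P f b = \<gamma> b'"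
      using Q_in_K[OF f, of b] P_in_K[OF f, of b] unfolding K_def by blast
    then have "D = \<gamma> (a - b')" by (simp add: D_def clinear_diff[OF \<gamma>_clinear])
    then show ?thesis by simp
  qed
  then obtain d where d: "D = \<gamma> d" unfolding K_def by blast
  obtain \<eta> where "(\<lambda>n :: nat. V (\<eta> n)) \<longlonglongrightarrow> cs d 1" using V_seq .
  from tendsto_PP[OF this] have "(\<lambda>n. h (star (PP (gm (\<eta> n))) * D)) \<longlonglongrightarrow> h (star (\<gamma> d) * D)"
    by (intro bounded_linear.tendsto[OF h_bounded] tendsto_mult
        bounded_linear.tendsto[OF bounded_linear_star] tendsto_const)
  then have "h (star D * D) = 0" unfolding weak' LIMSEQ_const_iff by (simp add: d)
  then have "D = 0" by (rule h_faithful)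
  then show ?thesis by (simp add: D_def)
qed

lemma central_rt:
  assumes "u \<in> K" "k \<in> K"
  shows "h (rt u k * b) = h (b * rt u k)"
proof -
  have "h (rt u k * b) = h (P u b * k)" by (rule h_rt_left)
  also have "\<dots> = h (b * rt u k)" by (simp add: P_eq_Q[OF assms(1)] h_rt)
  finally show ?thesis .
qed

lemma rt_eq_lt:
  assumes "u \<in> K" "g \<in> K"
  shows "rt g u = lt u g"
proof (rule eq_of_h)
  show "h (c * rt g u) = h (c * lt u g)" for c
    unfolding h_rt h_Q_left[symmetric] by (simp only: K_commute[OF Q_in_K[OF assms(2)] assms(1)])
qed

lemma rt_eq_lt_central:
  assumes g: "g \<in> K" shows "rt g b = lt b g"
proof -
  define y where "y = rt g b - lt b g"
  have *: "h (c * y) = h (Q c g * b) - h (b * Q c g)" for c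
    by (simp add: y_def right_diff_distrib h_diff h_rt h_Q_left)
  \<comment> \<open>\<open>Q_lt\<close> rewrites \<open>Q (lt u f) g\<close> as
    \<open>rt u (P f g)\<close>, to which \<open>central_rt\<close> applies.\<close>
  have T: "h (lt u f * y) = 0" if "u \<in> K" "f \<in> K" for u f
    unfolding * Q_lt rt_def[symmetric]
    using central_rt[OF that(1) P_in_K[OF that(2)]] by simp
  have T': "h (star y * lt u g) = 0" if u: "u \<in> K" for u
  proof -
    have "star (lt u g) = lt (star u) (star g)"
      by (simp add: star_lt rt_eq_lt[OF K_star[OF u] K_star[OF g]])
    then have "h (star (star y * lt u g)) = 0"
      by (simp add: star_mult T[OF K_star[OF u] K_star[OF g]])
    then show ?thesis by (simp add: h_star)
  qed
  \<comment> \<open>\<open>h (k * u)\<close> pairs \<open>star y\<close> with \<open>rt g u\<close>,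
    which is \<open>lt u g\<close> for \<open>u\<close> in \<open>K\<close>. So \<open>k\<close> is
    orthogonal to \<open>K\<close>, but it also lies in \<open>K\<close>.\<close>
  define k where "k = Q (star y) g"
  have k: "k \<in> K" unfolding k_def by (rule Q_in_K[OF g])
  have ku: "h (k * u) = 0" if u: "u \<in> K" for u
    unfolding k_def h_rt[symmetric] rt_eq_lt[OF u g] by (rule T'[OF u])
  have "h (star (star k) * star k) = 0"
    using ku[OF K_star[OF k]] by simp
  then have "star k = 0" by (rule h_faithful)
  then have "k = 0" by (metis star_star star_zero)
  \<comment> \<open>For \<open>c = star y\<close> the formula for \<open>h (c * y)\<close> involves
    \<open>g\<close> only through \<open>k\<close>.\<close>
  then have "h (star y * y) = 0"
    unfolding * k_def[symmetric] by (simp add: h_zero)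
  then have "y = 0" by (rule h_faithful)
  then show ?thesis by (simp add: y_def)
qed

theorem K_central: "h (\<gamma> k * b) = h (b * \<gamma> k)"
proof -
  have P: "h (P g c * b) = h (b * P g c)" if "g \<in> K" for g c
    using rt_eq_lt_central[OF that, of b] by (simp add: h_lt flip: h_rt_left)
  have PP: "h (PP (gm \<eta>) * b) = h (b * PP (gm \<eta>))" for \<eta>
    by (induction \<eta>) (simp_all add: P distrib_left distrib_right h_add)
  obtain \<eta> where "(\<lambda>n :: nat. V (\<eta> n)) \<longlonglongrightarrow> cs k 1" using V_seq .
  note lim = tendsto_PP[OF this]
  have "(\<lambda>n. h (PP (gm (\<eta> n)) * b)) \<longlonglongrightarrow> h (\<gamma> k * b)" "(\<lambda>n. h (b * PP (gm (\<eta> n)))) \<longlonglongrightarrow> h (b * \<gamma> k)"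
    by (intro bounded_linear.tendsto[OF h_bounded] tendsto_mult tendsto_const lim)+
  then show ?thesis unfolding PP by (rule LIMSEQ_unique)
qed

end

section \<open>Actions on algebras of functions\<close>

text \<open>The GNS form of a character has rank one, so the product form sees only the slices. This
  serves to compute \<open>gns_inner\<close> at evaluation states.\<close>

lemma tform_rank_one:
  assumes B: "pos_form B"
  shows "tform (\<lambda>a c. \<alpha> a * cnj (\<alpha> c)) B vs ws =
    B (tsum (\<lambda>a b. \<alpha> a *\<^sub>C b) vs) (tsum (\<lambda>a b. \<alpha> a *\<^sub>C b) ws)"
proof -
  have 1: "tform (\<lambda>a c. \<alpha> a * cnj (\<alpha> c)) B [v] ws = B (\<alpha> (fst v) *\<^sub>C snd v) (tsum (\<lambda>a b. \<alpha> a *\<^sub>C b) ws)" for v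
  proof (induction ws)
    case (Cons w ws)
    then show ?case
      unfolding tform_Cons2[of _ _ _ w ws] tsum_simps pos_form_add2[OF B]
      by (simp add: tform_def pos_form_scale1[OF B] pos_form_scale2[OF B])
  qed (simp add: pos_form_zero2[OF B])
  show ?thesis
  proof (induction vs)
    case (Cons v vs)
    then show ?case
      unfolding tform_Cons1[of _ _ v vs] tsum_simps pos_form_add1[OF B] 1 by simp
  qed (simp add: pos_form_zero1[OF B])
qed

lemma ev_clinear: "clinear (\<lambda>f :: 'x :: topological_space \<Rightarrow>\<^sub>C complex. apply_bcontfun f x)"
  by (rule clinearI) (simp_all add: scaleC_bcontfun.rep_eq)

lemma ev_state: "is_state (\<lambda>f :: 'x :: topological_space \<Rightarrow>\<^sub>C complex. apply_bcontfun f x)"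
  unfolding is_state_def
  by (auto simp: ev_clinear times_bcontfun.rep_eq star_bcontfun.rep_eq one_bcontfun.rep_eq
      complex_nonneg_Reals_iff mult.commute[of "cnj _"] complex_mult_cnj)

lemma ev_tsum:
  "apply_bcontfun (tsum (\<lambda>f s. \<phi> s *\<^sub>C (f :: 'x :: topological_space \<Rightarrow>\<^sub>C complex)) us) x =
    tsum (\<lambda>f s. apply_bcontfun f x * \<phi> s) us"
  by (induction us) (simp_all add: scaleC_bcontfun.rep_eq mult.commute)

locale function_action = cqg_haar ss ss_s s_ss \<Delta> h L R + cqg_action ss ss_s s_ss \<Delta> cs cs_s c_ss \<beta>
  for ss :: "'s :: unital_cstar_algebra \<Rightarrow> 's \<Rightarrow> 'ss :: unital_cstar_algebra"
    and ss_s :: "'ss \<Rightarrow> 's \<Rightarrow> 'sss :: unital_cstar_algebra"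
    and s_ss :: "'s \<Rightarrow> 'ss \<Rightarrow> 'sss"
    and \<Delta> :: "'s \<Rightarrow> 'ss" and h :: "'s \<Rightarrow> complex" and L R :: "'ss \<Rightarrow> 's"
    and cs :: "('x :: topological_space \<Rightarrow>\<^sub>C complex) \<Rightarrow> 's \<Rightarrow> 'cs :: unital_cstar_algebra"
    and cs_s :: "'cs \<Rightarrow> 's \<Rightarrow> 'css :: unital_cstar_algebra"
    and c_ss :: "('x \<Rightarrow>\<^sub>C complex) \<Rightarrow> 'ss \<Rightarrow> 'css"
    and \<beta> :: "('x \<Rightarrow>\<^sub>C complex) \<Rightarrow> 'cs"
begin

sublocale CS: tensor cs
  using action_tensors by unfold_locales (simp add: min_tensor3_def)

sublocale C3: tensor cs_s
  using action_tensors by unfold_locales (simp add: min_tensor3_def)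

sublocale C3': tensor c_ss
  using action_tensors by unfold_locales (simp add: min_tensor3_def)

lemma action_assoc: "cs_s (cs f a) b = c_ss f (ss a b)"
  using action_tensors by (simp add: min_tensor3_def)

text \<open>The norm of a function is tested pointwise, and the slice followed by evaluation at
  \<open>x\<close> is the product state \<open>ev\<^sub>x \<otimes> h\<close>, hence
  contractive.\<close>

lemma slice_H: obtains H where "right_slice cs h H"
proof -
  have bound: "norm (tsum (\<lambda>f s. h s *\<^sub>C f) us) \<le> 1 * norm (tsum cs us)" for us
  proof (rule norm_bound)
    fix x
    obtain \<Omega> where \<Omega>: "is_state \<Omega>" "\<And>a b. \<Omega> (cs a b) = apply_bcontfun a x * h b"
      using CS.product_state[OF ev_state state, of x] by metis
    note p = state_pos_fun[OF \<Omega>(1)]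
    have "apply_bcontfun (tsum (\<lambda>f s. h s *\<^sub>C f) us) x = \<Omega> (tsum cs us)"
      unfolding linear_tsum[OF clinear_imp_linear[OF pos_fun_clinear[OF p]]] \<Omega>(2) ev_tsum ..
    then show "norm (apply_bcontfun (tsum (\<lambda>f s. h s *\<^sub>C f) us) x) \<le> 1 * norm (tsum cs us)"
      using pos_fun_norm_le[OF p, of "tsum cs us"] \<Omega>(1) by (simp add: is_state_iff)
  qed
  have "clinear (\<lambda>f. h s *\<^sub>C f)" for s
    by (rule clinearI) (simp_all add: scaleC_add_right scaleC_scaleC mult.commute)
  from CS.extension[OF this bound]
  obtain H where "bounded_clinear H" "\<And>f s. H (cs f s) = h s *\<^sub>C f" by blast
  then show thesis by (intro that[of H]) (simp add: right_slice_def)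
qed

text \<open>
  \<open>L\<close> is a bounded left inverse of \<open>s \<mapsto> 1 \<otimes> s\<close>, so up to a constant the norm of \<open>'s\<close> is a
  spatial norm and hence determined by states, without the Hahn-Banach theorem.
\<close>

lemma slice_ev:
  obtains e where "bounded_clinear e" "\<And>f s. e (cs f s) = apply_bcontfun f x *\<^sub>C s"
proof -
  obtain C where C: "C > 0" "\<And>z. norm (L z) \<le> norm z * C"
    using bounded_linear.pos_bounded[OF L_bounded] by blast
  have bound: "norm (tsum (\<lambda>f s. apply_bcontfun f x *\<^sub>C s) us) \<le> C * norm (tsum cs us)" for us
  proof -
    define s where "s = tsum (\<lambda>f s. apply_bcontfun f x *\<^sub>C s) us"
    define N where "N = norm (tsum cs us)"
    \<comment> \<open>The spatial norm of \<open>us\<close> is tested at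
      \<open>ev\<^sub>x \<otimes> \<psi>\<close> on the vector \<open>1 \<otimes> d\<close>; the
      rank one form turns this into \<open>s\<close> acting on \<open>d\<close>.\<close>
    have le: "Re (\<psi> (star (s * d) * (s * d))) \<le> N\<^sup>2 * Re (\<psi> (star d * d))"
      if \<psi>: "is_state \<psi>" for \<psi> d
    proof -
      let ?ev = "\<lambda>f. apply_bcontfun f x"
      have gns: "gns_inner ?ev \<psi> vs ws =
          \<psi> (star (tsum (\<lambda>f s. ?ev f *\<^sub>C s) ws) * tsum (\<lambda>f s. ?ev f *\<^sub>C s) vs)" for vs ws
      proof -
        have "gns_inner ?ev \<psi> vs ws = tform (\<lambda>a c. ?ev a * cnj (?ev c)) (\<lambda>b d. \<psi> (star d * b)) vs ws"
          by (simp add: gns_inner_tform times_bcontfun.rep_eq star_bcontfun.rep_eq mult.commute)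
        also have "\<dots> = \<psi> (star (tsum (\<lambda>f s. ?ev f *\<^sub>C s) ws) * tsum (\<lambda>f s. ?ev f *\<^sub>C s) vs)"
          by (rule tform_rank_one[OF pos_fun_form[OF state_pos_fun[OF \<psi>]]])
        finally show ?thesis .
      qed
      have "tsum (\<lambda>f s. ?ev f *\<^sub>C s) (tensor_mult us [(1, d)]) = s * d"
        unfolding s_def by (induction us) (auto simp: tensor_mult_Cons distrib_right mult_scaleC_left)
      moreover have "tsum (\<lambda>f s. ?ev f *\<^sub>C s) [(1, d)] = d"
        by (simp add: one_bcontfun.rep_eq)
      ultimately show ?thesis
        using gns_tensor_mult_le[OF ev_state \<psi>, where us = us and vs = "[(1, d)]" and x1 = x]
        unfolding gns by (simp add: N_def CS.norm_tsum)
    qed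
    have "spatial_norm [(1 :: 's, s)] \<le> N"
    proof (rule spatial_norm_le[OF state state])
      show "0 \<le> N" by (simp add: N_def)
      fix \<phi> \<psi> :: "'s \<Rightarrow> complex" and vs
      assume \<phi>: "is_state \<phi>" and \<psi>: "is_state \<psi>"
      let ?A = "\<lambda>a c. \<phi> (star c * a)" and ?B = "\<lambda>a c. \<psi> (star c * a)"
      have A: "pos_form ?A" and B: "pos_form ?B"
        using pos_fun_form[OF state_pos_fun[OF \<phi>]] pos_fun_form[OF state_pos_fun[OF \<psi>]] .
      have "gns_inner \<phi> \<psi> (tensor_mult [(1, s)] vs) (tensor_mult [(1, s)] vs) =
          tform ?A (\<lambda>a c. ?B (s * a) (s * c)) vs vs"
        by (simp add: gns_inner_tform tensor_mult_Cons tform_map_prod)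
      moreover have "Re (tform ?A (\<lambda>a c. ?B (s * a) (s * c)) vs vs) \<le>
          Re (tform ?A (\<lambda>a c. of_real (N\<^sup>2) * ?B a c) vs vs)"
        by (rule tform_mono2[OF A pos_form_scaleR[OF B] pos_form_comp[OF B clinear_mult_left]])
           (use le[OF \<psi>] in simp_all)
      ultimately show "Re (gns_inner \<phi> \<psi> (tensor_mult [(1, s)] vs) (tensor_mult [(1, s)] vs)) \<le>
          N\<^sup>2 * Re (gns_inner \<phi> \<psi> vs vs)"
        unfolding tform_scaleR_right by (simp add: gns_inner_tform)
    qed
    then have "C * norm (ss 1 s) \<le> C * N"
      using S2.norm_tsum[of "[(1, s)]"] C(1) by simp
    moreover have "norm s \<le> C * norm (ss 1 s)"
      using C(2)[of "ss 1 s"] by (simp add: L_ss mult.commute)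
    ultimately show ?thesis
      unfolding s_def[symmetric] N_def[symmetric] by linarith
  qed
  have "clinear (\<lambda>f. apply_bcontfun f x *\<^sub>C s)" for s :: 's
    by (rule clinearI) (simp_all add: scaleC_add_left scaleC_scaleC scaleC_bcontfun.rep_eq)
  from CS.extension[OF this bound] that show thesis by blast
qed

text \<open>Instantiates \<open>commutative_coaction\<close> with
  \<open>\<gamma> = e \<circ> \<beta>\<close>. The coideal property is detected by \<open>h\<close>
  and follows by applying \<open>ev\<^sub>x \<otimes> h \<otimes> h\<close> to coassociativity of
  the action.\<close>

lemma pointwise_central:
  assumes H: "right_slice cs h H"
    and e: "bounded_clinear e" "\<And>f s. e (cs f s) = apply_bcontfun f x *\<^sub>C s"
  shows "h (e (\<beta> f) * b) = h (b * e (\<beta> f))"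
proof -
  have e_bounded: "bounded_linear e" and e_clinear: "clinear e"
    using e(1) by (simp_all add: bounded_clinear_def)
  have H_bounded: "bounded_linear H" and H_clinear: "clinear H" and H_cs: "\<And>f s. H (cs f s) = h s *\<^sub>C f"
    using H by (simp_all add: right_slice_def bounded_clinear_def)
  have \<beta>_clinear: "clinear \<beta>" and \<beta>_one: "\<beta> 1 = 1" and \<beta>_mult: "\<And>f g. \<beta> (f * g) = \<beta> f * \<beta> g"
    and \<beta>_star: "\<And>f. \<beta> (star f) = star (\<beta> f)"
    using action_hom by (simp_all add: unital_star_hom_def)
  have \<beta>_bounded: "bounded_linear \<beta>"
    by (rule CS.star_hom_bounded_linear[OF ev_state state action_hom])
  note bl = bounded_linear_intros bounded_linear_compose[OF e_bounded] bounded_linear_compose[OF H_bounded]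
    bounded_linear_compose[OF \<beta>_bounded] bounded_linear_compose[OF \<Delta>_bounded]
  have e_mult1: "e (z * cs g t) = e z * e (cs g t)" for z g t
  proof (rule CS.eqI[where f = "\<lambda>z. e (z * cs g t)"])
    show "bounded_linear (\<lambda>z. e (z * cs g t))" "bounded_linear (\<lambda>z. e z * e (cs g t))"
      by (intro bl)+
  qed (simp add: CS.mult e(2) times_bcontfun.rep_eq mult_scaleC_left mult_scaleC_right scaleC_scaleC)
  have e_mult: "e (z * y) = e z * e y" for z y
  proof (rule CS.eqI[where f = "\<lambda>y. e (z * y)"])
    show "bounded_linear (\<lambda>y. e (z * y))" "bounded_linear (\<lambda>y. e z * e y)"
      by (intro bl)+
  qed (rule e_mult1)
  have e_star: "e (star z) = star (e z)" for z
  proof (rule CS.eqI[where f = "\<lambda>z. e (star z)"])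
    show "bounded_linear (\<lambda>z. e (star z))" "bounded_linear (\<lambda>z. star (e z))"
      by (rule bounded_linear_compose[OF e_bounded bounded_linear_star]
          bounded_linear_compose[OF bounded_linear_star e_bounded])+
  qed (simp add: CS.star_t e(2) star_bcontfun.rep_eq star_scaleC)
  have e_one: "e 1 = 1"
    using e(2)[of 1 1] by (simp add: one_bcontfun.rep_eq)
  define \<gamma> where "\<gamma> f = e (\<beta> f)" for f
  have \<gamma>_hom: "unital_star_hom \<gamma>"
    unfolding unital_star_hom_def \<gamma>_def[abs_def]
    by (simp add: clinear_compose[OF e_clinear \<beta>_clinear] \<beta>_one e_one \<beta>_mult e_mult \<beta>_star e_star)
  have \<gamma>_bounded: "bounded_linear \<gamma>"
    unfolding \<gamma>_def[abs_def] by (intro bl bounded_linear_compose[OF e_bounded \<beta>_bounded])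
  obtain F G where FG: "tensor_hom cs cs_s \<beta> id F" "tensor_hom cs c_ss id \<Delta> G" "F \<circ> \<beta> = G \<circ> \<beta>"
    using action_coassociative by blast
  obtain \<theta> where \<theta>: "is_state \<theta>" "\<And>a b. \<theta> (cs a b) = apply_bcontfun a x * h b"
    using CS.product_state[OF ev_state state, of x] by metis
  obtain \<Xi> where \<Xi>: "is_state \<Xi>" "\<And>f y. \<Xi> (c_ss f y) = apply_bcontfun f x * hh y"
    using C3'.product_state[OF ev_state hh_state, of x] by metis
  have \<Xi>_bounded: "bounded_linear \<Xi>"
    by (rule pos_fun_bounded_linear[OF state_pos_fun[OF \<Xi>(1)]])
  have \<Xi>': "\<Xi> (cs_s z s) = h (e z) * h s" for z s
  proof (rule CS.eqI[where f = "\<lambda>z. \<Xi> (cs_s z s)"])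
    show "bounded_linear (\<lambda>z. \<Xi> (cs_s z s))"
      by (rule bounded_linear_compose[OF \<Xi>_bounded C3.bounded_linear1[OF \<theta>(1) state]])
    show "bounded_linear (\<lambda>z. h (e z) * h s)"
      by (intro bl e_bounded)
  qed (simp add: action_assoc \<Xi>(2) hh_ss e(2) h_scale)
  have F: "unital_star_hom F" "\<And>f s. F (cs f s) = cs_s (\<beta> f) s"
    using FG(1) by (simp_all add: tensor_hom_def)
  have G: "unital_star_hom G" "\<And>f s. G (cs f s) = c_ss f (\<Delta> s)"
    using FG(2) by (simp_all add: tensor_hom_def)
  have F_bounded: "bounded_linear F" and G_bounded: "bounded_linear G"
    using C3.star_hom_bounded_linear[OF \<theta>(1) state F(1)] C3.star_hom_bounded_linear[OF \<theta>(1) state G(1)] .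
  note bl' = bl bounded_linear_compose[OF \<Xi>_bounded] bounded_linear_compose[OF F_bounded]
    bounded_linear_compose[OF G_bounded]
  have coideal: "\<gamma> (H (cs 1 a * \<beta> f * cs 1 b)) = R (ss 1 a * \<Delta> (\<gamma> f) * ss 1 b)" for a f b
  proof (rule eq_of_h)
    fix c
    \<comment> \<open>Here the threefold tensor is read through
      \<open>id \<otimes> \<Delta>\<close>, in the next claim through
      \<open>\<beta> \<otimes> id\<close>; at \<open>z = \<beta> f\<close> the two agree.\<close>
    have 1: "\<Xi> (c_ss 1 (ss c a) * G z * c_ss 1 (ss 1 b)) = hh (ss c a * \<Delta> (e z) * ss 1 b)" for z
    proof (rule CS.eqI[where f = "\<lambda>z. \<Xi> (c_ss 1 (ss c a) * G z * c_ss 1 (ss 1 b))"])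
      show "bounded_linear (\<lambda>z. \<Xi> (c_ss 1 (ss c a) * G z * c_ss 1 (ss 1 b)))"
        "bounded_linear (\<lambda>z. hh (ss c a * \<Delta> (e z) * ss 1 b))"
        by (intro bl' G_bounded e_bounded)+
    qed (simp add: G(2) C3'.mult \<Xi>(2) e(2) clinear_scaleC[OF \<Delta>_clinear] mult_scaleC_left
          mult_scaleC_right hh_scale)
    have 2: "\<Xi> (c_ss 1 (ss c a) * F z * c_ss 1 (ss 1 b)) = h (c * e (\<beta> (H (cs 1 a * z * cs 1 b))))" for z
    proof (rule CS.eqI[where f = "\<lambda>z. \<Xi> (c_ss 1 (ss c a) * F z * c_ss 1 (ss 1 b))"])
      show "bounded_linear (\<lambda>z. \<Xi> (c_ss 1 (ss c a) * F z * c_ss 1 (ss 1 b)))"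
        "bounded_linear (\<lambda>z. h (c * e (\<beta> (H (cs 1 a * z * cs 1 b)))))"
        by (intro bl' F_bounded)+
      show "\<Xi> (c_ss 1 (ss c a) * F (cs g s) * c_ss 1 (ss 1 b)) =
          h (c * e (\<beta> (H (cs 1 a * cs g s * cs 1 b))))" for g s
        by (simp add: F(2) C3.mult CS.mult \<Xi>' e_mult e(2) one_bcontfun.rep_eq H_cs h_scale
            clinear_scaleC[OF \<beta>_clinear] clinear_scaleC[OF e_clinear] mult_scaleC_right
            flip: action_assoc)
    qed
    have "h (c * \<gamma> (H (cs 1 a * \<beta> f * cs 1 b))) = hh (ss c a * \<Delta> (\<gamma> f) * ss 1 b)"
      unfolding \<gamma>_def 2[symmetric] 1[symmetric] using FG(3) by (metis comp_apply)
    also have "\<dots> = h (c * R (ss 1 a * \<Delta> (\<gamma> f) * ss 1 b))"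
      unfolding ss_split(1)[of c a] mult.assoc by (simp add: R_mult1 flip: hh_R)
    finally show "h (c * \<gamma> (H (cs 1 a * \<beta> f * cs 1 b))) = h (c * R (ss 1 a * \<Delta> (\<gamma> f) * ss 1 b))" .
  qed
  have commute: "f * g = g * f" for f g :: "'x \<Rightarrow>\<^sub>C complex"
    by (rule bcontfun_eqI) (simp add: times_bcontfun.rep_eq mult.commute)
  interpret commutative_coaction ss ss_s s_ss \<Delta> h L R cs \<beta> \<gamma> H
    by (intro commutative_coaction.intro commutative_coaction_axioms.intro cqg_haar_axioms
        CS.min_tensor commute action_hom action_density \<gamma>_hom \<gamma>_bounded H coideal)
  show ?thesis using K_central[of f b] by (simp add: \<gamma>_def)
qed

text \<open>Integrating the second leg first reduces an arbitrary \<open>\<omega>\<close> to an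
  equation between two functions on the space, which \<open>pointwise_central\<close> verifies at
  each point.\<close>

lemma slice_central:
  assumes \<omega>: "bounded_clinear \<omega>" and E: "left_slice cs \<omega> E"
  shows "h (E (\<beta> f) * b) = h (b * E (\<beta> f))"
proof -
  obtain H where H: "right_slice cs h H" using slice_H .
  have H_bounded: "bounded_linear H" and H_cs: "\<And>f s. H (cs f s) = h s *\<^sub>C f"
    using H by (simp_all add: right_slice_def bounded_clinear_def)
  have E_bounded: "bounded_linear E" and E_cs: "\<And>f s. E (cs f s) = \<omega> f *\<^sub>C s"
    using E by (simp_all add: left_slice_def bounded_clinear_def)
  have \<omega>_bounded: "bounded_linear \<omega>" and \<omega>_clinear: "clinear \<omega>"
    using \<omega> by (simp_all add: bounded_clinear_def)
  note bl = bounded_linear_intros bounded_linear_compose[OF E_bounded] bounded_linear_compose[OF H_bounded]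
    bounded_linear_compose[OF \<omega>_bounded]
  have 1: "h (E z * b) = \<omega> (H (z * cs 1 b))" for z
  proof (rule CS.eqI[where f = "\<lambda>z. h (E z * b)"])
    show "bounded_linear (\<lambda>z. h (E z * b))" "bounded_linear (\<lambda>z. \<omega> (H (z * cs 1 b)))"
      by (intro bl E_bounded)+
  qed (simp add: CS.mult E_cs H_cs mult_scaleC_left h_scale clinear_scaleC[OF \<omega>_clinear])
  have 2: "h (b * E z) = \<omega> (H (cs 1 b * z))" for z
  proof (rule CS.eqI[where f = "\<lambda>z. h (b * E z)"])
    show "bounded_linear (\<lambda>z. h (b * E z))" "bounded_linear (\<lambda>z. \<omega> (H (cs 1 b * z)))"
      by (intro bl E_bounded)+
  qed (simp add: CS.mult E_cs H_cs mult_scaleC_right h_scale clinear_scaleC[OF \<omega>_clinear])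
  have "H (\<beta> f * cs 1 b) = H (cs 1 b * \<beta> f)"
  proof (rule bcontfun_eqI)
    fix x
    obtain e where e: "bounded_clinear e" "\<And>f s. e (cs f s) = apply_bcontfun f x *\<^sub>C s"
      using slice_ev[of x] by metis
    have e_bounded: "bounded_linear e" using e(1) by (simp add: bounded_clinear_def)
    have ev_bounded: "bounded_linear (\<lambda>f :: 'x \<Rightarrow>\<^sub>C complex. apply_bcontfun f x)"
      by (rule pos_fun_bounded_linear[OF state_pos_fun[OF ev_state]])
    note bl' = bl bounded_linear_compose[OF e_bounded] bounded_linear_compose[OF ev_bounded]
    have 3: "apply_bcontfun (H (z * cs 1 b)) x = h (e z * b)" for z
    proof (rule CS.eqI[where f = "\<lambda>z. apply_bcontfun (H (z * cs 1 b)) x"])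
      show "bounded_linear (\<lambda>z. apply_bcontfun (H (z * cs 1 b)) x)" "bounded_linear (\<lambda>z. h (e z * b))"
        by (intro bl' e_bounded)+
    qed (simp add: CS.mult H_cs e(2) mult_scaleC_left h_scale scaleC_bcontfun.rep_eq mult.commute)
    have 4: "apply_bcontfun (H (cs 1 b * z)) x = h (b * e z)" for z
    proof (rule CS.eqI[where f = "\<lambda>z. apply_bcontfun (H (cs 1 b * z)) x"])
      show "bounded_linear (\<lambda>z. apply_bcontfun (H (cs 1 b * z)) x)" "bounded_linear (\<lambda>z. h (b * e z))"
        by (intro bl' e_bounded)+
    qed (simp add: CS.mult H_cs e(2) mult_scaleC_right h_scale scaleC_bcontfun.rep_eq mult.commute)
    show "apply_bcontfun (H (\<beta> f * cs 1 b)) x = apply_bcontfun (H (cs 1 b * \<beta> f)) x"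
      unfolding 3 4 by (rule pointwise_central[OF H e])
  qed
  then show ?thesis by (simp only: 1 2)
qed

lemma tracial_of_faithful:
  assumes "faithful_action cs \<beta>" shows "tracial h"
proof -
  define Z where "Z = {a. \<forall>b. h (a * b) = h (b * a)}"
  have sub: "star_subalgebra Z"
    unfolding star_subalgebra_def
  proof (intro conjI ballI)
    show "complex_vector.subspace Z"
      unfolding complex_vector.subspace_def Z_def
      by (auto simp: h_add h_scale distrib_left distrib_right mult_scaleC_left mult_scaleC_right)
    show "x * y \<in> Z" if "x \<in> Z" "y \<in> Z" for x y
    proof -
      have "h (x * y * b) = h (b * (x * y))" for b
      proof -
        have "h (x * (y * b)) = h (y * (b * x))" using that(1) by (simp add: Z_def mult.assoc)
        also have "\<dots> = h (b * x * y)" using that(2) by (simp add: Z_def)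
        finally show ?thesis by (simp add: mult.assoc)
      qed
      then show ?thesis by (simp add: Z_def)
    qed
    show "star x \<in> Z" if x: "x \<in> Z" for x
    proof -
      have "h (star x * b) = h (b * star x)" for b
      proof -
        have "h (star (star b * x)) = h (star (x * star b))"
          using x unfolding h_star by (simp add: Z_def)
        then show ?thesis by (simp add: star_mult)
      qed
      then show ?thesis by (simp add: Z_def)
    qed
  qed
  have "closed Z"
  proof -
    have "closed {a. h (a * b) = h (b * a)}" for b
    proof -
      have "bounded_linear (\<lambda>a. h (a * b))" "bounded_linear (\<lambda>a. h (b * a))"
        by (intro bounded_linear_intros)+
      then show ?thesis by (intro closed_Collect_eq linear_continuous_on)
    qed
    then show ?thesis unfolding Z_def by (intro closed_Collect_all) blast
  qed
  moreover have "star_subalgebra hull {E (\<beta> a) |E a. \<exists>\<omega>. bounded_clinear \<omega> \<and> left_slice cs \<omega> E} \<subseteq> Z"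
    by (rule hull_minimal[where S = star_subalgebra, OF _ sub]) (auto simp: Z_def slice_central)
  ultimately have "closure (star_subalgebra hull {E (\<beta> a) |E a. \<exists>\<omega>. bounded_clinear \<omega> \<and> left_slice cs \<omega> E}) \<subseteq> Z"
    by (rule closure_minimal[rotated])
  then have "Z = UNIV"
    using assms unfolding faithful_action_def by blast
  then show ?thesis by (auto simp: tracial_def Z_def)
qed

end

theorem theorem3p2:
  fixes ss :: "'s :: unital_cstar_algebra \<Rightarrow> 's \<Rightarrow> 'ss :: unital_cstar_algebra"
    and ss_s :: "'ss \<Rightarrow> 's \<Rightarrow> 'sss :: unital_cstar_algebra"
    and s_ss :: "'s \<Rightarrow> 'ss \<Rightarrow> 'sss"
    and \<Delta> :: "'s \<Rightarrow> 'ss"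
    and h :: "'s \<Rightarrow> complex"
    and cs :: "('x :: t2_space \<Rightarrow>\<^sub>C complex) \<Rightarrow> 's \<Rightarrow> 'cs :: unital_cstar_algebra"
    and cs_s :: "'cs \<Rightarrow> 's \<Rightarrow> 'css :: unital_cstar_algebra"
    and c_ss :: "('x \<Rightarrow>\<^sub>C complex) \<Rightarrow> 'ss \<Rightarrow> 'css"
    and \<beta> :: "('x \<Rightarrow>\<^sub>C complex) \<Rightarrow> 'cs"
  assumes "compact_quantum_group ss ss_s s_ss \<Delta>"
    and "haar_state ss \<Delta> h"
    and "faithful_functional h"
    and "compact (UNIV :: 'x set)"
    and "cqg_action ss ss_s s_ss \<Delta> cs cs_s c_ss \<beta>"
    and "faithful_action cs \<beta>"
  shows "kac_algebra ss \<Delta>"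
proof -
  obtain L R where LR: "left_slice ss h L" "right_slice ss h R"
    "\<And>a. R (\<Delta> a) = h a *\<^sub>C 1" "\<And>a. L (\<Delta> a) = h a *\<^sub>C 1"
    using assms(2) unfolding haar_state_def by blast
  have "is_state h" using assms(2) by (simp add: haar_state_def)
  then interpret cqg_haar ss ss_s s_ss \<Delta> h L R
    by (intro cqg_haar.intro cqg_haar_axioms.intro assms(1,3) LR)
  interpret function_action ss ss_s s_ss \<Delta> h L R cs cs_s c_ss \<beta>
    by (intro function_action.intro cqg_haar_axioms assms(5))
  have "tracial h" by (rule tracial_of_faithful[OF assms(6)])
  with assms(2) show ?thesis by (auto simp: kac_algebra_def)
qed

end
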